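(* Let $M\in\mathbb N$ and let $\varepsilon_M>0$ be such that $P^\varepsilon_N(\eta)\ge\frac\lambda2|\eta|^2$ for all $\eta\in K$, all $0<\varepsilon<\varepsilon_M$ and all $N\in\mathbb N$ with $N\le M$. Then for every $0<\varepsilon<\varepsilon_M$ with $K\subset Z/\varepsilon$ the effective optimal control problem $(\mathrm P^*_M)$ admits a unique optimal solution $(u^*_M,y^*_M)\in U^*_{ad}\times H^{2M}(\mathbb R^n)$.
   Context: **Bloch waves.** Let $n\in\mathbb N$, $Y=[0,1]^n$, $Z=[-\tfrac12,\tfrac12)^n$. $A\in L^\infty(\mathbb R^n;\mathbb R^{n\times n})$ is symmetric, uniformly elliptic and $Y$-periodic. For $\eta\in Z$ let $0\le\lambda_0(\eta)\le\lambda_1(\eta)\le\dots$ be the eigenvalues of $-(\nabla+2\pi i\eta)\cdot(A(\nabla+2\pi i\eta))$ on $Y$-periodic functions, with eigenfunctions $\Phi_m(\cdot;\eta)\in H^1_\sharp(Y;\mathbb C)$, $m\in\mathbb N_0$, forming an orthonormal basis of $L^2_\sharp(Y;\mathbb C)$ ($\sharp$: periodic functions), chosen measurable in $\eta$ and with $\Phi_m(\cdot;-\eta)=\overline{\Phi_m(\cdot;\eta)}$ for a.e. $\eta$. For $\eta\in Z/\varepsilon$ put $\omega^\varepsilon_m(x;\eta)=\Phi_m(x/\varepsilon;\varepsilon\eta)e^{2\pi i\eta\cdot x}$. The Bloch coefficients of $u\in L^2(\mathbb R^n;\mathbb C)$ are $\hat u^\varepsilon_m(\eta)=\int_{\mathbb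 R^n}u\,\overline{\omega^\varepsilon_m(\cdot;\eta)}\,dx$ ($L^2$ sense), so $u=\int_{Z/\varepsilon}\sum_m\hat u^\varepsilon_m(\eta)\omega^\varepsilon_m(\cdot;\eta)\,d\eta$. The Fourier transform is $\hat u(\eta)=\int u(x)e^{-2\pi ix\cdot\eta}dx$. $L^2(\mathbb R^n)$, $H^k(\mathbb R^n)$ denote real-valued functions. The adaption of $f\in L^2(\mathbb R^n;\mathbb C)$ is $\mathcal A^\varepsilon(f)=\int_{Z/\varepsilon}\hat f(\eta)\omega^\varepsilon_0(\cdot;\eta)\,d\eta$. **Data.** $\mu_1,\mu_2\ge0$, $\kappa>0$; $f,y_{d,1},y_{d,2}\in L^2(\mathbb R^n)$ have Fourier transforms supported in a compact set $K\subset\mathbb R^n$ with $-K=K$. **Admissible sets.** For each $\varepsilon>0$, $\emptyset\ne U^\varepsilon_{ad}\subset L^2(\mathbb R^n)$ satisfies: (i) $U^\varepsilon_{ad}$ is convex and closed. (ii) There is $u_0\in L^2(\mathbb R^n)$ with $\mathcal A^\varepsilon(u_0)\in U^\varepsilon_{ad}$ for every $\varepsilon>0$. (iii) For $u\in U^\varepsilon_{ad}$ the projection $u_K=\int_K\hat u^\varepsilon_0(\eta)\omega^\varepsilon_0(\cdot;\eta)\,d\eta$ lies in $U^\varepsilon_{ad}$. **Effective problem.** $\mathbb A^*_{2k}$ ($k\ge1$) are real tensors of order $2k$ with $\lambda_0(\eta)=\sum_{k=1}^M(2\pi)^{2k}\mathbb A^*_{2k}\cdot\eta^{\otimes2k}+O(|\eta|^{2M+2})$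 as $\eta\to0$ for each $M$ (Taylor expansion of the even function $\lambda_0$, analytic near $0$), where $\mathbb A^*_{2k}\cdot\eta^{\otimes2k}=\sum_{i_1,\dots,i_{2k}}(\mathbb A^*_{2k})_{i_1\dots i_{2k}}\eta_{i_1}\cdots\eta_{i_{2k}}$; $\mathbb A_2^*$ is symmetric positive definite and $\lambda>0$ satisfies $\mathbb A^*_2\cdot\eta^{\otimes2}\ge\lambda|\eta|^2$ for all $\eta$. $P^\varepsilon_N(\eta)=\sum_{k=1}^N\varepsilon^{2k-2}(2\pi)^{2k}\mathbb A^*_{2k}\cdot\eta^{\otimes2k}$. Let $\langle D^ky,D^ky\rangle_{\mathbb A^*_{2k}}=\sum(\mathbb A^*_{2k})_{i_1\dots i_{2k}}\,\partial^k_{x_{i_1}\dots x_{i_k}}y\;\partial^k_{x_{i_{k+1}}\dots x_{i_{2k}}}y$, $\mathbb A^*_{2k}D^{2k}=\sum(\mathbb A^*_{2k})_{i_1\dots i_{2k}}\partial^{2k}_{x_{i_1}\dots x_{i_{2k}}}$, $E^*_M(y)=\int_{\mathbb R^n}\sum_{k=1}^M\varepsilon^{2k-2}\langle D^ky,D^ky\rangle_{\mathbb A^*_{2k}}+|y|^2\,dx$, and $J^*_M(u,y)=\frac{\mu_1}2E^*_M(y-y_{d,1})+\frac{\mu_2}2\int|y-y_{d,2}|^2dx+\frac\kappa2\int|u|^2dx$. Problem $(\mathrm P^*_M)$: minimize $J^*_M(u,y)$ over $(u,y)\in U^*_{ad}\times H^{2M}(\mathbb R^n)$ subject to $\sum_{k=1}^M\varepsilon^{2k-2}(-1)^k\mathbb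 A^*_{2k}D^{2k}y+y=f+u$, where $U^*_{ad}=\{u=\int_K\hat u(\eta)e^{2\pi i\eta\cdot x}d\eta\;:\;\mathcal A^\varepsilon(u)\in U^\varepsilon_{ad}\}$. *)

theory Defs
  imports "HOL-Analysis.Analysis" "HOL-Library.Landau_Symbols"
begin

section \<open>Square-integrable functions\<close>

text \<open>
  Elements of \<open>L\<^sup>2\<close> are represented by Borel functions; two representatives of the same
  element agree almost everywhere with respect to \<^const>\<open>lborel\<close>.
\<close>

definition L2_on :: "(real^'n) set \<Rightarrow> (real^'n \<Rightarrow> 'b::{banach,second_countable_topology}) set" where
  "L2_on S = {u. u \<in> borel_measurable borel \<and> set_integrable lborel S (\<lambda>x. (norm (u x))\<^sup>2)}"

abbreviation L2 :: "(real^'n \<Rightarrow> 'b::{banach,second_countable_topology}) set" where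
  "L2 \<equiv> L2_on UNIV"

text \<open>The nonnegative integral keeps a difference of infinite norm from being read as zero.\<close>

definition L2_tendsto ::
  "(real^'n) set \<Rightarrow> ('i \<Rightarrow> real^'n \<Rightarrow> 'b::{banach,second_countable_topology})
    \<Rightarrow> (real^'n \<Rightarrow> 'b) \<Rightarrow> 'i filter \<Rightarrow> bool" where
  "L2_tendsto S u v F \<longleftrightarrow>
    ((\<lambda>i. \<integral>\<^sup>+x\<in>S. ennreal ((norm (u i x - v x))\<^sup>2) \<partial>lborel) \<longlongrightarrow> 0) F"

definition L2_closed :: "(real^'n \<Rightarrow> real) set \<Rightarrow> bool" where
  "L2_closed U \<longleftrightarrow>
    (\<forall>u v. (\<forall>k::nat. u k \<in> U) \<and> v \<in> L2 \<and> L2_tendsto UNIV u v sequentially \<longrightarrow> v \<in> U)"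

definition fun_convex :: "('a \<Rightarrow> real) set \<Rightarrow> bool" where
  "fun_convex U \<longleftrightarrow>
    (\<forall>u\<in>U. \<forall>v\<in>U. \<forall>t\<in>{0..1}. (\<lambda>x. (1 - t) * u x + t * v x) \<in> U)"

text \<open>
  A complex function, known up to null sets, belongs to a set of real \<open>L\<^sup>2\<close> functions;
  in particular it is real almost everywhere.
\<close>

definition ae_mem :: "(real^'n \<Rightarrow> complex) \<Rightarrow> (real^'n \<Rightarrow> real) set \<Rightarrow> bool" where
  "ae_mem g U \<longleftrightarrow> (\<exists>v\<in>U. AE x in lborel. g x = complex_of_real (v x))"


section \<open>Smooth functions and weak derivatives\<close>

definition partial_deriv :: "'n \<Rightarrow> (real^'n \<Rightarrow> real) \<Rightarrow> real^'n \<Rightarrow> real" where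
  "partial_deriv j f x = deriv (\<lambda>t. f (x + t *\<^sub>R axis j 1)) 0"

text \<open>The list \<open>[j\<^sub>1, \<dots>, j\<^sub>k]\<close> encodes the partial derivative of order \<open>k\<close> in the directions
  \<open>j\<^sub>1, \<dots>, j\<^sub>k\<close>.\<close>

definition partial_derivs :: "'n list \<Rightarrow> (real^'n \<Rightarrow> real) \<Rightarrow> real^'n \<Rightarrow> real" where
  "partial_derivs js f = foldr partial_deriv js f"

definition smooth :: "(real^'n \<Rightarrow> real) \<Rightarrow> bool" where
  "smooth f \<longleftrightarrow>
    (\<forall>js. continuous_on UNIV (partial_derivs js f) \<and>
      (\<forall>j x. (\<lambda>t. partial_derivs js f (x + t *\<^sub>R axis j 1)) field_differentiable at 0))"

definition test_function :: "(real^'n \<Rightarrow> real) \<Rightarrow> bool" where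
  "test_function \<phi> \<longleftrightarrow> smooth \<phi> \<and> compact (closure {x. \<phi> x \<noteq> 0})"

definition is_weak_deriv :: "'n list \<Rightarrow> (real^'n \<Rightarrow> real) \<Rightarrow> (real^'n \<Rightarrow> real) \<Rightarrow> bool" where
  "is_weak_deriv js u v \<longleftrightarrow>
    (\<forall>\<phi>. test_function \<phi> \<longrightarrow>
      (LINT x|lborel. u x * partial_derivs js \<phi> x) = (-1) ^ length js * (LINT x|lborel. v x * \<phi> x))"

definition Hk :: "nat \<Rightarrow> (real^'n \<Rightarrow> real) set" where
  "Hk k = {u \<in> L2. \<forall>js. length js \<le> k \<longrightarrow> (\<exists>v\<in>L2. is_weak_deriv js u v)}"

definition weak_deriv :: "'n list \<Rightarrow> (real^'n \<Rightarrow> real) \<Rightarrow> real^'n \<Rightarrow> real" where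
  "weak_deriv js u = (SOME v. v \<in> L2 \<and> is_weak_deriv js u v)"


section \<open>Periodic functions\<close>

definition Y_periodic :: "(real^'n \<Rightarrow> 'b) \<Rightarrow> bool" where
  "Y_periodic u \<longleftrightarrow> (\<forall>x k. (\<forall>i. k $ i \<in> \<int>) \<longrightarrow> u (x + k) = u x)"

definition Ycell :: "(real^'n) set" where
  "Ycell = {y. \<forall>i. 0 \<le> y $ i \<and> y $ i \<le> 1}"

definition Zcell :: "(real^'n) set" where
  "Zcell = {\<eta>. \<forall>i. - (1/2) \<le> \<eta> $ i \<and> \<eta> $ i < 1/2}"

text \<open>The scaled cell \<open>Z/\<epsilon>\<close>.\<close>

definition Zscaled :: "real \<Rightarrow> (real^'n) set" where
  "Zscaled \<epsilon> = {\<eta>. \<epsilon> *\<^sub>R \<eta> \<in> Zcell}"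

definition L2_per :: "(real^'n \<Rightarrow> complex) set" where
  "L2_per = {u \<in> L2_on Ycell. Y_periodic u}"

definition per_inner :: "(real^'n \<Rightarrow> complex) \<Rightarrow> (real^'n \<Rightarrow> complex) \<Rightarrow> complex" where
  "per_inner u v = (LINT y:Ycell|lborel. u y * cnj (v y))"

definition is_per_weak_deriv ::
  "'n \<Rightarrow> (real^'n \<Rightarrow> complex) \<Rightarrow> (real^'n \<Rightarrow> complex) \<Rightarrow> bool" where
  "is_per_weak_deriv j u v \<longleftrightarrow>
    (\<forall>\<phi>. smooth \<phi> \<and> Y_periodic \<phi> \<longrightarrow>
      (LINT y:Ycell|lborel. u y * complex_of_real (partial_deriv j \<phi> y))
        = - (LINT y:Ycell|lborel. v y * complex_of_real (\<phi> y)))"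

definition H1_per :: "(real^'n \<Rightarrow> complex) set" where
  "H1_per = {u \<in> L2_per. \<forall>j. \<exists>v\<in>L2_per. is_per_weak_deriv j u v}"

definition per_weak_deriv :: "'n \<Rightarrow> (real^'n \<Rightarrow> complex) \<Rightarrow> real^'n \<Rightarrow> complex" where
  "per_weak_deriv j u = (SOME v. v \<in> L2_per \<and> is_per_weak_deriv j u v)"


section \<open>Bloch waves\<close>

definition coefficient_field :: "(real^'n \<Rightarrow> real^'n^'n) \<Rightarrow> bool" where
  "coefficient_field A \<longleftrightarrow>
    A \<in> borel_measurable borel \<and>
    (\<exists>C. AE y in lborel. norm (A y) \<le> C) \<and>
    (AE y in lborel. transpose (A y) = A y) \<and>
    (\<exists>\<alpha>>0. AE y in lborel. \<forall>\<xi>. \<xi> \<bullet> (A y *v \<xi>) \<ge> \<alpha> * (norm \<xi>)\<^sup>2) \<and>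
    Y_periodic A"

text \<open>The \<open>j\<close>-th component of \<open>(\<nabla> + 2\<pi>i\<eta>)u\<close>.\<close>

definition shifted_grad :: "real^'n \<Rightarrow> 'n \<Rightarrow> (real^'n \<Rightarrow> complex) \<Rightarrow> real^'n \<Rightarrow> complex" where
  "shifted_grad \<eta> j u y = per_weak_deriv j u y + 2 * pi * \<i> * complex_of_real (\<eta> $ j) * u y"

text \<open>Eigenvalue equation for \<open>-(\<nabla> + 2\<pi>i\<eta>)\<cdot>(A(\<nabla> + 2\<pi>i\<eta>))\<close> on periodic functions, in the weak form
  appropriate for bounded measurable \<open>A\<close>.\<close>

definition bloch_eigen ::
  "(real^'n \<Rightarrow> real^'n^'n) \<Rightarrow> real^'n \<Rightarrow> real \<Rightarrow> (real^'n \<Rightarrow> complex) \<Rightarrow> bool" where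
  "bloch_eigen A \<eta> l u \<longleftrightarrow>
    u \<in> H1_per \<and>
    (\<forall>v\<in>H1_per.
      (LINT y:Ycell|lborel. \<Sum>i\<in>UNIV. \<Sum>j\<in>UNIV.
          complex_of_real (A y $ i $ j) * shifted_grad \<eta> j u y * cnj (shifted_grad \<eta> i v y))
        = complex_of_real l * per_inner u v)"

definition per_orthonormal_basis :: "(nat \<Rightarrow> real^'n \<Rightarrow> complex) \<Rightarrow> bool" where
  "per_orthonormal_basis e \<longleftrightarrow>
    (\<forall>m. e m \<in> L2_per) \<and>
    (\<forall>m k. per_inner (e m) (e k) = (if m = k then 1 else 0)) \<and>
    (\<forall>u\<in>L2_per. L2_tendsto Ycell (\<lambda>N y. \<Sum>m<N. per_inner u (e m) * e m y) u sequentially)"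

text \<open>
  \<open>lam m \<eta>\<close> and \<open>\<Phi> m y \<eta>\<close> are only constrained for \<open>\<eta>\<close> in the cell \<open>Z\<close>.  Because the eigenfunctions
  form an orthonormal basis, the values \<open>lam m \<eta>\<close> exhaust the spectrum, with multiplicity.
\<close>

definition bloch_system ::
  "(real^'n \<Rightarrow> real^'n^'n) \<Rightarrow> (nat \<Rightarrow> real^'n \<Rightarrow> real)
    \<Rightarrow> (nat \<Rightarrow> real^'n \<Rightarrow> real^'n \<Rightarrow> complex) \<Rightarrow> bool" where
  "bloch_system A lam \<Phi> \<longleftrightarrow>
    (\<forall>\<eta>\<in>Zcell. 0 \<le> lam 0 \<eta> \<and> (\<forall>m. lam m \<eta> \<le> lam (Suc m) \<eta>)
      \<and> (\<forall>m. bloch_eigen A \<eta> (lam m \<eta>) (\<lambda>y. \<Phi> m y \<eta>))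
      \<and> per_orthonormal_basis (\<lambda>m y. \<Phi> m y \<eta>)) \<and>
    (\<forall>m. set_borel_measurable borel (UNIV \<times> Zcell) (\<lambda>(y, \<eta>). \<Phi> m y \<eta>)) \<and>
    (\<forall>m. AE \<eta> in lborel. \<eta> \<in> Zcell \<longrightarrow> (AE y in lborel. \<Phi> m y (- \<eta>) = cnj (\<Phi> m y \<eta>)))"

definition bloch_wave ::
  "(nat \<Rightarrow> real^'n \<Rightarrow> real^'n \<Rightarrow> complex) \<Rightarrow> real \<Rightarrow> nat \<Rightarrow> real^'n \<Rightarrow> real^'n \<Rightarrow> complex" where
  "bloch_wave \<Phi> \<epsilon> m x \<eta> = \<Phi> m ((1 / \<epsilon>) *\<^sub>R x) (\<epsilon> *\<^sub>R \<eta>) * cis (2 * pi * (\<eta> \<bullet> x))"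

text \<open>The integral over \<open>\<real>\<^sup>n\<close> is the limit of integrals over balls in \<open>L\<^sup>2(Z/\<epsilon>)\<close>.\<close>

definition is_bloch_coeff ::
  "(nat \<Rightarrow> real^'n \<Rightarrow> real^'n \<Rightarrow> complex) \<Rightarrow> real \<Rightarrow> nat
    \<Rightarrow> (real^'n \<Rightarrow> complex) \<Rightarrow> (real^'n \<Rightarrow> complex) \<Rightarrow> bool" where
  "is_bloch_coeff \<Phi> \<epsilon> m u g \<longleftrightarrow>
    g \<in> L2_on (Zscaled \<epsilon>) \<and>
    L2_tendsto (Zscaled \<epsilon>)
      (\<lambda>R \<eta>. LINT x:cball 0 R|lborel. u x * cnj (bloch_wave \<Phi> \<epsilon> m x \<eta>)) g at_top"

definition bloch_coeff ::
  "(nat \<Rightarrow> real^'n \<Rightarrow> real^'n \<Rightarrow> complex) \<Rightarrow> real \<Rightarrow> nat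
    \<Rightarrow> (real^'n \<Rightarrow> complex) \<Rightarrow> real^'n \<Rightarrow> complex" where
  "bloch_coeff \<Phi> \<epsilon> m u = (SOME g. is_bloch_coeff \<Phi> \<epsilon> m u g)"


section \<open>Fourier transform and adaption\<close>

definition is_fourier :: "(real^'n \<Rightarrow> complex) \<Rightarrow> (real^'n \<Rightarrow> complex) \<Rightarrow> bool" where
  "is_fourier u g \<longleftrightarrow>
    g \<in> L2 \<and>
    L2_tendsto UNIV (\<lambda>R \<eta>. LINT x:cball 0 R|lborel. u x * cis (- 2 * pi * (x \<bullet> \<eta>))) g at_top"

definition fourier :: "(real^'n \<Rightarrow> complex) \<Rightarrow> real^'n \<Rightarrow> complex" where
  "fourier u = (SOME g. is_fourier u g)"

abbreviation rfourier :: "(real^'n \<Rightarrow> real) \<Rightarrow> real^'n \<Rightarrow> complex" where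
  "rfourier u \<equiv> fourier (\<lambda>x. complex_of_real (u x))"

definition fourier_supported_in :: "(real^'n) set \<Rightarrow> (real^'n \<Rightarrow> real) \<Rightarrow> bool" where
  "fourier_supported_in K u \<longleftrightarrow> (AE \<eta> in lborel. \<eta> \<notin> K \<longrightarrow> rfourier u \<eta> = 0)"

text \<open>
  For \<open>\<eta>\<close>-integrals over bounded sets the integrand is Lebesgue integrable for almost every \<open>x\<close>, so
  no limit is needed in the next two definitions.
\<close>

definition adaption ::
  "(nat \<Rightarrow> real^'n \<Rightarrow> real^'n \<Rightarrow> complex) \<Rightarrow> real \<Rightarrow> (real^'n \<Rightarrow> complex) \<Rightarrow> real^'n \<Rightarrow> complex" where
  "adaption \<Phi> \<epsilon> f x = (LINT \<eta>:Zscaled \<epsilon>|lborel. fourier f \<eta> * bloch_wave \<Phi> \<epsilon> 0 x \<eta>)"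

abbreviation radaption ::
  "(nat \<Rightarrow> real^'n \<Rightarrow> real^'n \<Rightarrow> complex) \<Rightarrow> real \<Rightarrow> (real^'n \<Rightarrow> real) \<Rightarrow> real^'n \<Rightarrow> complex" where
  "radaption \<Phi> \<epsilon> u \<equiv> adaption \<Phi> \<epsilon> (\<lambda>x. complex_of_real (u x))"

text \<open>Bloch coefficients live on \<open>Z/\<epsilon>\<close> only, whence the intersection; it is \<open>K\<close> itself as soon as
  \<open>K \<subseteq> Z/\<epsilon>\<close>.\<close>

definition bloch_projection ::
  "(nat \<Rightarrow> real^'n \<Rightarrow> real^'n \<Rightarrow> complex) \<Rightarrow> real \<Rightarrow> (real^'n) set
    \<Rightarrow> (real^'n \<Rightarrow> real) \<Rightarrow> real^'n \<Rightarrow> complex" where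
  "bloch_projection \<Phi> \<epsilon> K u x =
    (LINT \<eta>:K \<inter> Zscaled \<epsilon>|lborel.
      bloch_coeff \<Phi> \<epsilon> 0 (\<lambda>x. complex_of_real (u x)) \<eta> * bloch_wave \<Phi> \<epsilon> 0 x \<eta>)"


section \<open>Admissible sets\<close>

text \<open>Applied to constant sequences, \<^const>\<open>L2_closed\<close> makes each \<open>U \<epsilon>\<close> invariant under changes on
  null sets, so \<open>U \<epsilon>\<close> is a set of \<open>L\<^sup>2\<close> classes.\<close>

definition admissible_sets ::
  "(nat \<Rightarrow> real^'n \<Rightarrow> real^'n \<Rightarrow> complex) \<Rightarrow> (real^'n) set
    \<Rightarrow> (real \<Rightarrow> (real^'n \<Rightarrow> real) set) \<Rightarrow> bool" where
  "admissible_sets \<Phi> K U \<longleftrightarrow>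
    (\<forall>\<epsilon>>0. U \<epsilon> \<noteq> {} \<and> U \<epsilon> \<subseteq> L2 \<and> fun_convex (U \<epsilon>) \<and> L2_closed (U \<epsilon>)) \<and>
    (\<exists>u0\<in>L2. \<forall>\<epsilon>>0. ae_mem (radaption \<Phi> \<epsilon> u0) (U \<epsilon>)) \<and>
    (\<forall>\<epsilon>>0. \<forall>u\<in>U \<epsilon>. ae_mem (bloch_projection \<Phi> \<epsilon> K u) (U \<epsilon>))"

definition U_star ::
  "(nat \<Rightarrow> real^'n \<Rightarrow> real^'n \<Rightarrow> complex) \<Rightarrow> (real^'n) set
    \<Rightarrow> (real \<Rightarrow> (real^'n \<Rightarrow> real) set) \<Rightarrow> real \<Rightarrow> (real^'n \<Rightarrow> real) set" where
  "U_star \<Phi> K U \<epsilon> =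
    {u \<in> L2.
      (AE x in lborel. complex_of_real (u x)
         = (LINT \<eta>:K|lborel. rfourier u \<eta> * cis (2 * pi * (\<eta> \<bullet> x)))) \<and>
      ae_mem (radaption \<Phi> \<epsilon> u) (U \<epsilon>)}"


section \<open>Effective problem\<close>

text \<open>
  The entry of a tensor of order \<open>2k\<close> at \<open>(i\<^sub>1, \<dots>, i\<^sub>2\<^sub>k)\<close> is its value at the list of these
  indices.  A family \<open>T\<close> of such tensors is indexed by \<open>k\<close>: \<open>T k\<close> has order \<open>2k\<close>, and only lists of
  length \<open>2k\<close> are ever used.
\<close>

type_synonym 'n tensors = "nat \<Rightarrow> 'n list \<Rightarrow> real"

definition tensor_apply :: "'n::finite tensors \<Rightarrow> nat \<Rightarrow> real^'n \<Rightarrow> real" where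
  "tensor_apply T k \<eta> = (\<Sum>js | length js = 2 * k. T k js * prod_list (map (\<lambda>j. \<eta> $ j) js))"

definition effective_tensors ::
  "(real^'n \<Rightarrow> real) \<Rightarrow> 'n::finite tensors \<Rightarrow> real \<Rightarrow> bool" where
  "effective_tensors lam0 T c \<longleftrightarrow>
    (\<forall>M\<ge>1. (\<lambda>\<eta>. lam0 \<eta> - (\<Sum>k=1..M. (2 * pi) ^ (2 * k) * tensor_apply T k \<eta>))
        \<in> O[at 0](\<lambda>\<eta>. norm \<eta> ^ (2 * M + 2))) \<and>
    (\<forall>i j. T 1 [i, j] = T 1 [j, i]) \<and>
    (\<forall>\<eta>. \<eta> \<noteq> 0 \<longrightarrow> tensor_apply T 1 \<eta> > 0) \<and>
    c > 0 \<and> (\<forall>\<eta>. tensor_apply T 1 \<eta> \<ge> c * (norm \<eta>)\<^sup>2)"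

definition Psym :: "'n::finite tensors \<Rightarrow> real \<Rightarrow> nat \<Rightarrow> real^'n \<Rightarrow> real" where
  "Psym T \<epsilon> N \<eta> = (\<Sum>k=1..N. \<epsilon> ^ (2 * k - 2) * (2 * pi) ^ (2 * k) * tensor_apply T k \<eta>)"

definition tensor_energy ::
  "'n::finite tensors \<Rightarrow> nat \<Rightarrow> (real^'n \<Rightarrow> real) \<Rightarrow> real^'n \<Rightarrow> real" where
  "tensor_energy T k y x =
    (\<Sum>js | length js = 2 * k. T k js * weak_deriv (take k js) y x * weak_deriv (drop k js) y x)"

definition tensor_diff ::
  "'n::finite tensors \<Rightarrow> nat \<Rightarrow> (real^'n \<Rightarrow> real) \<Rightarrow> real^'n \<Rightarrow> real" where
  "tensor_diff T k y x = (\<Sum>js | length js = 2 * k. T k js * weak_deriv js y x)"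

definition E_star :: "'n::finite tensors \<Rightarrow> real \<Rightarrow> nat \<Rightarrow> (real^'n \<Rightarrow> real) \<Rightarrow> real" where
  "E_star T \<epsilon> M y =
    (LINT x|lborel. (\<Sum>k=1..M. \<epsilon> ^ (2 * k - 2) * tensor_energy T k y x) + \<bar>y x\<bar>\<^sup>2)"

definition J_star ::
  "'n::finite tensors \<Rightarrow> real \<Rightarrow> nat \<Rightarrow> real \<Rightarrow> real \<Rightarrow> real
    \<Rightarrow> (real^'n \<Rightarrow> real) \<Rightarrow> (real^'n \<Rightarrow> real) \<Rightarrow> (real^'n \<Rightarrow> real) \<Rightarrow> (real^'n \<Rightarrow> real) \<Rightarrow> real" where
  "J_star T \<epsilon> M \<mu>1 \<mu>2 \<kappa> yd1 yd2 u y =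
    \<mu>1 / 2 * E_star T \<epsilon> M (\<lambda>x. y x - yd1 x)
    + \<mu>2 / 2 * (LINT x|lborel. \<bar>y x - yd2 x\<bar>\<^sup>2)
    + \<kappa> / 2 * (LINT x|lborel. \<bar>u x\<bar>\<^sup>2)"

definition state_equation ::
  "'n::finite tensors \<Rightarrow> real \<Rightarrow> nat \<Rightarrow> (real^'n \<Rightarrow> real)
    \<Rightarrow> (real^'n \<Rightarrow> real) \<Rightarrow> (real^'n \<Rightarrow> real) \<Rightarrow> bool" where
  "state_equation T \<epsilon> M f u y \<longleftrightarrow>
    (AE x in lborel.
      (\<Sum>k=1..M. \<epsilon> ^ (2 * k - 2) * (-1) ^ k * tensor_diff T k y x) + y x = f x + u x)"

definition P_star_feasible ::
  "'n::finite tensors \<Rightarrow> real \<Rightarrow> nat \<Rightarrow> (real^'n \<Rightarrow> real) \<Rightarrow> (real^'n \<Rightarrow> real) set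
    \<Rightarrow> (real^'n \<Rightarrow> real) \<Rightarrow> (real^'n \<Rightarrow> real) \<Rightarrow> bool" where
  "P_star_feasible T \<epsilon> M f Uad u y \<longleftrightarrow>
    u \<in> Uad \<and> y \<in> Hk (2 * M) \<and> state_equation T \<epsilon> M f u y"

definition P_star_optimal ::
  "'n::finite tensors \<Rightarrow> real \<Rightarrow> nat \<Rightarrow> real \<Rightarrow> real \<Rightarrow> real
    \<Rightarrow> (real^'n \<Rightarrow> real) \<Rightarrow> (real^'n \<Rightarrow> real) \<Rightarrow> (real^'n \<Rightarrow> real)
    \<Rightarrow> (real^'n \<Rightarrow> real) set \<Rightarrow> (real^'n \<Rightarrow> real) \<Rightarrow> (real^'n \<Rightarrow> real) \<Rightarrow> bool" where
  "P_star_optimal T \<epsilon> M \<mu>1 \<mu>2 \<kappa> f yd1 yd2 Uad u y \<longleftrightarrow>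
    P_star_feasible T \<epsilon> M f Uad u y \<and>
    (\<forall>u' y'. P_star_feasible T \<epsilon> M f Uad u' y' \<longrightarrow>
      J_star T \<epsilon> M \<mu>1 \<mu>2 \<kappa> yd1 yd2 u y \<le> J_star T \<epsilon> M \<mu>1 \<mu>2 \<kappa> yd1 yd2 u' y')"

end

theory Submission
  imports Defs
begin

text \<open>
  The effective operator has constant coefficients.  On the Fourier side the state equation is therefore
  multiplication by the polynomial \<open>P + 1\<close> with \<open>P = Psym T \<epsilon> M\<close>, and the energy is integration of
  the squared modulus of the transform against \<open>P + 1\<close> (\<open>state_equation_fourier\<close>, \<open>E_star_fourier\<close>).
  On \<open>K\<close> the hypothesis gives \<open>P \<ge> 0\<close>.  Off \<open>K\<close> the right-hand side has no frequencies, and the zeros of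
  \<open>P + 1\<close> form a null set, because on every ray \<open>P + 1\<close> is a polynomial with value \<open>1\<close> at the origin.
  Hence each control has exactly one state in \<open>Hk (2 * M)\<close>, and this state has its frequencies in \<open>K\<close>
  (\<open>state_fourier\<close>, \<open>state_exists\<close>).  After elimination of the state the cost is a sum of squared norms of
  affine functions of the control, among them the control cost with the factor \<open>\<kappa> > 0\<close>.  It is continuous and
  strictly convex with a quantitative bound, so minimizing sequences in a nonempty convex closed set are
  Cauchy and converge to the unique minimizer (\<open>L2_strictly_convex_minimizer\<close>).

  It remains to see that the set of admissible controls \<open>U_star\<close> is nonempty, convex and closed.  This rests on
  the fact that superposition of Bloch waves of the lowest band is an isometry from coefficients on
  \<open>Zscaled \<epsilon>\<close> into \<open>L2\<close> (\<open>isometric_kernel_bloch_wave\<close>).  So the adaption is linear and continuous, which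
  gives convexity and closedness.  An isometry is inverted by its adjoint, so the Bloch coefficients of the
  adaption of \<open>u0\<close> are the Fourier coefficients of \<open>u0\<close> (\<open>bloch_coeff_synth\<close>); the projection of this
  adaption to \<open>K\<close> is then the adaption of the band-limited part of \<open>u0\<close>, which belongs to \<open>U_star\<close>.

  The isometry is Parseval's identity for Fourier series on a cell in disguise: the values of a superposition
  of modulated periodic functions at the lattice translates of a point are Fourier coefficients
  (\<open>isometric_kernel_modulated\<close>).  Constant periodic functions at small scale \<open>\<epsilon>\<close> turn the same statement into
  Plancherel's theorem, so that the Fourier transform on \<open>L2\<close>, its inversion for band-limited functions and
  the recovery of Bloch coefficients all come from one source.  Parseval's identity follows from the
  Stone-Weierstrass theorem on the torus and the completeness of \<open>L2\<close>.  Weak derivatives are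
  identified with Fourier multipliers by pairing with translated bump functions
  (\<open>is_weak_deriv_fourierI\<close>, \<open>is_weak_deriv_fourierD\<close>).
\<close>

section \<open>The Hilbert space of square-integrable functions\<close>

text \<open>On functions outside \<open>L2\<close> these two quantities carry no information, since a divergent integral is
  read as zero; this is why the estimates below assume membership in \<open>L2\<close>.\<close>

definition L2norm :: "(real^'n \<Rightarrow> 'b::{banach,second_countable_topology}) \<Rightarrow> real" where
  "L2norm u = sqrt (LINT x|lborel. (norm (u x))\<^sup>2)"

definition L2inner :: "(real^'n \<Rightarrow> complex) \<Rightarrow> (real^'n \<Rightarrow> complex) \<Rightarrow> complex" where
  "L2inner u v = (LINT x|lborel. u x * cnj (v x))"

lemma cnj_measurable [measurable]: "cnj \<in> borel_measurable borel"
  by (rule borel_measurable_continuous_onI) (intro continuous_intros)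

lemma mult_le_sum_squares: "a * b \<le> a\<^sup>2 + (b::real)\<^sup>2"
  using zero_le_power2[of a] zero_le_power2[of b] zero_le_power2[of "a - b"] power2_diff[of a b]
  by linarith

lemma L2_iff:
  "u \<in> L2 \<longleftrightarrow> u \<in> borel_measurable borel \<and> integrable lborel (\<lambda>x. (norm (u x))\<^sup>2)"
  by (simp add: L2_on_def set_integrable_def)

lemma L2_measurable [measurable_dest]: "u \<in> L2 \<Longrightarrow> u \<in> borel_measurable borel"
  by (simp add: L2_iff)

lemma L2_integrable: "u \<in> L2 \<Longrightarrow> integrable lborel (\<lambda>x. (norm (u x))\<^sup>2)"
  by (simp add: L2_iff)

lemma L2_iff_nn:
  "u \<in> L2 \<longleftrightarrow> u \<in> borel_measurable borel \<and> (\<integral>\<^sup>+x. ennreal ((norm (u x))\<^sup>2) \<partial>lborel) < \<infinity>"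
  unfolding L2_iff by (auto simp: integrable_iff_bounded)

lemma L2norm_nonneg [simp]: "0 \<le> L2norm u"
  by (simp add: L2norm_def)

lemma L2norm_power2: "(L2norm u)\<^sup>2 = (LINT x|lborel. (norm (u x))\<^sup>2)"
  by (simp add: L2norm_def)

lemma nn_integral_L2norm:
  "u \<in> L2 \<Longrightarrow> (\<integral>\<^sup>+x. ennreal ((norm (u x))\<^sup>2) \<partial>lborel) = ennreal ((L2norm u)\<^sup>2)"
  by (simp add: L2norm_power2 nn_integral_eq_integral L2_integrable)

lemma L2norm_le_nn:
  assumes "(\<integral>\<^sup>+x. ennreal ((norm (u x))\<^sup>2) \<partial>lborel) \<le> ennreal (c\<^sup>2)" "u \<in> L2" "0 \<le> c"
  shows "L2norm u \<le> c"
proof (rule power2_le_imp_le)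
  show "(L2norm u)\<^sup>2 \<le> c\<^sup>2" using assms(1) unfolding nn_integral_L2norm[OF assms(2)] by simp
qed fact

lemma L2norm_cong: "(\<And>x. norm (u x) = norm (v x)) \<Longrightarrow> L2norm u = L2norm v"
  by (simp add: L2norm_def)

lemma L2norm_cong_AE:
  assumes "u \<in> L2" "v \<in> L2" "AE x in lborel. u x = v x" shows "L2norm u = L2norm v"
proof -
  have [measurable]: "u \<in> borel_measurable borel" "v \<in> borel_measurable borel"
    using assms by auto
  have "(LINT x|lborel. (norm (u x))\<^sup>2) = (LINT x|lborel. (norm (v x))\<^sup>2)"
    by (rule integral_cong_AE) (use assms(3) in auto)
  then show ?thesis by (simp add: L2norm_def)
qed

lemma L2_bound:
  assumes "u \<in> L2" "v \<in> borel_measurable borel" "\<And>x. norm (v x) \<le> C * norm (u x)"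
  shows "v \<in> L2" "0 \<le> C \<Longrightarrow> L2norm v \<le> C * L2norm u"
proof -
  have [measurable]: "u \<in> borel_measurable borel" "v \<in> borel_measurable borel"
    using assms by auto
  have le: "(norm (v x))\<^sup>2 \<le> C\<^sup>2 * (norm (u x))\<^sup>2" for x
    using power_mono[OF assms(3), of x 2] by (simp add: power_mult_distrib)
  have int: "integrable lborel (\<lambda>x. C\<^sup>2 * (norm (u x))\<^sup>2)"
    using L2_integrable[OF assms(1)] by simp
  have iv: "integrable lborel (\<lambda>x. (norm (v x))\<^sup>2)"
    by (rule Bochner_Integration.integrable_bound[OF int]) (use le in auto)
  then show "v \<in> L2" by (simp add: L2_iff)
  assume C: "0 \<le> C"
  have "(L2norm v)\<^sup>2 \<le> (C * L2norm u)\<^sup>2"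
    unfolding power_mult_distrib L2norm_power2
    using integral_mono[OF iv int le] by simp
  then show "L2norm v \<le> C * L2norm u"
    using C by - (rule power2_le_imp_le, auto)
qed

lemma L2_add:
  assumes "u \<in> L2" "v \<in> L2" shows "(\<lambda>x. u x + v x) \<in> L2"
proof -
  have [measurable]: "u \<in> borel_measurable borel" "v \<in> borel_measurable borel"
    using assms by auto
  have le: "(norm (u x + v x))\<^sup>2 \<le> 2 * (norm (u x))\<^sup>2 + 2 * (norm (v x))\<^sup>2" for x
  proof -
    have "(norm (u x + v x))\<^sup>2 \<le> (norm (u x) + norm (v x))\<^sup>2"
      by (intro power_mono norm_triangle_ineq) auto
    also have "\<dots> \<le> 2 * (norm (u x))\<^sup>2 + 2 * (norm (v x))\<^sup>2"
      using zero_le_power2[of "norm (u x) - norm (v x)"] by (simp add: power2_eq_square algebra_simps)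
    finally show ?thesis .
  qed
  have "integrable lborel (\<lambda>x. (norm (u x + v x))\<^sup>2)"
    by (rule Bochner_Integration.integrable_bound
        [where f="\<lambda>x. 2 * (norm (u x))\<^sup>2 + 2 * (norm (v x))\<^sup>2"])
      (use le assms[THEN L2_integrable] in auto)
  then show ?thesis by (simp add: L2_iff)
qed

lemma L2_zero: "(\<lambda>x. 0) \<in> L2"
  by (simp add: L2_iff)

lemma L2_uminus: "u \<in> L2 \<Longrightarrow> (\<lambda>x. - u x) \<in> L2"
  by (rule L2_bound(1)[where C=1 and u=u]) auto

lemma L2_diff: "u \<in> L2 \<Longrightarrow> v \<in> L2 \<Longrightarrow> (\<lambda>x. u x - v x) \<in> L2"
  using L2_add[OF _ L2_uminus, of u v] by simp

lemma L2_scaleR: "u \<in> L2 \<Longrightarrow> (\<lambda>x. c *\<^sub>R u x) \<in> L2"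
  by (rule L2_bound(1)[where C="\<bar>c\<bar>" and u=u]) auto

lemma L2_cmult: "u \<in> L2 \<Longrightarrow> (\<lambda>x. c * u x) \<in> L2" for u :: "real^'n \<Rightarrow> 'b::{real_normed_field,banach,second_countable_topology}"
  by (rule L2_bound(1)[where C="norm c" and u=u]) (auto simp: norm_mult)

lemma L2_sum: "(\<And>i. i \<in> I \<Longrightarrow> u i \<in> L2) \<Longrightarrow> (\<lambda>x. \<Sum>i\<in>I. u i x) \<in> L2"
  by (induction I rule: infinite_finite_induct) (auto intro: L2_add simp: L2_zero)

lemma L2_indicator: "u \<in> L2 \<Longrightarrow> S \<in> sets borel \<Longrightarrow> (\<lambda>x. indicator S x *\<^sub>R u x) \<in> L2"
  by (rule L2_bound(1)[where C=1 and u=u]) (auto simp: indicator_def)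

lemma L2norm_scaleR: "L2norm (\<lambda>x. c *\<^sub>R u x) = \<bar>c\<bar> * L2norm u"
  by (simp add: L2norm_def power_mult_distrib real_sqrt_mult)

lemma L2norm_cmult: "L2norm (\<lambda>x. c * u x) = norm c * L2norm u"
  for u :: "real^'n \<Rightarrow> 'b::{real_normed_field,banach,second_countable_topology}"
  by (simp add: L2norm_def power_mult_distrib real_sqrt_mult norm_mult)

lemma L2norm_diff_commute: "L2norm (\<lambda>x. u x - v x) = L2norm (\<lambda>x. v x - u x)"
  by (rule L2norm_cong) (rule norm_minus_commute)

lemma L2_of_real: "(\<lambda>x. complex_of_real (u x)) \<in> L2 \<longleftrightarrow> u \<in> L2"
proof
  assume "(\<lambda>x. complex_of_real (u x)) \<in> L2"
  then show "u \<in> L2"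
  proof (rule L2_bound(1)[where C=1 and u="\<lambda>x. complex_of_real (u x)"])
    have "(\<lambda>x. Re (complex_of_real (u x))) \<in> borel_measurable borel"
      by (intro borel_measurable_continuous_on[OF continuous_on_Re[OF continuous_on_id]]
          L2_measurable[OF \<open>(\<lambda>x. complex_of_real (u x)) \<in> L2\<close>])
    then show "u \<in> borel_measurable borel" by simp
  qed auto
next
  assume "u \<in> L2" then show "(\<lambda>x. complex_of_real (u x)) \<in> L2"
    by - (rule L2_bound(1)[where u=u and C=1], auto)
qed

lemma L2_indicator_finite:
  assumes "S \<in> sets borel" "emeasure lborel S < \<infinity>"
  shows "(\<lambda>x. complex_of_real (indicator S x)) \<in> L2"
  unfolding L2_of_real L2_iff
proof
  have "(\<lambda>x. (norm (indicator S x :: real))\<^sup>2) = indicator S" by (auto simp: indicator_def)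
  then show "integrable lborel (\<lambda>x. (norm (indicator S x :: real))\<^sup>2)" using assms by simp
qed (use assms in simp)

lemma L2_Re: "u \<in> L2 \<Longrightarrow> (\<lambda>x. Re (u x)) \<in> L2"
  by (rule L2_bound(1)[where C=1 and u=u]) (auto simp: abs_Re_le_cmod)

lemma L2_cnj: "u \<in> L2 \<Longrightarrow> (\<lambda>x. cnj (u x)) \<in> L2"
  by (rule L2_bound(1)[where C=1 and u=u])
    (auto intro: borel_measurable_continuous_on[OF continuous_on_cnj[OF continuous_on_id]])

lemma L2_mult_integrable:
  fixes u v :: "real^'n \<Rightarrow> 'b::{real_normed_field,banach,second_countable_topology}"
  assumes "u \<in> L2" "v \<in> L2" shows "integrable lborel (\<lambda>x. u x * v x)"
proof -
  have [measurable]: "u \<in> borel_measurable borel" "v \<in> borel_measurable borel"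
    using assms by auto
  have "norm (u x * v x) \<le> (norm (u x))\<^sup>2 + (norm (v x))\<^sup>2" for x
    unfolding norm_mult using zero_le_power2[of "norm (u x) - norm (v x)"]
      mult_nonneg_nonneg[of "norm (u x)" "norm (v x)"]
    by (simp add: power2_eq_square algebra_simps del: mult_nonneg_nonneg)
  then show ?thesis
    by (intro Bochner_Integration.integrable_bound
        [where f="\<lambda>x. (norm (u x))\<^sup>2 + (norm (v x))\<^sup>2" and g="\<lambda>x. u x * v x"])
      (use assms[THEN L2_integrable] in \<open>auto\<close>)
qed

lemma L2_inner_integrable:
  "u \<in> L2 \<Longrightarrow> v \<in> L2 \<Longrightarrow> integrable lborel (\<lambda>x. u x * cnj (v x))"
  by (rule L2_mult_integrable[OF _ L2_cnj])

lemma L2_finite_integrable: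
  fixes u :: "real^'n \<Rightarrow> complex"
  assumes "u \<in> L2" "S \<in> sets borel" "emeasure lborel S < \<infinity>"
  shows "integrable lborel (\<lambda>x. indicator S x *\<^sub>R u x)"
  using L2_mult_integrable[OF L2_indicator_finite[OF assms(2,3)] assms(1)]
  by (simp add: scaleR_conv_of_real)

lemma L2_Cauchy_Schwarz_norm:
  assumes "u \<in> L2" "v \<in> L2"
  shows "(LINT x|lborel. norm (u x) * norm (v x)) \<le> L2norm u * L2norm v"
proof -
  have [measurable]: "u \<in> borel_measurable borel" "v \<in> borel_measurable borel"
    using assms by auto
  have u': "(\<lambda>x. norm (u x)) \<in> L2" "(\<lambda>x. norm (v x)) \<in> L2"
    by (rule L2_bound(1)[where C=1, OF assms(1)], simp_all, rule L2_bound(1)[where C=1, OF assms(2)], simp_all)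
  have i: "integrable lborel (\<lambda>x. norm (u x) * norm (v x))"
    by (rule L2_mult_integrable[OF u'])
  let ?I = "LINT x|lborel. norm (u x) * norm (v x)"
  have I0: "0 \<le> ?I" by simp
  have "ennreal (?I\<^sup>2) = (\<integral>\<^sup>+x. ennreal (norm (u x)) * ennreal (norm (v x)) \<partial>lborel)\<^sup>2"
    using nn_integral_eq_integral[OF i] I0 by (simp add: ennreal_mult ennreal_power)
  also have "\<dots> \<le> (\<integral>\<^sup>+x. (ennreal (norm (u x)))\<^sup>2 \<partial>lborel) * (\<integral>\<^sup>+x. (ennreal (norm (v x)))\<^sup>2 \<partial>lborel)"
    by (rule Cauchy_Schwarz_nn_integral) auto
  also have "\<dots> = ennreal ((L2norm u)\<^sup>2 * (L2norm v)\<^sup>2)"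
    using assms[THEN nn_integral_L2norm] by (simp add: ennreal_power ennreal_mult)
  finally have "?I\<^sup>2 \<le> (L2norm u * L2norm v)\<^sup>2"
    by (simp add: power_mult_distrib)
  then show ?thesis by - (rule power2_le_imp_le, auto)
qed

lemma L2_Cauchy_Schwarz:
  assumes "u \<in> L2" "v \<in> L2" shows "norm (L2inner u v) \<le> L2norm u * L2norm v"
proof -
  have "norm (L2inner u v) \<le> (LINT x|lborel. norm (u x * cnj (v x)))"
    unfolding L2inner_def by (rule integral_norm_bound)
  also have "\<dots> = (LINT x|lborel. norm (u x) * norm (v x))" by (simp add: norm_mult)
  finally show ?thesis using L2_Cauchy_Schwarz_norm[OF assms] by linarith
qed

lemma L2norm_triangle:
  assumes "u \<in> L2" "v \<in> L2" shows "L2norm (\<lambda>x. u x + v x) \<le> L2norm u + L2norm v"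
proof -
  have [measurable]: "u \<in> borel_measurable borel" "v \<in> borel_measurable borel"
    using assms by auto
  have u': "(\<lambda>x. norm (u x)) \<in> L2" "(\<lambda>x. norm (v x)) \<in> L2"
    by (rule L2_bound(1)[where C=1, OF assms(1)], simp_all, rule L2_bound(1)[where C=1, OF assms(2)], simp_all)
  note i = L2_mult_integrable[OF u'] assms[THEN L2_integrable] L2_add[OF assms, THEN L2_integrable]
  have "(L2norm (\<lambda>x. u x + v x))\<^sup>2
      \<le> (LINT x|lborel. (norm (u x))\<^sup>2 + 2 * (norm (u x) * norm (v x)) + (norm (v x))\<^sup>2)"
    unfolding L2norm_power2
  proof (rule integral_mono)
    show "(norm (u x + v x))\<^sup>2 \<le> (norm (u x))\<^sup>2 + 2 * (norm (u x) * norm (v x)) + (norm (v x))\<^sup>2" for x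
      using power_mono[OF norm_triangle_ineq[of "u x" "v x"], of 2]
      by (simp add: power2_eq_square algebra_simps)
  qed (use i in auto)
  also have "\<dots> = (L2norm u)\<^sup>2 + 2 * (LINT x|lborel. norm (u x) * norm (v x)) + (L2norm v)\<^sup>2"
    using i by (simp add: L2norm_power2)
  also have "\<dots> \<le> (L2norm u + L2norm v)\<^sup>2"
    using L2_Cauchy_Schwarz_norm[OF assms] by (simp add: power2_eq_square algebra_simps)
  finally show ?thesis by - (rule power2_le_imp_le, auto)
qed

lemma L2norm_triangle_diff:
  assumes "u \<in> L2" "v \<in> L2" "w \<in> L2"
  shows "L2norm (\<lambda>x. u x - w x) \<le> L2norm (\<lambda>x. u x - v x) + L2norm (\<lambda>x. v x - w x)"
  using L2norm_triangle[OF L2_diff[OF assms(1,2)] L2_diff[OF assms(2,3)]] by simp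

lemma L2norm_diff_ineq:
  assumes "u \<in> L2" "v \<in> L2" shows "\<bar>L2norm u - L2norm v\<bar> \<le> L2norm (\<lambda>x. u x - v x)"
  using L2norm_triangle[OF L2_diff[OF assms] assms(2)] L2norm_triangle[OF L2_diff[OF assms(2,1)] assms(1)]
    L2norm_diff_commute[of u v] by simp

lemma L2norm_eq_0:
  assumes "u \<in> L2" shows "L2norm u = 0 \<longleftrightarrow> (AE x in lborel. u x = 0)"
  using integral_nonneg_eq_0_iff_AE[OF L2_integrable[OF assms]] by (simp add: L2norm_def)

lemma L2norm_diff_eq_0:
  assumes "u \<in> L2" "v \<in> L2" shows "L2norm (\<lambda>x. u x - v x) = 0 \<longleftrightarrow> (AE x in lborel. u x = v x)"
  using L2norm_eq_0[OF L2_diff[OF assms]] by simp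

lemma L2inner_self: "u \<in> L2 \<Longrightarrow> L2inner u u = of_real ((L2norm u)\<^sup>2)"
  unfolding L2inner_def L2norm_power2 by (simp add: complex_norm_square[symmetric] flip: of_real_power integral_complex_of_real)

lemma L2inner_add_left:
  "\<lbrakk>u \<in> L2; v \<in> L2; w \<in> L2\<rbrakk> \<Longrightarrow> L2inner (\<lambda>x. u x + v x) w = L2inner u w + L2inner v w"
  unfolding L2inner_def by (simp add: distrib_right L2_inner_integrable)

lemma L2inner_diff_left:
  "\<lbrakk>u \<in> L2; v \<in> L2; w \<in> L2\<rbrakk> \<Longrightarrow> L2inner (\<lambda>x. u x - v x) w = L2inner u w - L2inner v w"
  unfolding L2inner_def by (simp add: left_diff_distrib L2_inner_integrable)

lemma L2inner_diff_right:
  "\<lbrakk>u \<in> L2; v \<in> L2; w \<in> L2\<rbrakk> \<Longrightarrow> L2inner w (\<lambda>x. u x - v x) = L2inner w u - L2inner w v"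
  unfolding L2inner_def by (simp add: right_diff_distrib L2_inner_integrable)

lemma L2inner_cmult_left: "L2inner (\<lambda>x. c * u x) v = c * L2inner u v"
  unfolding L2inner_def by (simp add: mult.assoc)

lemma L2inner_cmult_right: "L2inner u (\<lambda>x. c * v x) = cnj c * L2inner u v"
proof -
  have "L2inner u (\<lambda>x. c * v x) = (LINT x|lborel. cnj c * (u x * cnj (v x)))"
    unfolding L2inner_def by (rule arg_cong[where f="integral\<^sup>L lborel"]) (auto simp: ac_simps)
  then show ?thesis by (simp add: L2inner_def)
qed

lemma L2inner_commute: "L2inner v u = cnj (L2inner u v)"
proof -
  have "cnj (L2inner u v) = (LINT x|lborel. cnj (u x * cnj (v x)))"
    unfolding L2inner_def by (rule Bochner_Integration.integral_cnj[symmetric])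
  then show ?thesis by (simp add: L2inner_def mult.commute)
qed

lemma L2norm_diff_power2:
  assumes "u \<in> L2" "v \<in> L2"
  shows "(L2norm (\<lambda>x. u x - v x))\<^sup>2 = (L2norm u)\<^sup>2 - 2 * Re (L2inner u v) + (L2norm v)\<^sup>2"
proof -
  have "complex_of_real ((L2norm (\<lambda>x. u x - v x))\<^sup>2) = L2inner u u - L2inner u v - L2inner v u + L2inner v v"
    using assms by (simp only: L2inner_self[symmetric] L2_diff L2inner_diff_left L2inner_diff_right) simp
  then have "Re (complex_of_real ((L2norm (\<lambda>x. u x - v x))\<^sup>2))
      = Re (L2inner u u - L2inner u v - L2inner v u + L2inner v v)" by (rule arg_cong)
  then show ?thesis
    using L2inner_commute[of v u] assms by (simp add: L2inner_self)
qed

lemma L2inner_cong_AE: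
  assumes "u \<in> L2" "v \<in> L2" "u' \<in> L2" "v' \<in> L2"
    "AE x in lborel. u x = u' x" "AE x in lborel. v x = v' x"
  shows "L2inner u v = L2inner u' v'"
  unfolding L2inner_def
proof (rule integral_cong_AE)
  show "AE x in lborel. u x * cnj (v x) = u' x * cnj (v' x)"
    using assms(5,6) by eventually_elim simp
qed (rule borel_measurable_integrable[OF L2_inner_integrable], fact+)+

text \<open>Polarization turns an isometry into a map that preserves inner products.\<close>

lemma L2inner_polarization:
  assumes "u \<in> L2" "v \<in> L2"
  shows "L2inner u v = of_real (((L2norm (\<lambda>x. u x + v x))\<^sup>2 - (L2norm u)\<^sup>2 - (L2norm v)\<^sup>2) / 2)
    + \<i> * of_real (((L2norm (\<lambda>x. u x + \<i> * v x))\<^sup>2 - (L2norm u)\<^sup>2 - (L2norm v)\<^sup>2) / 2)"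
proof -
  have gen: "(L2norm (\<lambda>x. u x + w x))\<^sup>2 = (L2norm u)\<^sup>2 + 2 * Re (L2inner u w) + (L2norm w)\<^sup>2" if "w \<in> L2" for w
    using L2norm_diff_power2[OF assms(1) L2_uminus[OF that]] L2inner_cmult_right[of u "-1" w]
      L2norm_cong[of "\<lambda>x. - w x" w] by simp
  have n: "L2norm (\<lambda>x. \<i> * v x) = L2norm v" by (rule L2norm_cong) (simp add: norm_mult)
  show ?thesis
    unfolding gen[OF assms(2)] gen[OF L2_cmult[OF assms(2), of \<i>]] n L2inner_cmult_right
    by (simp add: complex_eq_iff)
qed

lemma L2_tendsto_iff:
  assumes "\<And>i. u i \<in> L2" "v \<in> L2"
  shows "L2_tendsto UNIV u v F \<longleftrightarrow> ((\<lambda>i. L2norm (\<lambda>x. u i x - v x)) \<longlongrightarrow> 0) F"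
proof -
  have "L2_tendsto UNIV u v F \<longleftrightarrow> ((\<lambda>i. ennreal ((L2norm (\<lambda>x. u i x - v x))\<^sup>2)) \<longlongrightarrow> ennreal 0) F"
    using assms by (simp add: L2_tendsto_def nn_integral_L2norm L2_diff)
  also have "\<dots> \<longleftrightarrow> ((\<lambda>i. (L2norm (\<lambda>x. u i x - v x))\<^sup>2) \<longlongrightarrow> 0) F"
    by (rule tendsto_ennreal_iff) auto
  also have "\<dots> \<longleftrightarrow> ((\<lambda>i. L2norm (\<lambda>x. u i x - v x)) \<longlongrightarrow> 0) F"
  proof
    assume "((\<lambda>i. (L2norm (\<lambda>x. u i x - v x))\<^sup>2) \<longlongrightarrow> 0) F"
    from tendsto_real_sqrt[OF this] show "((\<lambda>i. L2norm (\<lambda>x. u i x - v x)) \<longlongrightarrow> 0) F" by simp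
  next
    assume "((\<lambda>i. L2norm (\<lambda>x. u i x - v x)) \<longlongrightarrow> 0) F"
    from tendsto_power[OF this, of 2] show "((\<lambda>i. (L2norm (\<lambda>x. u i x - v x))\<^sup>2) \<longlongrightarrow> 0) F" by simp
  qed
  finally show ?thesis .
qed

text \<open>Limits along filters other than \<open>sequentially\<close> occur because Fourier and Bloch transforms are
  limits of integrals over balls whose radius is a real parameter.\<close>

lemma L2_limit_unique:
  assumes u: "\<And>i. u i \<in> L2" and vw: "v \<in> L2" "w \<in> L2" and F: "F \<noteq> bot"
    and lim: "((\<lambda>i. L2norm (\<lambda>x. u i x - v x)) \<longlongrightarrow> 0) F" "((\<lambda>i. L2norm (\<lambda>x. u i x - w x)) \<longlongrightarrow> 0) F"
  shows "AE x in lborel. v x = w x"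
proof -
  have "((\<lambda>i. L2norm (\<lambda>x. u i x - v x) + L2norm (\<lambda>x. u i x - w x)) \<longlongrightarrow> 0) F"
    using tendsto_add[OF lim] by simp
  moreover have "L2norm (\<lambda>x. v x - w x) \<le> L2norm (\<lambda>x. u i x - v x) + L2norm (\<lambda>x. u i x - w x)" for i
    using L2norm_triangle_diff[OF vw(1) u vw(2), of i] by (simp add: L2norm_diff_commute)
  ultimately have "L2norm (\<lambda>x. v x - w x) \<le> 0"
    by (intro tendsto_lowerbound[OF _ _ F]) auto
  then have "L2norm (\<lambda>x. v x - w x) = 0" using L2norm_nonneg[of "\<lambda>x. v x - w x"] by linarith
  then show ?thesis using L2norm_diff_eq_0[OF vw] by blast
qed

text \<open>Fatou's lemma in norm form: it controls an \<open>L\<^sup>2\<close> distance to a pointwise limit.\<close>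

lemma L2_Fatou:
  fixes u :: "nat \<Rightarrow> real^'n \<Rightarrow> 'b::{banach,second_countable_topology}"
  assumes u: "\<And>n. u n \<in> L2" and v: "v \<in> borel_measurable borel"
    and lim: "AE x in lborel. (\<lambda>n. u n x) \<longlonglongrightarrow> v x"
    and bnd: "eventually (\<lambda>n. L2norm (u n) \<le> C) sequentially"
  shows "v \<in> L2" "L2norm v \<le> C"
proof -
  have [measurable]: "\<And>n. u n \<in> borel_measurable borel" "v \<in> borel_measurable borel" using u v by auto
  from bnd obtain n where "L2norm (u n) \<le> C" by (auto simp: eventually_sequentially)
  then have C: "0 \<le> C" using L2norm_nonneg order_trans by blast
  have "(\<integral>\<^sup>+x. ennreal ((norm (v x))\<^sup>2) \<partial>lborel)
      = (\<integral>\<^sup>+x. liminf (\<lambda>n. ennreal ((norm (u n x))\<^sup>2)) \<partial>lborel)"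
  proof (rule nn_integral_cong_AE, use lim in eventually_elim)
    fix x assume "(\<lambda>n. u n x) \<longlonglongrightarrow> v x"
    then have "(\<lambda>n. ennreal ((norm (u n x))\<^sup>2)) \<longlonglongrightarrow> ennreal ((norm (v x))\<^sup>2)"
      by (intro tendsto_ennrealI tendsto_intros)
    then show "ennreal ((norm (v x))\<^sup>2) = liminf (\<lambda>n. ennreal ((norm (u n x))\<^sup>2))"
      by (rule lim_imp_Liminf[OF trivial_limit_sequentially, symmetric])
  qed
  also have "\<dots> \<le> liminf (\<lambda>n. \<integral>\<^sup>+x. ennreal ((norm (u n x))\<^sup>2) \<partial>lborel)"
    by (rule nn_integral_liminf) auto
  also have "\<dots> \<le> ennreal (C\<^sup>2)"
  proof -
    have "eventually (\<lambda>n. (\<integral>\<^sup>+x. ennreal ((norm (u n x))\<^sup>2) \<partial>lborel) \<le> ennreal (C\<^sup>2)) sequentially"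
      using bnd by eventually_elim (simp add: nn_integral_L2norm u power_mono)
    then have "liminf (\<lambda>n. \<integral>\<^sup>+x. ennreal ((norm (u n x))\<^sup>2) \<partial>lborel) \<le> liminf (\<lambda>n. ennreal (C\<^sup>2))"
      by (rule Liminf_mono)
    then show ?thesis by (simp add: Liminf_const)
  qed
  finally have *: "(\<integral>\<^sup>+x. ennreal ((norm (v x))\<^sup>2) \<partial>lborel) \<le> ennreal (C\<^sup>2)" .
  then show "v \<in> L2" unfolding L2_iff_nn by (auto simp: le_less_trans)
  then show "L2norm v \<le> C" using L2norm_le_nn[OF * _ C] by blast
qed

text \<open>Riesz-Fischer.  Along a subsequence the increments \<open>d\<close> satisfy \<open>\<parallel>d k\<parallel> \<le> 2\<^sup>-\<^sup>k\<close>, so that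
  \<open>\<Sum>k. 2\<^sup>k * \<bar>d k\<bar>\<^sup>2\<close> has a finite integral; hence almost everywhere \<open>\<bar>d k\<bar>\<close> decays geometrically
  and the subsequence converges pointwise.\<close>

lemma L2_complete:
  fixes u :: "nat \<Rightarrow> real^'n \<Rightarrow> 'b::{banach,second_countable_topology}"
  assumes u: "\<And>n. u n \<in> L2"
    and cauchy: "\<And>e. 0 < e \<Longrightarrow> \<exists>N. \<forall>m\<ge>N. \<forall>n\<ge>N. L2norm (\<lambda>x. u m x - u n x) \<le> e"
  obtains v where "v \<in> L2" "(\<lambda>n. L2norm (\<lambda>x. u n x - v x)) \<longlonglongrightarrow> 0"
proof -
  have [measurable]: "\<And>n. u n \<in> borel_measurable borel" using u by auto
  have "\<exists>N. \<forall>k. N k < N (Suc k) \<and> (\<forall>m\<ge>N k. \<forall>n\<ge>N k. L2norm (\<lambda>x. u m x - u n x) \<le> (1/2)^k)"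
  proof -
    have "\<exists>N. \<forall>k. (\<forall>m\<ge>N k. \<forall>n\<ge>N k. L2norm (\<lambda>x. u m x - u n x) \<le> (1/2)^k) \<and> N k < N (Suc k)"
    proof (rule dependent_nat_choice)
      show "\<exists>N. \<forall>m\<ge>N. \<forall>n\<ge>N. L2norm (\<lambda>x. u m x - u n x) \<le> (1 / 2) ^ 0"
        using cauchy[of 1] by simp
      fix N k
      obtain N' where N': "\<forall>m\<ge>N'. \<forall>n\<ge>N'. L2norm (\<lambda>x. u m x - u n x) \<le> (1 / 2) ^ Suc k"
        using cauchy[of "(1/2)^Suc k"] by auto
      show "\<exists>y. (\<forall>m\<ge>y. \<forall>n\<ge>y. L2norm (\<lambda>x. u m x - u n x) \<le> (1 / 2) ^ Suc k) \<and> N < y"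
        using N' by (intro exI[of _ "max N' (Suc N)"]) auto
    qed
    then show ?thesis by blast
  qed
  then obtain N where N: "\<And>k. N k < N (Suc k)"
    "\<And>k m n. m \<ge> N k \<Longrightarrow> n \<ge> N k \<Longrightarrow> L2norm (\<lambda>x. u m x - u n x) \<le> (1/2)^k" by blast
  have mono: "strict_mono N" using N(1) by (simp add: strict_mono_Suc_iff)
  define d where "d k x = u (N (Suc k)) x - u (N k) x" for k x
  have [measurable]: "\<And>k. d k \<in> borel_measurable borel" unfolding d_def by measurable
  have d: "d k \<in> L2" "L2norm (d k) \<le> (1/2)^k" for k
    using u N(2)[of k "N (Suc k)" "N k"] N(1)[of k] unfolding d_def by (auto intro: L2_diff)
  have "(\<integral>\<^sup>+x. (\<Sum>k. ennreal (2^k * (norm (d k x))\<^sup>2)) \<partial>lborel)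
      = (\<Sum>k. (\<integral>\<^sup>+x. ennreal (2^k * (norm (d k x))\<^sup>2) \<partial>lborel))"
    by (rule nn_integral_suminf) auto
  also have "\<dots> \<le> (\<Sum>k. ennreal ((1/2)^k))"
  proof (rule suminf_le)
    fix k
    have "(\<integral>\<^sup>+x. ennreal (2^k * (norm (d k x))\<^sup>2) \<partial>lborel) = ennreal (2^k) * ennreal ((L2norm (d k))\<^sup>2)"
      by (simp add: ennreal_mult' nn_integral_cmult nn_integral_L2norm d)
    also have "\<dots> \<le> ennreal (2^k * ((1/2)^k)\<^sup>2)"
      using d(2)[of k] by (simp add: ennreal_mult'[symmetric] power_mono)
    also have "2^k * ((1/2)^k)\<^sup>2 = (1/2::real)^k"
      by (simp add: power2_eq_square power_divide)
    finally show "(\<integral>\<^sup>+x. ennreal (2^k * (norm (d k x))\<^sup>2) \<partial>lborel) \<le> ennreal ((1/2)^k)" .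
  qed auto
  also have "\<dots> = ennreal (\<Sum>k. (1/2)^k)"
    by (rule suminf_ennreal2) (auto intro: summable_geometric)
  also have "\<dots> < \<infinity>" by simp
  finally have "AE x in lborel. (\<Sum>k. ennreal (2^k * (norm (d k x))\<^sup>2)) \<noteq> \<infinity>"
    by (intro nn_integral_PInf_AE) auto
  then have conv: "AE x in lborel. convergent (\<lambda>k. u (N k) x)"
  proof eventually_elim
    fix x assume "(\<Sum>k. ennreal (2^k * (norm (d k x))\<^sup>2)) \<noteq> \<infinity>"
    then have s: "summable (\<lambda>k. 2^k * (norm (d k x))\<^sup>2)"
      by (intro summable_suminf_not_top) auto
    obtain B where B: "\<And>k. 2^k * (norm (d k x))\<^sup>2 \<le> B"
      using summable_imp_Bseq[OF s] unfolding Bseq_def by (auto simp: abs_le_iff)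
    have B0: "0 \<le> B" by (rule order_trans[OF _ B[of 0]]) simp
    have "norm (d k x) \<le> sqrt B * (1 / sqrt 2)^k" for k
    proof (rule power2_le_imp_le)
      have "((1 / sqrt 2)^k)\<^sup>2 = ((1 / sqrt 2 :: real)\<^sup>2)^k"
        by (simp only: power_mult[symmetric] mult.commute)
      also have "(1 / sqrt 2 :: real)\<^sup>2 = 1 / 2" by (simp add: power_divide)
      finally have "(sqrt B * (1 / sqrt 2)^k)\<^sup>2 = B * (1 / 2)^k"
        using B0 by (simp only: power_mult_distrib real_sqrt_pow2)
      moreover have "(norm (d k x))\<^sup>2 \<le> B * (1 / 2)^k"
        using B[of k] by (simp add: field_simps power_divide)
      ultimately show "(norm (d k x))\<^sup>2 \<le> (sqrt B * (1 / sqrt 2)^k)\<^sup>2" by simp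
      show "0 \<le> sqrt B * (1 / sqrt 2)^k" using B0 by simp
    qed
    moreover have "summable (\<lambda>k. sqrt B * (1 / sqrt 2)^k)"
      by (intro summable_mult summable_geometric) simp
    ultimately have "summable (\<lambda>k. d k x)"
      by (intro summable_comparison_test'[of "\<lambda>k. sqrt B * (1 / sqrt 2)^k" 0 "\<lambda>k. d k x"])
    then have "convergent (\<lambda>n. \<Sum>k<n. d k x)" by (simp add: summable_iff_convergent)
    moreover have "(\<Sum>k<n. d k x) = u (N n) x - u (N 0) x" for n
      unfolding d_def by (rule sum_lessThan_telescope)
    ultimately have "convergent (\<lambda>n. u (N n) x - u (N 0) x)" by simp
    from convergent_add[OF this convergent_const[of "u (N 0) x"]]
    show "convergent (\<lambda>k. u (N k) x)" by simp
  qed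
  define v where "v x = lim (\<lambda>k. u (N k) x)" for x
  have vm [measurable]: "v \<in> borel_measurable borel"
    unfolding v_def[abs_def] by (rule borel_measurable_lim_metric) simp
  have lim: "AE x in lborel. (\<lambda>k. u (N k) x) \<longlonglongrightarrow> v x"
    using conv by eventually_elim (simp add: v_def convergent_LIMSEQ_iff)
  have key: "(\<lambda>x. u n x - v x) \<in> L2 \<and> L2norm (\<lambda>x. u n x - v x) \<le> (1/2)^k" if "n \<ge> N k" for n k
  proof -
    have ev: "eventually (\<lambda>j. L2norm (\<lambda>x. u n x - u (N j) x) \<le> (1/2)^k) sequentially"
      unfolding eventually_sequentially
      by (rule exI[of _ k]) (use N(2) that mono in \<open>auto simp: strict_mono_less_eq\<close>)
    have l: "AE x in lborel. (\<lambda>j. u n x - u (N j) x) \<longlonglongrightarrow> u n x - v x"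
      using lim by eventually_elim (intro tendsto_intros)
    show ?thesis
      using L2_Fatou[OF L2_diff[OF u u] _ l ev] by simp
  qed
  have "v \<in> L2"
    using L2_diff[OF u[of "N 0"] conjunct1[OF key[of 0 "N 0"]]] by simp
  moreover have "(\<lambda>n. L2norm (\<lambda>x. u n x - v x)) \<longlonglongrightarrow> 0"
  proof (rule LIMSEQ_I)
    fix r :: real assume "0 < r"
    then obtain k where "(1/2)^k < r" using real_arch_pow_inv[of r "1/2"] by auto
    then show "\<exists>no. \<forall>n\<ge>no. norm (L2norm (\<lambda>x. u n x - v x) - 0) < r"
      using key[of k] by (intro exI[of _ "N k"]) force
  qed
  ultimately show ?thesis by (rule that)
qed

section \<open>Fourier series on the cell\<close>

definition lattice :: "(real^'n) set" where
  "lattice = {k. \<forall>i. k $ i \<in> \<int>}"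

lemma countable_lattice: "countable (lattice :: (real^'n) set)"
proof -
  have "lattice \<subseteq> range (\<lambda>f::'n \<Rightarrow> int. \<chi> i. real_of_int (f i))"
  proof
    fix k :: "real^'n" assume "k \<in> lattice"
    then have "\<forall>i. \<exists>m. k $ i = real_of_int m" by (auto simp: lattice_def Ints_def)
    then obtain m where "\<And>i. k $ i = real_of_int (m i)" by metis
    then have "k = (\<chi> i. real_of_int (m i))" by (simp add: vec_eq_iff)
    then show "k \<in> range (\<lambda>f::'n \<Rightarrow> int. \<chi> i. real_of_int (f i))" by auto
  qed
  then show ?thesis by (rule countable_subset) (rule countable_image, rule countableI_type)
qed

lemma infinite_lattice: "infinite (lattice :: (real^'n) set)"
proof -
  have "inj (\<lambda>m::nat. (\<chi> i. real m) :: real^'n)"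
    by (auto simp: inj_def vec_eq_iff)
  then have "infinite (range (\<lambda>m::nat. (\<chi> i. real m) :: real^'n))" by (rule range_inj_infinite)
  moreover have "range (\<lambda>m::nat. (\<chi> i. real m) :: real^'n) \<subseteq> lattice" by (auto simp: lattice_def)
  ultimately show ?thesis by (rule infinite_super[rotated])
qed

text \<open>The lattice is enumerated by \<open>nat\<close>, so that sums over it are ordinary series.\<close>

definition lat :: "nat \<Rightarrow> real^'n" where "lat = from_nat_into lattice"

lemma lat_bij: "bij_betw lat UNIV lattice"
  unfolding lat_def by (rule bij_betw_from_nat_into[OF countable_lattice infinite_lattice])

lemma lat_in_lattice: "lat n \<in> lattice"
  using lat_bij by (auto simp: bij_betw_def)

lemma lat_eq_iff: "lat m = lat n \<longleftrightarrow> m = n"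
  using lat_bij by (auto simp: bij_betw_def inj_def)

subsection \<open>Tiling by half-open cells\<close>

definition Qcell :: "(real^'n) set" where
  "Qcell = {y. \<forall>i. 0 \<le> y $ i \<and> y $ i < 1}"

lemma Qcell_sets [measurable]: "Qcell \<in> sets borel"
  unfolding Qcell_def by measurable

lemma Zcell_sets [measurable]: "Zcell \<in> sets borel"
  unfolding Zcell_def by measurable

lemma nn_integral_lborel_translate:
  fixes F :: "'a::euclidean_space \<Rightarrow> ennreal"
  assumes [measurable]: "F \<in> borel_measurable borel"
  shows "(\<integral>\<^sup>+x. F (x + a) \<partial>lborel) = (\<integral>\<^sup>+x. F x \<partial>lborel)"
  by (subst (2) lborel_distr_plus[of a, symmetric]) (simp add: nn_integral_distr add.commute)

text \<open>The lattice point is the vector of integer parts.\<close>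

lemma lattice_tile: "\<exists>!n. (x :: real^'n) - lat n \<in> Qcell"
proof -
  let ?k = "\<chi> i. real_of_int \<lfloor>x $ i\<rfloor>"
  have "?k \<in> lattice" by (simp add: lattice_def)
  then obtain n where n: "lat n = ?k" using lat_bij unfolding bij_betw_def by (metis UNIV_I imageE)
  have "x - lat n \<in> Qcell" unfolding n Qcell_def using floor_correct by (auto simp: field_simps)
  moreover have "m = n" if m: "x - lat m \<in> Qcell" for m
  proof -
    have "lat m $ i = ?k $ i" for i
    proof -
      have "lat m $ i \<in> \<int>" using lat_in_lattice[of m] unfolding lattice_def by blast
      then obtain z where z: "lat m $ i = real_of_int z" by (auto simp: Ints_def)
      have "0 \<le> (x - lat m) $ i" "(x - lat m) $ i < 1" using m unfolding Qcell_def by blast+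
      then have "\<lfloor>x $ i\<rfloor> = z" using z by (intro floor_unique) auto
      then show ?thesis using z by simp
    qed
    then have "(lat m :: real^'n) = lat n" unfolding n by (simp add: vec_eq_iff)
    then show "m = n" by (simp add: lat_eq_iff)
  qed
  ultimately show ?thesis by blast
qed

lemma nn_integral_tile:
  fixes F :: "real^'n \<Rightarrow> ennreal"
  assumes [measurable]: "F \<in> borel_measurable borel"
  shows "(\<integral>\<^sup>+x. F x \<partial>lborel) = (\<Sum>n. \<integral>\<^sup>+x. F (x + lat n) * indicator Qcell x \<partial>lborel)"
proof -
  have one: "(\<Sum>n. F x * indicator Qcell (x - lat n)) = F x" for x
  proof -
    obtain m where m: "x - lat m \<in> Qcell" "\<And>n. x - lat n \<in> Qcell \<Longrightarrow> n = m"
      using lattice_tile[of x] by blast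
    have "F x * indicator Qcell (x - lat n) = (if n = m then F x else 0)" for n
    proof (cases "n = m")
      case False
      then have "x - lat n \<notin> Qcell" using m(2) by blast
      then show ?thesis using False by simp
    qed (use m(1) in simp)
    then show ?thesis using sums_unique[OF sums_single[of m "\<lambda>_. F x"]] by simp
  qed
  have "(\<integral>\<^sup>+x. F x \<partial>lborel) = (\<Sum>n. \<integral>\<^sup>+x. F x * indicator Qcell (x - lat n) \<partial>lborel)"
  proof -
    have "(\<Sum>n. \<integral>\<^sup>+x. F x * indicator Qcell (x - lat n) \<partial>lborel)
        = (\<integral>\<^sup>+x. (\<Sum>n. F x * indicator Qcell (x - lat n)) \<partial>lborel)"
      by (rule nn_integral_suminf[symmetric]) measurable
    then show ?thesis unfolding one by simp
  qed
  also have "(\<lambda>n. \<integral>\<^sup>+x. F x * indicator Qcell (x - lat n) \<partial>lborel)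
      = (\<lambda>n. \<integral>\<^sup>+x. F (x + lat n) * indicator Qcell x \<partial>lborel)"
  proof
    fix n
    show "(\<integral>\<^sup>+x. F x * indicator Qcell (x - lat n) \<partial>lborel)
        = (\<integral>\<^sup>+x. F (x + lat n) * indicator Qcell x \<partial>lborel)"
      using nn_integral_lborel_translate[of "\<lambda>x. F x * indicator Qcell (x - lat n)" "lat n"] by simp
  qed
  finally show ?thesis .
qed

subsection \<open>Orthonormality of the exponentials\<close>

definition lat_exp :: "nat \<Rightarrow> real^'n \<Rightarrow> complex" where
  "lat_exp n \<eta> = indicator Zcell \<eta> *\<^sub>R cis (2 * pi * (lat n \<bullet> \<eta>))"

lemma cis_sum: "finite I \<Longrightarrow> cis (\<Sum>i\<in>I. f i) = (\<Prod>i\<in>I. cis (f i))"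
  by (induction I rule: finite_induct) (auto simp: cis_mult[symmetric])

lemma lborel_integral_prod_Basis:
  fixes f :: "'a::euclidean_space \<Rightarrow> real \<Rightarrow> complex"
  assumes "\<And>b. b \<in> Basis \<Longrightarrow> integrable lborel (f b)"
  shows "(LINT x|lborel. (\<Prod>b\<in>Basis. f b (x \<bullet> b))) = (\<Prod>b\<in>Basis. LINT t|lborel. f b t)"
    "integrable lborel (\<lambda>x. \<Prod>b\<in>Basis. f b (x \<bullet> b))"
proof -
  interpret product_sigma_finite "\<lambda>_::'a. lborel :: real measure" ..
  have [measurable]: "b \<in> Basis \<Longrightarrow> f b \<in> borel_measurable borel" for b
    using borel_measurable_integrable[OF assms] by simp
  let ?T = "\<lambda>g. \<Sum>b\<in>Basis. g b *\<^sub>R b :: 'a"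
  have T: "?T \<in> measurable (\<Pi>\<^sub>M b\<in>Basis. lborel) borel" by measurable
  have in1: "?T g \<bullet> b = g b" if "b \<in> Basis" for g and b :: 'a
    using that by simp
  have eq: "(\<Prod>b\<in>Basis. f b (?T g \<bullet> b)) = (\<Prod>b\<in>Basis. f b (g b))" for g
    by (rule prod.cong) (auto simp: in1)
  have m: "(\<lambda>x. \<Prod>b\<in>Basis. f b (x \<bullet> b)) \<in> borel_measurable borel" by measurable
  show "(LINT x|lborel. (\<Prod>b\<in>Basis. f b (x \<bullet> b))) = (\<Prod>b\<in>Basis. LINT t|lborel. f b t)"
    unfolding lborel_eq[where 'a='a] integral_distr[OF T m] eq
    by (rule product_integral_prod) (use assms in auto)
  show "integrable lborel (\<lambda>x. \<Prod>b\<in>Basis. f b (x \<bullet> b))"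
    unfolding lborel_eq[where 'a='a] integrable_distr_eq[OF T m] eq
    by (rule product_integrable_prod) (use assms in auto)
qed

lemma integral_cis_period:
  assumes "m \<in> \<int>"
  shows "(LINT t|lborel. indicator {-1/2..<1/2::real} t *\<^sub>R cis (2 * pi * (m * t))) = (if m = 0 then 1 else 0)"
    "integrable lborel (\<lambda>t. indicator {-1/2..<1/2::real} t *\<^sub>R cis (2 * pi * (m * t)))"
proof -
  let ?f = "\<lambda>t. cis (2 * pi * (m * t))"
  have cont: "continuous_on {-1/2..1/2} ?f" by (intro continuous_intros)
  have ic: "integrable lborel (\<lambda>t. indicator {-1/2..1/2::real} t *\<^sub>R ?f t)"
    using borel_integrable_atLeastAtMost'[OF cont] by (simp add: set_integrable_def)
  have ae: "AE t in lborel. indicator {-1/2..1/2::real} t *\<^sub>R ?f t = indicator {-1/2..<1/2::real} t *\<^sub>R ?f t"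
    using AE_lborel_singleton[of "1/2::real"] by eventually_elim (auto simp: indicator_def)
  have [measurable]: "?f \<in> borel_measurable borel"
    by (intro borel_measurable_continuous_onI continuous_intros)
  show "integrable lborel (\<lambda>t. indicator {-1/2..<1/2::real} t *\<^sub>R ?f t)"
    by (rule integrable_cong_AE_imp[OF ic _ ae]) measurable
  have eq: "(LINT t|lborel. indicator {-1/2..<1/2::real} t *\<^sub>R ?f t)
      = (LINT t|lborel. indicator {-1/2..1/2::real} t *\<^sub>R ?f t)"
    by (rule integral_cong_AE) (use ae in \<open>auto\<close>)
  show "(LINT t|lborel. indicator {-1/2..<1/2::real} t *\<^sub>R ?f t) = (if m = 0 then 1 else 0)"
  proof (cases "m = 0")
    case True then show ?thesis unfolding eq by simp
  next
    case False
    let ?c = "2 * pi * m"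
    have c: "complex_of_real ?c * \<i> \<noteq> 0" using False by simp
    have "(LINT t|lborel. indicator {-1/2..1/2::real} t *\<^sub>R ?f t)
        = cis (?c * (1/2)) / (of_real ?c * \<i>) - cis (?c * (-1/2)) / (of_real ?c * \<i>)"
    proof (rule integral_FTC_atLeastAtMost)
      fix t :: real
      have "((\<lambda>t. cis (?c * t) / (of_real ?c * \<i>)) has_vector_derivative (of_real ?c * \<i> * cis (?c * t)) / (of_real ?c * \<i>))
          (at t within {-1/2..1/2})"
        unfolding cis_conv_exp using c
        by (auto intro!: derivative_eq_intros has_vector_derivative_real_field simp: mult_ac)
      then show "((\<lambda>t. cis (?c * t) / (of_real ?c * \<i>)) has_vector_derivative ?f t) (at t within {-1/2..1/2})"
        using c by (simp add: mult.assoc)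
    qed (use cont in auto)
    also have "cis (?c * (1/2)) = cis (?c * (-1/2))"
    proof -
      have "cis (?c * (1/2)) = cis (?c * (-1/2)) * cis ?c" unfolding cis_mult by (rule arg_cong[where f=cis]) simp
      also have "cis ?c = 1" using assms by (simp add: cis_multiple_2pi)
      finally show ?thesis by simp
    qed
    finally show ?thesis unfolding eq using False by simp
  qed
qed

lemma Zcell_Basis: "\<eta> \<in> Zcell \<longleftrightarrow> (\<forall>b\<in>Basis. \<eta> \<bullet> b \<in> {-1/2..<1/2})"
  by (auto simp: Zcell_def Basis_vec_def inner_axis)

lemma indicator_Zcell_prod: "indicator Zcell \<eta> = (\<Prod>b\<in>Basis. indicator {-1/2..<1/2::real} (\<eta> \<bullet> b) :: real)"
  by (cases "\<eta> \<in> Zcell") (auto simp: Zcell_Basis indicator_def)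

text \<open>The integral factorizes over the coordinates, and each factor is the integral of an exponential over
  a period.\<close>

lemma integral_exp_Zcell:
  assumes "k \<in> lattice"
  shows "(LINT \<eta>|lborel. indicator Zcell \<eta> *\<^sub>R cis (2 * pi * (k \<bullet> \<eta>))) = (if k = 0 then 1 else 0)"
    "integrable lborel (\<lambda>\<eta>. indicator Zcell \<eta> *\<^sub>R cis (2 * pi * (k \<bullet> \<eta>)))"
proof -
  have int: "k \<bullet> b \<in> \<int>" if "b \<in> Basis" for b
    using that assms by (auto simp: lattice_def Basis_vec_def inner_axis)
  let ?f = "\<lambda>b t. indicator {-1/2..<1/2::real} t *\<^sub>R cis (2 * pi * (k \<bullet> b * t))"
  have eq: "indicator Zcell \<eta> *\<^sub>R cis (2 * pi * (k \<bullet> \<eta>)) = (\<Prod>b\<in>Basis. ?f b (\<eta> \<bullet> b))" for \<eta>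
    by (subst euclidean_inner)
      (simp add: scaleR_conv_of_real prod.distrib indicator_Zcell_prod cis_sum[symmetric] sum_distrib_left)
  have "(\<Prod>b\<in>Basis. LINT t|lborel. ?f b t) = (\<Prod>b\<in>Basis. if k \<bullet> b = 0 then 1 else 0)"
    by (rule prod.cong[OF refl]) (rule integral_cis_period(1)[OF int])
  also have "\<dots> = (if k = 0 then 1 else 0)"
    using euclidean_all_zero_iff[of k] by auto
  finally show "(LINT \<eta>|lborel. indicator Zcell \<eta> *\<^sub>R cis (2 * pi * (k \<bullet> \<eta>))) = (if k = 0 then 1 else 0)"
    unfolding eq by (subst lborel_integral_prod_Basis(1)) (rule integral_cis_period(2)[OF int], simp_all)
  show "integrable lborel (\<lambda>\<eta>. indicator Zcell \<eta> *\<^sub>R cis (2 * pi * (k \<bullet> \<eta>)))"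
    unfolding eq by (rule lborel_integral_prod_Basis(2)) (rule integral_cis_period(2)[OF int])
qed

lemma indicator_Zcell_integrable: "integrable lborel (indicator (Zcell :: (real^'n) set) :: _ \<Rightarrow> real)"
proof -
  have "integrable lborel (\<lambda>\<eta>::real^'n. Re (indicator Zcell \<eta> *\<^sub>R cis (2 * pi * (0 \<bullet> \<eta>))))"
    by (intro integrable_Re integral_exp_Zcell(2)) (simp add: lattice_def)
  then show ?thesis by simp
qed

lemma cis_measurable [measurable]: "cis \<in> borel_measurable borel"
  by (intro borel_measurable_continuous_onI continuous_intros)

lemma Zcell_emeasure_finite: "emeasure lborel (Zcell :: (real^'n) set) < \<infinity>"
  using indicator_Zcell_integrable[where 'n='n] by (simp add: integrable_indicator_iff)

lemma lat_exp_L2: "(lat_exp n :: real^'n \<Rightarrow> complex) \<in> L2"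
  unfolding L2_iff
proof
  show "(lat_exp n :: real^'n \<Rightarrow> complex) \<in> borel_measurable borel" unfolding lat_exp_def[abs_def] by measurable
  have "(\<lambda>\<eta>::real^'n. (norm (lat_exp n \<eta>))\<^sup>2) = indicator Zcell"
    by (auto simp: lat_exp_def fun_eq_iff indicator_def)
  then show "integrable lborel (\<lambda>\<eta>::real^'n. (norm (lat_exp n \<eta>))\<^sup>2)" by (simp only: indicator_Zcell_integrable)
qed

lemma lat_exp_orthonormal:
  "L2inner (lat_exp m :: real^'n \<Rightarrow> complex) (lat_exp n) = (if m = n then 1 else 0)"
proof -
  have "(lat m - lat n :: real^'n) \<in> lattice"
    using lat_in_lattice[of m, where 'a='n] lat_in_lattice[of n, where 'a='n]
    by (auto simp: lattice_def intro: Ints_diff)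
  moreover have "lat_exp m \<eta> * cnj (lat_exp n \<eta>) = indicator Zcell \<eta> *\<^sub>R cis (2 * pi * ((lat m - lat n) \<bullet> \<eta>))" for \<eta> :: "real^'n"
    by (auto simp: lat_exp_def indicator_def cis_cnj cis_mult inner_diff_left algebra_simps)
  ultimately show ?thesis
    unfolding L2inner_def by (simp add: integral_exp_Zcell lat_eq_iff)
qed

subsection \<open>Completeness of the exponentials\<close>

text \<open>Trigonometric polynomials; generating them by sums of single terms lets products and orthogonality
  be handled by induction.\<close>

inductive_set trig :: "(real^'n \<Rightarrow> complex) set" where
  exp: "k \<in> lattice \<Longrightarrow> (\<lambda>\<eta>. c * cis (2 * pi * (k \<bullet> \<eta>))) \<in> trig"
| add: "p \<in> trig \<Longrightarrow> q \<in> trig \<Longrightarrow> (\<lambda>\<eta>. p \<eta> + q \<eta>) \<in> trig"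

lemma trig_mult: "p \<in> trig \<Longrightarrow> q \<in> trig \<Longrightarrow> (\<lambda>\<eta>. p \<eta> * q \<eta>) \<in> trig"
proof (induction rule: trig.induct)
  case (exp k c)
  from exp(2,1) show ?case
  proof (induction rule: trig.induct)
    case (exp k' c')
    have "k + k' \<in> lattice" using exp by (auto simp: lattice_def)
    from trig.exp[OF this, of "c * c'"] show ?case
      by (simp add: inner_add_left cis_mult[symmetric] distrib_left mult_ac)
  next
    case (add p q) then show ?case using trig.add by (auto simp: distrib_left)
  qed
next
  case (add p p') then show ?case using trig.add by (auto simp: distrib_right)
qed

lemma trig_continuous: "p \<in> trig \<Longrightarrow> continuous_on S p"
  by (induction rule: trig.induct) (auto intro!: continuous_intros)

lemma trig_const: "(\<lambda>\<eta>. c) \<in> trig"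
  using trig.exp[of 0 c] by (simp add: lattice_def)

text \<open>The torus appears as a compact subset of \<open>complex^'n\<close>; opposite faces of the closed cell are glued.\<close>

definition torus :: "real^'n \<Rightarrow> complex^'n" where
  "torus \<eta> = (\<chi> j. cis (2 * pi * \<eta> $ j))"

lemma torus_continuous: "continuous_on S torus"
  unfolding torus_def by (intro continuous_intros)

definition Zclosed :: "(real^'n) set" where
  "Zclosed = cbox (\<chi> i. -1/2) (\<chi> i. 1/2)"

definition Zopen :: "(real^'n) set" where
  "Zopen = box (\<chi> i. -1/2) (\<chi> i. 1/2)"

lemma Zclosed_iff: "x \<in> Zclosed \<longleftrightarrow> (\<forall>i. -1/2 \<le> x $ i \<and> x $ i \<le> 1/2)"
  by (auto simp: Zclosed_def mem_box_cart)

lemma Zopen_iff: "x \<in> Zopen \<longleftrightarrow> (\<forall>i. -1/2 < x $ i \<and> x $ i < 1/2)"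
  by (auto simp: Zopen_def mem_box_cart)

lemma Zcell_subset_Zclosed: "Zcell \<subseteq> Zclosed"
  by (auto simp: Zclosed_iff Zcell_def less_imp_le)

lemma torus_eq_imp:
  assumes "x \<in> Zclosed" "y \<in> Zclosed" "torus x = torus y"
  shows "x = y \<or> (x \<notin> Zopen \<and> y \<notin> Zopen)"
proof (rule disjCI)
  assume neg: "\<not> (x \<notin> Zopen \<and> y \<notin> Zopen)"
  show "x = y"
  proof (rule vec_eq_iff[THEN iffD2], rule allI)
    fix i
    have "cis (2 * pi * x $ i) = cis (2 * pi * y $ i)"
      using arg_cong[OF assms(3), of "\<lambda>v. v $ i"] by (simp add: torus_def)
    then have "cis (2 * pi * x $ i) / cis (2 * pi * y $ i) = 1" by simp
    then have "cis (2 * pi * (x $ i - y $ i)) = 1" by (simp add: cis_divide algebra_simps)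
    then have "cos (2 * pi * (x $ i - y $ i)) = 1" by (metis cis.sel(1) one_complex.sel(1))
    then obtain n::int where "2 * pi * (x $ i - y $ i) = of_int n * 2 * pi"
      by (auto simp: cos_one_2pi_int)
    then have n: "x $ i - y $ i = of_int n" by simp
    have b: "-1/2 \<le> x $ i" "x $ i \<le> 1/2" "-1/2 \<le> y $ i" "y $ i \<le> 1/2"
      using assms(1,2) by (auto simp: Zclosed_iff)
    have "-1/2 < x $ i \<and> x $ i < 1/2 \<or> -1/2 < y $ i \<and> y $ i < 1/2"
      using neg by (auto simp: Zopen_iff)
    then have "\<bar>x $ i - y $ i\<bar> < 1" using b by linarith
    then have "n = 0" using n by simp
    then show "x $ i = y $ i" using n by simp
  qed
qed

text \<open>A continuous function that vanishes on the boundary of the cell descends to a continuous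
  function on the compact torus, where Stone-Weierstrass applies.\<close>

lemma trig_approx:
  fixes h :: "real^'n \<Rightarrow> real"
  assumes h: "continuous_on UNIV h" and h0: "\<And>x. x \<notin> Zopen \<Longrightarrow> h x = 0" and e: "0 < e"
  obtains p where "p \<in> trig" "\<And>x. x \<in> Zclosed \<Longrightarrow> norm (of_real (h x) - p x) < e"
proof -
  let ?T = "torus ` (Zclosed :: (real^'n) set)"
  have cC: "compact (Zclosed :: (real^'n) set)" by (simp add: Zclosed_def)
  have cT: "compact ?T" by (rule compact_continuous_image[OF torus_continuous cC])
  \<comment> \<open>\<open>h\<close> read as a function on the torus; the choice of the preimage matters only on the boundary, where \<open>h = 0\<close>\<close>
  define H where "H z = h (SOME x. x \<in> Zclosed \<and> torus x = z)" for z
  have H: "H (torus x) = h x" if "x \<in> Zclosed" for x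
  proof -
    let ?y = "SOME y. y \<in> Zclosed \<and> torus y = torus x"
    have y: "?y \<in> Zclosed \<and> torus ?y = torus x" by (rule someI[of _ x]) (use that in auto)
    from torus_eq_imp[OF conjunct1[OF y] that conjunct2[OF y]] have "h ?y = h x"
    proof
      assume "?y \<notin> Zopen \<and> x \<notin> Zopen" then show ?thesis using h0[of ?y] h0[of x] by simp
    qed simp
    then show ?thesis unfolding H_def .
  qed
  have Hc: "continuous_on ?T H"
  proof (subst continuous_on_closed_vimage)
    show "closed ?T" by (rule compact_imp_closed[OF cT])
    show "\<forall>B. closed B \<longrightarrow> closed (H -` B \<inter> ?T)"
    proof (intro allI impI)
      fix B :: "real set" assume B: "closed B"
      have "H -` B \<inter> ?T = torus ` (h -` B \<inter> Zclosed)" using H by auto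
      moreover have "closed (h -` B)" using B h by (simp add: continuous_on_closed_vimage)
      then have "compact (h -` B \<inter> Zclosed)" using cC by (simp add: closed_Int_compact)
      then have "compact (torus ` (h -` B \<inter> Zclosed))"
        by (rule compact_continuous_image[OF torus_continuous])
      ultimately show "closed (H -` B \<inter> ?T)" by (simp add: compact_imp_closed)
    qed
  qed
  let ?P = "\<lambda>F. continuous_on ?T F \<and> (\<exists>p\<in>trig. \<forall>\<eta>\<in>Zclosed. complex_of_real (F (torus \<eta>)) = p \<eta>)"
  have "\<exists>F. ?P F \<and> (\<forall>z\<in>?T. \<bar>H z - F z\<bar> < e)"
  proof (rule Stone_Weierstrass_HOL[OF cT, where P="?P"])
    show "?P (\<lambda>x. c)" for c
      by (auto intro!: continuous_intros bexI[OF _ trig_const[of "complex_of_real c"]])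
    show "?P f \<Longrightarrow> continuous_on ?T f" for f by blast
    show "?P (\<lambda>x. f x + g x)" if "?P f \<and> ?P g" for f g
    proof -
      from that obtain p q where "p \<in> trig" "q \<in> trig" "\<forall>\<eta>\<in>Zclosed. complex_of_real (f (torus \<eta>)) = p \<eta>"
        "\<forall>\<eta>\<in>Zclosed. complex_of_real (g (torus \<eta>)) = q \<eta>" by blast
      then show ?thesis using that by (auto intro!: continuous_intros bexI[OF _ trig.add[of p q]])
    qed
    show "?P (\<lambda>x. f x * g x)" if "?P f \<and> ?P g" for f g
    proof -
      from that obtain p q where "p \<in> trig" "q \<in> trig" "\<forall>\<eta>\<in>Zclosed. complex_of_real (f (torus \<eta>)) = p \<eta>"
        "\<forall>\<eta>\<in>Zclosed. complex_of_real (g (torus \<eta>)) = q \<eta>" by blast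
      then show ?thesis using that by (auto intro!: continuous_intros bexI[OF _ trig_mult[of p q]])
    qed
    show "\<exists>f. ?P f \<and> f x \<noteq> f y" if xy: "x \<in> ?T \<and> y \<in> ?T \<and> x \<noteq> y" for x y
    proof -
      obtain j where j: "x $ j \<noteq> y $ j" using xy by (auto simp: vec_eq_iff)
      have ax: "axis j 1 \<in> lattice" "- axis j 1 \<in> lattice" by (auto simp: lattice_def axis_def)
      have ina: "axis j 1 \<bullet> \<eta> = \<eta> $ j" for \<eta> :: "real^'n" by (simp add: inner_axis')
      have "?P (\<lambda>z. Re (z $ j))"
      proof
        show "continuous_on ?T (\<lambda>z. Re (z $ j))" by (intro continuous_intros)
        show "\<exists>p\<in>trig. \<forall>\<eta>\<in>Zclosed. complex_of_real (Re (torus \<eta> $ j)) = p \<eta>"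
          by (rule bexI[OF _ trig.add[OF trig.exp[OF ax(1), of "1/2"] trig.exp[OF ax(2), of "1/2"]]])
            (auto simp: torus_def ina complex_eq_iff)
      qed
      moreover have "?P (\<lambda>z. Im (z $ j))"
      proof
        show "continuous_on ?T (\<lambda>z. Im (z $ j))" by (intro continuous_intros)
        show "\<exists>p\<in>trig. \<forall>\<eta>\<in>Zclosed. complex_of_real (Im (torus \<eta> $ j)) = p \<eta>"
          by (rule bexI[OF _ trig.add[OF trig.exp[OF ax(1), of "-\<i>/2"] trig.exp[OF ax(2), of "\<i>/2"]]])
            (auto simp: torus_def ina complex_eq_iff)
      qed
      ultimately show ?thesis using j by (auto simp: complex_eq_iff)
    qed
  qed (use Hc e in auto)
  then obtain F p where "\<forall>z\<in>?T. \<bar>H z - F z\<bar> < e" "p \<in> trig"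
      "\<forall>\<eta>\<in>Zclosed. complex_of_real (F (torus \<eta>)) = p \<eta>" by blast
  then have "norm (of_real (h x) - p x) < e" if "x \<in> Zclosed" for x
    using that H[OF that] by (metis imageI norm_of_real of_real_diff)
  then show ?thesis using that \<open>p \<in> trig\<close> by blast
qed

text \<open>A function orthogonal to all exponentials is orthogonal to all continuous functions supported in the
  open cell.  Such functions approximate the bounded measurable phase of \<open>g\<close> almost everywhere, and the
  pairing of \<open>g\<close> with its phase is the integral of \<open>\<bar>g\<bar>\<close>.\<close>

lemma trig_complete:
  fixes g :: "real^'n \<Rightarrow> complex"
  assumes g: "integrable lborel g" and gZ: "\<And>x. x \<notin> Zcell \<Longrightarrow> g x = 0"
    and orth: "\<And>k. k \<in> lattice \<Longrightarrow> (LINT x|lborel. g x * cis (2 * pi * (k \<bullet> x))) = 0"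
  shows "AE x in lborel. g x = 0"
proof -
  have gm [measurable]: "g \<in> borel_measurable borel" using g by auto
  have bi: "integrable lborel (\<lambda>x. g x * f x)"
    if "f \<in> borel_measurable borel" "\<And>x. x \<in> Zclosed \<Longrightarrow> norm (f x) \<le> B" for f B
  proof (rule Bochner_Integration.integrable_bound[of _ "\<lambda>x. B *\<^sub>R norm (g x)"])
    show "integrable lborel (\<lambda>x. B *\<^sub>R norm (g x))" using g by auto
    have "norm (g x * f x) \<le> norm (B *\<^sub>R norm (g x))" for x
    proof (cases "x \<in> Zcell")
      case True
      then have "norm (f x) \<le> B" using that(2)[of x] by (auto simp: Zclosed_iff Zcell_def less_imp_le)
      then show ?thesis by (simp add: norm_mult mult.commute mult_left_mono order_trans[OF _ abs_ge_self] mult_right_mono)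
    qed (simp add: gZ)
    then show "AE x in lborel. norm (g x * f x) \<le> norm (B *\<^sub>R norm (g x))" by simp
  qed (use that in measurable)
  have tb: "\<exists>B. \<forall>x\<in>Zclosed. norm (p x) \<le> B" if "p \<in> trig" for p :: "real^'n \<Rightarrow> complex"
  proof -
    have "compact (p ` Zclosed)"
      by (rule compact_continuous_image[OF trig_continuous[OF that]]) (simp add: Zclosed_def)
    then show ?thesis using compact_imp_bounded bounded_iff by (metis imageI)
  qed
  have pm: "p \<in> borel_measurable borel" if "p \<in> trig" for p :: "real^'n \<Rightarrow> complex"
    using trig_continuous[OF that] by (rule borel_measurable_continuous_onI)
  have tint: "integrable lborel (\<lambda>x. g x * p x)" if p: "p \<in> trig" for p
    using tb[OF p] bi[OF pm[OF p]] by blast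
  have t0: "(LINT x|lborel. g x * p x) = 0" if "p \<in> trig" for p
    using that
  proof (induction rule: trig.induct)
    case (exp k c)
    have "(LINT x|lborel. g x * (c * cis (2 * pi * (k \<bullet> x)))) = (LINT x|lborel. c * (g x * cis (2 * pi * (k \<bullet> x))))"
      by (simp add: mult.left_commute)
    also have "\<dots> = 0" using orth[OF exp] by simp
    finally show ?case .
  next
    case (add p q)
    then show ?case using tint by (simp add: distrib_left)
  qed
  have h0: "(LINT x|lborel. g x * of_real (h x)) = 0"
    if h: "continuous_on UNIV h" "\<And>x. x \<notin> Zopen \<Longrightarrow> h x = 0" for h :: "real^'n \<Rightarrow> real"
  proof -
    have "norm (LINT x|lborel. g x * of_real (h x)) \<le> e * (LINT x|lborel. norm (g x))" if "e > 0" for e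
    proof -
      obtain p where p: "p \<in> trig" "\<And>x. x \<in> Zclosed \<Longrightarrow> norm (of_real (h x) - p x) < e"
        using trig_approx[OF h \<open>e > 0\<close>] by blast
      have hm: "(\<lambda>x. complex_of_real (h x)) \<in> borel_measurable borel"
        using h(1) by (intro borel_measurable_continuous_onI continuous_intros)
      have dm: "(\<lambda>x. of_real (h x) - p x) \<in> borel_measurable borel"
        using hm pm[OF p(1)] by (rule borel_measurable_diff)
      have i2: "integrable lborel (\<lambda>x. g x * (of_real (h x) - p x))"
        by (rule bi[OF dm, of e]) (use p(2) less_imp_le in blast)
      have "(LINT x|lborel. g x * (of_real (h x) - p x) + g x * p x) = (LINT x|lborel. g x * (of_real (h x) - p x))"
        using i2 tint[OF p(1)] t0[OF p(1)] by simp
      then have eq: "(LINT x|lborel. g x * of_real (h x)) = (LINT x|lborel. g x * (of_real (h x) - p x))"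
        by (simp add: algebra_simps)
      have "norm (LINT x|lborel. g x * (of_real (h x) - p x)) \<le> (LINT x|lborel. norm (g x * (of_real (h x) - p x)))"
        by (rule integral_norm_bound)
      also have "\<dots> \<le> (LINT x|lborel. e * norm (g x))"
      proof (rule integral_mono)
        show "norm (g x * (of_real (h x) - p x)) \<le> e * norm (g x)" for x
        proof (cases "x \<in> Zcell")
          case True
          then have "norm (of_real (h x) - p x) \<le> e" using p(2)[of x] by (auto simp: Zclosed_iff Zcell_def less_imp_le)
          from mult_right_mono[OF this norm_ge_zero[of "g x"]]
          show ?thesis by (simp add: norm_mult mult.commute)
        qed (simp add: gZ)
      qed (use i2 g in auto)
      finally show ?thesis unfolding eq by simp
    qed
    note * = this
    have "norm (LINT x|lborel. g x * of_real (h x)) \<le> 0"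
    proof (rule field_le_epsilon)
      fix d :: real assume d: "d > 0"
      let ?N = "LINT x|lborel. norm (g x)"
      have N: "?N \<ge> 0" by simp
      have "norm (LINT x|lborel. g x * of_real (h x)) \<le> d / (?N + 1) * ?N"
        by (rule *) (use d N in \<open>simp add: add_nonneg_pos\<close>)
      also have "\<dots> \<le> d"
      proof -
        have "d / (N + 1) * N \<le> d" if "N \<ge> 0" for N
          using d that by (simp add: field_simps)
        then show ?thesis using N by blast
      qed
      finally show "norm (LINT x|lborel. g x * of_real (h x)) \<le> 0 + d" by simp
    qed
    then show ?thesis by simp
  qed
  have hc: "(LINT x|lborel. g x * h x) = 0"
    if h: "continuous_on UNIV h" "\<And>x. x \<notin> Zopen \<Longrightarrow> h x = 0" "\<And>x. norm (h x) \<le> 1" for h :: "real^'n \<Rightarrow> complex"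
  proof -
    have cr: "continuous_on UNIV (\<lambda>x. Re (h x))" "continuous_on UNIV (\<lambda>x. Im (h x))"
      using h(1) by (auto intro: continuous_intros)
    have m: "(\<lambda>x. complex_of_real (Re (h x))) \<in> borel_measurable borel" "(\<lambda>x. complex_of_real (Im (h x))) \<in> borel_measurable borel"
      using cr by (auto intro!: borel_measurable_continuous_onI continuous_intros)
    have i: "integrable lborel (\<lambda>x. g x * of_real (Re (h x)))" "integrable lborel (\<lambda>x. g x * of_real (Im (h x)))"
      by (rule bi[OF m(1), of 1], simp, rule order_trans[OF abs_Re_le_cmod h(3)])
        (rule bi[OF m(2), of 1], simp, rule order_trans[OF abs_Im_le_cmod h(3)])
    have "(LINT x|lborel. g x * h x) = (LINT x|lborel. g x * of_real (Re (h x)) + \<i> * (g x * of_real (Im (h x))))"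
      by (rule arg_cong[where f="integral\<^sup>L lborel"]) (simp add: fun_eq_iff complex_eq_iff algebra_simps)
    also have "\<dots> = (LINT x|lborel. g x * of_real (Re (h x))) + \<i> * (LINT x|lborel. g x * of_real (Im (h x)))"
      using i by simp
    also have "\<dots> = 0" using h0[OF cr(1)] h0[OF cr(2)] h(2) by simp
    finally show ?thesis .
  qed
  \<comment> \<open>test against cut-off continuous approximations of the phase \<open>cnj g / \<bar>g\<bar>\<close>\<close>
  define s where "s x = (if g x = 0 then 0 else cnj (g x) / of_real (norm (g x)))" for x
  have cnjm: "(\<lambda>x. cnj (g x)) \<in> borel_measurable borel"
    by (rule borel_measurable_continuous_on[OF continuous_on_cnj[OF continuous_on_id] gm])
  have "s \<in> borel_measurable borel" unfolding s_def[abs_def] using cnjm by measurable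
  then have "s \<in> borel_measurable lebesgue" by (simp add: measurable_completion)
  then have "s measurable_on UNIV" by (rule lebesgue_measurable_imp_measurable_on) simp
  then obtain N G where N: "negligible N" and G: "\<And>n::nat. continuous_on UNIV (G n)"
    and lim: "\<And>x. x \<notin> N \<Longrightarrow> (\<lambda>n. G n x) \<longlonglongrightarrow> s x"
    unfolding measurable_on_def by auto
  have s1: "norm (s x) \<le> 1" for x by (simp add: s_def norm_divide)
  \<comment> \<open>\<open>coff n\<close> vanishes off the open cell and is eventually \<open>1\<close> at each of its points; dividing \<open>G n\<close> by
    \<open>max 1 \<bar>G n\<bar>\<close> keeps the limit, whose modulus is at most \<open>1\<close>, and gives a bound\<close>
  define coff where "coff n x = min 1 (real n * infdist x (- Zopen))" for n :: nat and x :: "real^'n"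
  define h where "h n x = of_real (coff n x) * (G n x / of_real (max 1 (norm (G n x))))" for n x
  have ne: "- (Zopen :: (real^'n) set) \<noteq> {}"
  proof -
    have "(\<chi> i. 1) \<notin> (Zopen :: (real^'n) set)" by (simp add: Zopen_iff)
    then show ?thesis by blast
  qed
  have chi: "0 \<le> coff n x" "coff n x \<le> 1" for n x by (auto simp: coff_def infdist_nonneg)
  have hcont: "continuous_on UNIV (h n)" for n
    unfolding h_def coff_def using G by (intro continuous_intros) auto
  have hZ: "h n x = 0" if "x \<notin> Zopen" for n x
    using that by (simp add: h_def coff_def)
  have hb: "norm (h n x) \<le> 1" for n x
  proof -
    have "norm (G n x) / max 1 (norm (G n x)) \<le> 1" by (auto simp: field_simps)
    then have "coff n x * (norm (G n x) / max 1 (norm (G n x))) \<le> 1"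
      using chi[of n x] by (intro mult_le_one) auto
    then show ?thesis using chi[of n x] by (simp add: h_def norm_mult norm_divide)
  qed
  have hlim: "(\<lambda>n. g x * h n x) \<longlonglongrightarrow> of_real (norm (g x))" if x: "x \<notin> N" "x \<in> Zopen" for x
  proof -
    have "open (Zopen :: (real^'n) set)" unfolding Zopen_def by (rule open_box)
    then have d: "infdist x (- Zopen) > 0"
      using x(2) ne by (metis ComplD closed_Compl in_closed_iff_infdist_zero infdist_nonneg less_eq_real_def)
    obtain n0 where n0: "1 < real n0 * infdist x (- Zopen)" using reals_Archimedean3[OF d] by blast
    have "eventually (\<lambda>n. coff n x = 1) sequentially"
      unfolding eventually_sequentially
    proof (intro exI[of _ n0] allI impI)
      fix n assume "n0 \<le> n"
      then have "real n0 * infdist x (- Zopen) \<le> real n * infdist x (- Zopen)"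
        using d by (intro mult_right_mono) auto
      then show "coff n x = 1" using n0 by (simp add: coff_def)
    qed
    then have l1: "(\<lambda>n. coff n x) \<longlonglongrightarrow> 1" by (rule tendsto_eventually)
    have "(\<lambda>n. g x * h n x) \<longlonglongrightarrow> g x * (of_real 1 * (s x / of_real (max 1 (norm (s x)))))"
      unfolding h_def by (intro tendsto_intros l1 lim x) (auto simp: max_def)
    also have "max 1 (norm (s x)) = 1" using s1[of x] by simp
    also have "g x * (of_real 1 * (s x / of_real 1)) = of_real (norm (g x))"
    proof (cases "g x = 0")
      case False
      then show ?thesis by (simp add: s_def complex_norm_square[symmetric] power2_eq_square)
    qed simp
    finally show ?thesis .
  qed
  have "AE x in lborel. x \<notin> (Zcell :: (real^'n) set) - Zopen"
  proof -
    have "negligible ((Zclosed :: (real^'n) set) - Zopen)"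
      unfolding Zclosed_def Zopen_def by (rule negligible_frontier_interval)
    then have "AE x in lebesgue. x \<notin> (Zclosed :: (real^'n) set) - Zopen"
      unfolding negligible_iff_null_sets by (rule AE_not_in)
    moreover have "(Zclosed :: (real^'n) set) - Zopen \<in> sets borel" by (simp add: Zclosed_def Zopen_def)
    ultimately have "AE x in lborel. x \<notin> (Zclosed :: (real^'n) set) - Zopen"
      by (simp add: AE_completion_iff)
    then show ?thesis by eventually_elim (use Zcell_subset_Zclosed in blast)
  qed
  moreover have "AE x in lborel. x \<notin> N"
  proof -
    have "AE x in lebesgue. x \<notin> N" using N by (simp add: negligible_iff_null_sets AE_not_in)
    then show ?thesis by (simp add: AE_completion_iff)
  qed
  ultimately have lim2: "AE x in lborel. (\<lambda>n. g x * h n x) \<longlonglongrightarrow> complex_of_real (norm (g x))"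
  proof eventually_elim
    fix x assume "x \<notin> Zcell - Zopen" "x \<notin> N"
    then show "(\<lambda>n. g x * h n x) \<longlonglongrightarrow> complex_of_real (norm (g x))"
      using hlim[of x] gZ[of x] by (cases "x \<in> Zcell") auto
  qed
  have "(\<lambda>n. LINT x|lborel. g x * h n x) \<longlonglongrightarrow> (LINT x|lborel. complex_of_real (norm (g x)))"
  proof (rule integral_dominated_convergence[OF _ _ _ lim2, of "\<lambda>x. norm (g x)"])
    show "AE x in lborel. norm (g x * h n x) \<le> norm (g x)" for n
      using hb[of n] by (auto simp: norm_mult mult_left_le)
    show "(\<lambda>x. g x * h n x) \<in> borel_measurable lborel" for n
      using borel_measurable_continuous_onI[OF hcont[of n]] by measurable
  qed (use g in auto)
  moreover have "(LINT x|lborel. g x * h n x) = 0" for n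
    using hc[OF hcont hZ hb] by blast
  ultimately have "(\<lambda>n::nat. 0) \<longlonglongrightarrow> (LINT x|lborel. complex_of_real (norm (g x)))" by simp
  from LIMSEQ_unique[OF tendsto_const this] have "(LINT x|lborel. norm (g x)) = 0"
    by (simp only: integral_complex_of_real) simp
  then show ?thesis using integral_nonneg_eq_0_iff_AE[of lborel "\<lambda>x. norm (g x)"] g by simp
qed

subsection \<open>Parseval\<close>

lemma L2_inner_sum_orthonormal:
  assumes b: "\<And>n::nat. b n \<in> L2" and on: "\<And>m n. L2inner (b m) (b n) = (if m = n then 1 else 0)"
    and w: "w \<in> L2" and I: "finite I"
  shows "L2inner (\<lambda>x. \<Sum>i\<in>I. c i * b i x) w = (\<Sum>i\<in>I. c i * L2inner (b i) w)"
    "(L2norm (\<lambda>x. \<Sum>i\<in>I. c i * b i x))\<^sup>2 = (\<Sum>i\<in>I. (norm (c i))\<^sup>2)"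
proof -
  have gen: "L2inner (\<lambda>x. \<Sum>i\<in>J. c i * b i x) w = (\<Sum>i\<in>J. c i * L2inner (b i) w)"
    if "w \<in> L2" "finite J" for w J
    using that(2)
  proof (induction J rule: finite_induct)
    case empty then show ?case by (simp add: L2inner_def)
  next
    case (insert i J)
    have "L2inner (\<lambda>x. c i * b i x + (\<Sum>i\<in>J. c i * b i x)) w = c i * L2inner (b i) w + (\<Sum>i\<in>J. c i * L2inner (b i) w)"
      unfolding insert(3)[symmetric]
      by (subst L2inner_add_left) (auto intro!: L2_cmult L2_sum b that simp: L2inner_cmult_left)
    then show ?case using insert(1,2) by simp
  qed
  then show "L2inner (\<lambda>x. \<Sum>i\<in>I. c i * b i x) w = (\<Sum>i\<in>I. c i * L2inner (b i) w)" using w I by blast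
  let ?S = "\<lambda>x. \<Sum>i\<in>I. c i * b i x"
  have S: "?S \<in> L2" by (intro L2_sum L2_cmult b)
  have 1: "L2inner (b i) ?S = cnj (c i)" if "i \<in> I" for i
  proof -
    have "L2inner ?S (b i) = (\<Sum>j\<in>I. if j = i then c j else 0)"
      unfolding gen[OF b I] on by (rule sum.cong) auto
    also have "\<dots> = c i" using that I by simp
    finally show ?thesis using L2inner_commute[of "b i" ?S] by simp
  qed
  have "complex_of_real ((L2norm ?S)\<^sup>2) = (\<Sum>i\<in>I. c i * L2inner (b i) ?S)"
    unfolding L2inner_self[OF S, symmetric] by (rule gen[OF S I])
  also have "\<dots> = (\<Sum>i\<in>I. complex_of_real ((norm (c i))\<^sup>2))"
    by (rule sum.cong) (simp_all add: 1 complex_norm_square del: of_real_power)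
  finally have "complex_of_real ((L2norm ?S)\<^sup>2) = complex_of_real (\<Sum>i\<in>I. (norm (c i))\<^sup>2)" by simp
  then show "(L2norm ?S)\<^sup>2 = (\<Sum>i\<in>I. (norm (c i))\<^sup>2)" by (simp only: of_real_eq_iff)
qed

text \<open>The partial sums are Cauchy by Bessel's inequality.  The difference \<open>w\<close> of \<open>G\<close> and their limit is
  orthogonal to all \<open>b n\<close>, hence to the partial sums and, by completeness, to \<open>G\<close>, hence to itself.\<close>

lemma L2_Parseval:
  assumes b: "\<And>n::nat. b n \<in> L2" and on: "\<And>m n. L2inner (b m) (b n) = (if m = n then 1 else 0)"
    and G: "G \<in> L2"
    and complete: "\<And>w. w \<in> L2 \<Longrightarrow> (\<And>n. L2inner w (b n) = 0) \<Longrightarrow> L2inner w G = 0"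
  shows "(\<lambda>n. (norm (L2inner G (b n)))\<^sup>2) sums (L2norm G)\<^sup>2"
proof -
  define c where "c n = L2inner G (b n)" for n
  define S where "S N x = (\<Sum>i<N. c i * b i x)" for N x
  have S: "S N \<in> L2" for N unfolding S_def by (intro L2_sum L2_cmult b)
  have nS: "(L2norm (S N))\<^sup>2 = (\<Sum>i<N. (norm (c i))\<^sup>2)" for N
    unfolding S_def by (rule L2_inner_sum_orthonormal(2)[OF b on G]) auto
  have GS: "L2inner G (S N) = of_real (\<Sum>i<N. (norm (c i))\<^sup>2)" for N
  proof -
    have "L2inner (S N) G = (\<Sum>i<N. c i * cnj (c i))"
      unfolding S_def by (subst L2_inner_sum_orthonormal(1)[OF b on G]) (auto simp: c_def L2inner_commute[of "b _" G])
    then show ?thesis using L2inner_commute[of G "S N"] by (simp add: complex_norm_square[symmetric])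
  qed
  have pyth: "(L2norm (\<lambda>x. G x - S N x))\<^sup>2 = (L2norm G)\<^sup>2 - (\<Sum>i<N. (norm (c i))\<^sup>2)" for N
    unfolding L2norm_diff_power2[OF G S] GS nS by simp
  then have bess: "(\<Sum>i<N. (norm (c i))\<^sup>2) \<le> (L2norm G)\<^sup>2" for N
    using pyth[of N] zero_le_power2[of "L2norm (\<lambda>x. G x - S N x)"] by linarith
  have summ: "summable (\<lambda>i. (norm (c i))\<^sup>2)"
    by (rule summableI_nonneg_bounded[OF _ bess]) simp
  have diffS: "(L2norm (\<lambda>x. S m x - S n x))\<^sup>2 = (\<Sum>i=n..<m. (norm (c i))\<^sup>2)" if "n \<le> m" for m n
  proof -
    have "S m x - S n x = (\<Sum>i=n..<m. c i * b i x)" for x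
      unfolding S_def using sum_diff_nat_ivl[of 0 n m "\<lambda>i. c i * b i x"] that by (simp add: atLeast0LessThan)
    then show ?thesis using L2_inner_sum_orthonormal(2)[OF b on G, of "{n..<m}" c] by simp
  qed
  have cau: "\<exists>N. \<forall>m\<ge>N. \<forall>n\<ge>N. L2norm (\<lambda>x. S m x - S n x) \<le> e" if e: "0 < e" for e
  proof -
    obtain N where N: "\<And>m n. m \<ge> N \<Longrightarrow> norm (\<Sum>i=m..<n. (norm (c i))\<^sup>2) < e\<^sup>2"
      using summ e unfolding summable_Cauchy by (meson zero_less_power)
    have *: "L2norm (\<lambda>x. S m x - S n x) \<le> e" if "n \<ge> N" "n \<le> m" for m n
    proof (rule power2_le_imp_le)
      show "(L2norm (\<lambda>x. S m x - S n x))\<^sup>2 \<le> e\<^sup>2"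
        unfolding diffS[OF that(2)] using N[OF that(1), of m] by simp
    qed (use e in simp)
    have "L2norm (\<lambda>x. S m x - S n x) \<le> e" if "m \<ge> N" "n \<ge> N" for m n
      using *[of n m] *[of m n] that L2norm_diff_commute[of "S m" "S n"] by (cases "n \<le> m") auto
    then show ?thesis by blast
  qed
  obtain v where v: "v \<in> L2" "(\<lambda>n. L2norm (\<lambda>x. S n x - v x)) \<longlonglongrightarrow> 0"
    using L2_complete[OF S cau] by blast
  define w where "w x = G x - v x" for x
  have w: "w \<in> L2" unfolding w_def by (rule L2_diff[OF G v(1)])
  \<comment> \<open>inner products pass to the limit of the partial sums\<close>
  have limin: "(\<lambda>N. L2inner (S N) z) \<longlonglongrightarrow> L2inner v z" if z: "z \<in> L2" for z
  proof -
    have "(\<lambda>N. L2inner (S N) z - L2inner v z) \<longlonglongrightarrow> 0"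
    proof (rule Lim_null_comparison)
      show "\<forall>\<^sub>F N in sequentially. norm (L2inner (S N) z - L2inner v z) \<le> L2norm (\<lambda>x. S N x - v x) * L2norm z"
        using L2_Cauchy_Schwarz[OF L2_diff[OF S v(1)] z] L2inner_diff_left[OF S v(1) z] by simp
      show "(\<lambda>N. L2norm (\<lambda>x. S N x - v x) * L2norm z) \<longlonglongrightarrow> 0"
        using tendsto_mult_left_zero[OF v(2)] by simp
    qed
    then show ?thesis by (simp add: LIM_zero_iff)
  qed
  have w0: "L2inner w (b n) = 0" for n
  proof -
    have "L2inner (S N) (b n) = c n" if "n < N" for N
    proof -
      have "L2inner (S N) (b n) = (\<Sum>j<N. if j = n then c j else 0)"
        unfolding S_def L2_inner_sum_orthonormal(1)[OF b on b finite_lessThan] on by (rule sum.cong) auto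
      then show ?thesis using that by simp
    qed
    then have "(\<lambda>N. L2inner (S N) (b n)) \<longlonglongrightarrow> c n"
      by (intro tendsto_eventually) (auto simp: eventually_sequentially intro!: exI[of _ "Suc n"])
    with limin[OF b, of n] have "L2inner v (b n) = c n" using LIMSEQ_unique by blast
    then show ?thesis unfolding w_def L2inner_diff_left[OF G v(1) b] c_def by simp
  qed
  have "L2inner v w = 0"
  proof -
    have "L2inner (S N) w = 0" for N
      unfolding S_def L2_inner_sum_orthonormal(1)[OF b on w finite_lessThan]
      using w0 L2inner_commute[of "b _" w] by simp
    then show ?thesis using limin[OF w] LIMSEQ_unique[OF _ tendsto_const[of 0]] by auto
  qed
  moreover have "L2inner G w = 0" using complete[OF w w0] L2inner_commute[of G w] by simp
  moreover have weq: "w = (\<lambda>x. G x - v x)" by (simp add: w_def fun_eq_iff)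
  have "L2inner w w = L2inner G w - L2inner v w"
    by (subst (1) weq) (rule L2inner_diff_left[OF G v(1) w])
  ultimately have "L2inner w w = 0" by simp
  then have "L2norm w = 0" using L2inner_self[OF w] by simp
  have "L2norm (\<lambda>x. G x - S N x) \<le> L2norm (\<lambda>x. S N x - v x)" for N
    using L2norm_triangle_diff[OF G v(1) S, of N] \<open>L2norm w = 0\<close> L2norm_diff_commute[of "S N" v]
    by (simp add: weq)
  then have "(\<lambda>N. L2norm (\<lambda>x. G x - S N x)) \<longlonglongrightarrow> 0"
    by (intro tendsto_sandwich[OF _ _ tendsto_const v(2)]) auto
  from tendsto_power[OF this, of 2]
  have "(\<lambda>N. (L2norm G)\<^sup>2 - (\<Sum>i<N. (norm (c i))\<^sup>2)) \<longlonglongrightarrow> 0" by (simp add: pyth)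
  from tendsto_diff[OF tendsto_const[of "(L2norm G)\<^sup>2"] this]
  have "(\<lambda>N. \<Sum>i<N. (norm (c i))\<^sup>2) \<longlonglongrightarrow> (L2norm G)\<^sup>2" by simp
  then show ?thesis unfolding sums_def c_def .
qed

lemma L2_Zcell_integrable:
  fixes g :: "real^'n \<Rightarrow> complex"
  assumes "g \<in> L2" "\<And>x. x \<notin> Zcell \<Longrightarrow> g x = 0"
  shows "integrable lborel g"
proof -
  have "(\<lambda>x. indicator Zcell x *\<^sub>R g x) = g" using assms(2) by (auto simp: fun_eq_iff indicator_def)
  then show ?thesis using L2_finite_integrable[OF assms(1) Zcell_sets Zcell_emeasure_finite] by simp
qed

text \<open>The basis elements are \<open>cis (2 * pi * (lat n \<bullet> x))\<close>; conjugating \<open>g\<close> gives the coefficients the sign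
  that the lattice values of a synthesized function have.\<close>

lemma Fourier_series_Parseval:
  fixes g :: "real^'n \<Rightarrow> complex"
  assumes g: "g \<in> L2" and gZ: "\<And>x. x \<notin> Zcell \<Longrightarrow> g x = 0"
  shows "(\<lambda>n. (norm (LINT x|lborel. g x * cis (2 * pi * (x \<bullet> lat n))))\<^sup>2) sums (L2norm g)\<^sup>2"
proof -
  have inner: "L2inner w (lat_exp n) = (LINT x|lborel. (indicator Zcell x *\<^sub>R w x) * cis (2 * pi * (- lat n \<bullet> x)))" for w n
    unfolding L2inner_def
    by (rule arg_cong[where f="integral\<^sup>L lborel"]) (auto simp: fun_eq_iff lat_exp_def indicator_def cis_cnj)
  have comp: "L2inner w (\<lambda>x. cnj (g x)) = 0" if w: "w \<in> L2" "\<And>n. L2inner w (lat_exp n) = 0" for w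
  proof -
    let ?w = "\<lambda>x. indicator Zcell x *\<^sub>R w x"
    have w': "?w \<in> L2" by (rule L2_indicator[OF w(1) Zcell_sets])
    have "AE x in lborel. ?w x = 0"
    proof (rule trig_complete)
      show "integrable lborel ?w" by (rule L2_Zcell_integrable[OF w']) simp
      fix k :: "real^'n" assume "k \<in> lattice"
      then have "- k \<in> lattice" by (auto simp: lattice_def)
      then obtain n where "lat n = - k" using lat_bij unfolding bij_betw_def by (metis UNIV_I imageE)
      then show "(LINT x|lborel. ?w x * cis (2 * pi * (k \<bullet> x))) = 0" using w(2)[of n] inner[of w n] by simp
    qed simp
    then have "AE x in lborel. w x * cnj (cnj (g x)) = 0"
    proof eventually_elim
      fix x assume "?w x = 0"
      then show "w x * cnj (cnj (g x)) = 0" using gZ[of x] by (cases "x \<in> Zcell") auto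
    qed
    then show ?thesis unfolding L2inner_def by (rule integral_eq_zero_AE)
  qed
  have "(\<lambda>n. (norm (L2inner (\<lambda>x. cnj (g x)) (lat_exp n)))\<^sup>2) sums (L2norm (\<lambda>x. cnj (g x)))\<^sup>2"
    by (rule L2_Parseval[OF lat_exp_L2 lat_exp_orthonormal L2_cnj[OF g] comp])
  moreover have "L2norm (\<lambda>x. cnj (g x)) = L2norm g" by (rule L2norm_cong) simp
  moreover have "norm (L2inner (\<lambda>x. cnj (g x)) (lat_exp n)) = norm (LINT x|lborel. g x * cis (2 * pi * (x \<bullet> lat n)))" for n
  proof -
    have "cnj (L2inner (\<lambda>x. cnj (g x)) (lat_exp n)) = L2inner (lat_exp n) (\<lambda>x. cnj (g x))"
      by (rule L2inner_commute[symmetric])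
    also have "\<dots> = (LINT x|lborel. g x * cis (2 * pi * (x \<bullet> lat n)))"
      unfolding L2inner_def
      by (rule arg_cong[where f="integral\<^sup>L lborel"])
        (use gZ in \<open>auto simp: fun_eq_iff lat_exp_def indicator_def inner_commute\<close>)
    finally show ?thesis by (metis complex_mod_cnj)
  qed
  ultimately show ?thesis by simp
qed

section \<open>Isometric kernels\<close>

text \<open>Fourier and Bloch transforms are treated together: \<open>w x \<eta>\<close> is a plane wave or a Bloch wave at the point
  \<open>x\<close> with frequency \<open>\<eta>\<close>, and \<open>S\<close> is a set of frequencies.  Analysis is truncated to a ball because the
  full integral exists as an \<open>L\<^sup>2\<close> limit only.\<close>

definition synth :: "(real^'n \<Rightarrow> real^'n \<Rightarrow> complex) \<Rightarrow> (real^'n) set \<Rightarrow> (real^'n \<Rightarrow> complex) \<Rightarrow> real^'n \<Rightarrow> complex" where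
  "synth w S g x = (LINT \<eta>:S|lborel. g \<eta> * w x \<eta>)"

definition analysis :: "(real^'n \<Rightarrow> real^'n \<Rightarrow> complex) \<Rightarrow> real \<Rightarrow> (real^'n \<Rightarrow> complex) \<Rightarrow> real^'n \<Rightarrow> complex" where
  "analysis w R u \<eta> = (LINT x:cball 0 R|lborel. u x * cnj (w x \<eta>))"

definition trunc :: "real \<Rightarrow> (real^'n \<Rightarrow> 'b::real_normed_vector) \<Rightarrow> real^'n \<Rightarrow> 'b" where
  "trunc R u x = indicator (cball 0 R) x *\<^sub>R u x"

lemma cball_sets [measurable]: "cball a R \<in> sets (borel :: 'a::metric_space measure)"
  by (rule borel_closed) (rule closed_cball)

lemma borel_measurable_integral_lborel:
  fixes f :: "real^'n \<Rightarrow> real^'n \<Rightarrow> complex"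
  assumes "case_prod f \<in> borel_measurable (borel \<Otimes>\<^sub>M borel)"
  shows "(\<lambda>x. LINT y|lborel. f x y) \<in> borel_measurable borel"
proof -
  have eq: "sets (borel \<Otimes>\<^sub>M borel) = sets ((borel :: (real^'n) measure) \<Otimes>\<^sub>M (lborel :: (real^'n) measure))"
    by (rule sets_pair_measure_cong) simp_all
  have "borel_measurable (borel \<Otimes>\<^sub>M borel)
      = (borel_measurable ((borel :: (real^'n) measure) \<Otimes>\<^sub>M (lborel :: (real^'n) measure)) :: (_ \<Rightarrow> complex) set)"
    by (rule measurable_cong_sets[OF eq refl])
  with assms have "case_prod f \<in> borel_measurable (borel \<Otimes>\<^sub>M lborel)" by blast
  then show ?thesis by (rule lborel.borel_measurable_lebesgue_integral)
qed

lemma trunc_L2: "u \<in> L2 \<Longrightarrow> trunc R u \<in> L2"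
  unfolding trunc_def[abs_def] by (rule L2_indicator) auto

lemma trunc_tendsto:
  fixes u :: "real^'n \<Rightarrow> 'b::{banach,second_countable_topology}"
  assumes u: "u \<in> L2"
  shows "((\<lambda>R. L2norm (\<lambda>x. trunc R u x - u x)) \<longlongrightarrow> 0) at_top"
proof -
  have [measurable]: "u \<in> borel_measurable borel" using u by auto
  have "((\<lambda>R. LINT x|lborel. (norm (trunc R u x - u x))\<^sup>2) \<longlongrightarrow> (LINT x|(lborel :: (real^'n) measure). 0 :: real)) at_top"
  proof (rule integral_dominated_convergence_at_top[where f="\<lambda>x. 0" and s="\<lambda>R x. (norm (trunc R u x - u x))\<^sup>2"
        and M=lborel and w="\<lambda>x. (norm (u x))\<^sup>2"])
    show "integrable lborel (\<lambda>x. (norm (u x))\<^sup>2)" by (rule L2_integrable[OF u])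
    show "\<forall>\<^sub>F R in at_top. AE x in lborel. norm ((norm (trunc R u x - u x))\<^sup>2) \<le> (norm (u x))\<^sup>2"
      by (rule always_eventually) (auto simp: trunc_def indicator_def)
    show "AE x in lborel. ((\<lambda>R. (norm (trunc R u x - u x))\<^sup>2) \<longlongrightarrow> 0) at_top"
    proof (rule AE_I2)
      fix x
      have "eventually (\<lambda>R. (norm (trunc R u x - u x))\<^sup>2 = 0) at_top"
        using eventually_ge_at_top[of "norm x"] by eventually_elim (auto simp: trunc_def)
      then show "((\<lambda>R. (norm (trunc R u x - u x))\<^sup>2) \<longlongrightarrow> 0) at_top" by (rule tendsto_eventually)
    qed
  qed (auto simp: trunc_def)
  then have "((\<lambda>R. sqrt (LINT x|lborel. (norm (trunc R u x - u x))\<^sup>2)) \<longlongrightarrow> sqrt 0) at_top"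
    by (intro tendsto_real_sqrt) simp
  then show ?thesis by (simp add: L2norm_def)
qed

text \<open>The conditions on \<open>S\<close> and the local bound, uniform in the frequency, serve to justify Fubini when
  synthesis is paired with truncated analysis.\<close>

locale isometric_kernel =
  fixes w :: "real^'n \<Rightarrow> real^'n \<Rightarrow> complex" and S :: "(real^'n) set"
  assumes S_sets [measurable]: "S \<in> sets borel"
    and S_finite: "emeasure lborel S < \<infinity>"
    and kernel_measurable: "(\<lambda>(x, \<eta>). indicator S \<eta> *\<^sub>R w x \<eta>) \<in> borel_measurable (borel \<Otimes>\<^sub>M borel)"
    and kernel_local: "\<exists>C. \<forall>\<eta>\<in>S. (\<integral>\<^sup>+x. ennreal ((norm (w x \<eta>))\<^sup>2) * indicator (cball 0 R) x \<partial>lborel) \<le> ennreal C"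
    and synth_L2: "g \<in> L2 \<Longrightarrow> synth w S g \<in> L2"
    and synth_norm: "g \<in> L2 \<Longrightarrow> L2norm (synth w S g) = L2norm (\<lambda>\<eta>. indicator S \<eta> *\<^sub>R g \<eta>)"
    and synth_integrable: "g \<in> L2 \<Longrightarrow> AE x in lborel. integrable lborel (\<lambda>\<eta>. indicator S \<eta> *\<^sub>R (g \<eta> * w x \<eta>))"
begin

text \<open>Only the values of \<open>w\<close> for frequencies in \<open>S\<close> are known to be measurable.\<close>

definition "W x \<eta> = indicator S \<eta> *\<^sub>R w x \<eta>"

lemma W_measurable [measurable]: "case_prod W \<in> borel_measurable (borel \<Otimes>\<^sub>M borel)"
  using kernel_measurable by (simp add: W_def[abs_def])

lemma synth_W: "synth w S g x = (LINT \<eta>|lborel. g \<eta> * W x \<eta>)"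
  unfolding synth_def set_lebesgue_integral_def W_def by simp

lemma synth_add:
  assumes "g \<in> L2" "h \<in> L2"
  shows "AE x in lborel. synth w S (\<lambda>\<eta>. g \<eta> + h \<eta>) x = synth w S g x + synth w S h x"
  using synth_integrable[OF assms(1)] synth_integrable[OF assms(2)]
  by eventually_elim
    (simp add: synth_def set_lebesgue_integral_def distrib_right scaleR_add_right)

lemma synth_cmult: "synth w S (\<lambda>\<eta>. c * g \<eta>) x = c * synth w S g x"
proof -
  have "synth w S (\<lambda>\<eta>. c * g \<eta>) x = (LINT \<eta>|lborel. c * (indicator S \<eta> *\<^sub>R (g \<eta> * w x \<eta>)))"
    unfolding synth_def set_lebesgue_integral_def
    by (rule arg_cong[where f="integral\<^sup>L lborel"]) (simp add: fun_eq_iff mult_ac)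
  also have "\<dots> = c * (LINT \<eta>|lborel. indicator S \<eta> *\<^sub>R (g \<eta> * w x \<eta>))"
    by (rule integral_mult_right_zero)
  finally show ?thesis unfolding synth_def set_lebesgue_integral_def .
qed

lemma W_local:
  obtains C where "0 \<le> C" "\<And>\<eta>. (\<integral>\<^sup>+x. ennreal ((norm (trunc R (\<lambda>x. W x \<eta>) x))\<^sup>2) \<partial>lborel) \<le> ennreal C"
proof -
  obtain C where C: "\<forall>\<eta>\<in>S. (\<integral>\<^sup>+x. ennreal ((norm (w x \<eta>))\<^sup>2) * indicator (cball 0 R) x \<partial>lborel) \<le> ennreal C"
    using kernel_local by blast
  have "(\<integral>\<^sup>+x. ennreal ((norm (trunc R (\<lambda>x. W x \<eta>) x))\<^sup>2) \<partial>lborel) \<le> ennreal (max 0 C)" for \<eta>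
  proof (cases "\<eta> \<in> S")
    case True
    have "(\<integral>\<^sup>+x. ennreal ((norm (trunc R (\<lambda>x. W x \<eta>) x))\<^sup>2) \<partial>lborel)
        = (\<integral>\<^sup>+x. ennreal ((norm (w x \<eta>))\<^sup>2) * indicator (cball 0 R) x \<partial>lborel)"
      using True by (intro nn_integral_cong) (simp add: trunc_def W_def indicator_def)
    also have "\<dots> \<le> ennreal C" using C True by blast
    also have "\<dots> \<le> ennreal (max 0 C)" by (intro ennreal_leI) simp
    finally show ?thesis .
  qed (simp add: trunc_def W_def)
  then show ?thesis by (rule that[rotated]) simp
qed

lemma W_trunc_L2: "trunc R (\<lambda>x. W x \<eta>) \<in> L2"
proof -
  obtain C where "(\<integral>\<^sup>+x. ennreal ((norm (trunc R (\<lambda>x. W x \<eta>) x))\<^sup>2) \<partial>lborel) \<le> ennreal C"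
    using W_local by metis
  then show ?thesis unfolding L2_iff_nn by (auto simp: le_less_trans trunc_def[abs_def])
qed

lemma analysis_W: "indicator S \<eta> *\<^sub>R analysis w R u \<eta> = L2inner (trunc R u) (trunc R (\<lambda>x. W x \<eta>))"
proof -
  have "indicator S \<eta> *\<^sub>R analysis w R u \<eta> = (LINT x|lborel. indicator S \<eta> *\<^sub>R (indicator (cball 0 R) x *\<^sub>R (u x * cnj (w x \<eta>))))"
    unfolding analysis_def set_lebesgue_integral_def by (cases "\<eta> \<in> S") simp_all
  also have "\<dots> = L2inner (trunc R u) (trunc R (\<lambda>x. W x \<eta>))"
    unfolding L2inner_def
    by (rule arg_cong[where f="integral\<^sup>L lborel"]) (simp add: fun_eq_iff trunc_def W_def indicator_def)
  finally show ?thesis .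
qed

lemma analysis_L2:
  assumes u: "u \<in> L2"
  shows "(\<lambda>\<eta>. indicator S \<eta> *\<^sub>R analysis w R u \<eta>) \<in> L2"
proof -
  have [measurable]: "u \<in> borel_measurable borel" using u by auto
  let ?A = "\<lambda>\<eta>. L2inner (trunc R u) (trunc R (\<lambda>x. W x \<eta>))"
  have "(\<lambda>\<eta>. LINT x|lborel. trunc R u x * cnj (trunc R (\<lambda>x. W x \<eta>) x)) \<in> borel_measurable borel"
    unfolding trunc_def by (rule borel_measurable_integral_lborel) measurable
  then have Am: "?A \<in> borel_measurable borel" by (simp add: L2inner_def)
  obtain C where C: "0 \<le> C" "\<And>\<eta>. (\<integral>\<^sup>+x. ennreal ((norm (trunc R (\<lambda>x. W x \<eta>) x))\<^sup>2) \<partial>lborel) \<le> ennreal C"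
    by (rule W_local) auto
  have n: "L2norm (trunc R (\<lambda>x. W x \<eta>)) \<le> sqrt C" for \<eta>
    by (rule L2norm_le_nn[OF _ W_trunc_L2]) (use C in auto)
  have Ab: "norm (?A \<eta>) \<le> L2norm (trunc R u) * sqrt C" for \<eta>
    by (rule order_trans[OF L2_Cauchy_Schwarz[OF trunc_L2[OF u] W_trunc_L2]]) (intro mult_left_mono n, simp)
  have A0: "?A \<eta> = indicator S \<eta> *\<^sub>R ?A \<eta>" for \<eta>
    unfolding analysis_W[symmetric] by (simp add: indicator_def)
  note 1 = L2_indicator_finite[OF S_sets S_finite]
  have "?A \<in> L2"
  proof (rule L2_bound(1)[OF 1 Am, of "L2norm (trunc R u) * sqrt C"])
    fix \<eta>
    show "norm (?A \<eta>) \<le> L2norm (trunc R u) * sqrt C * norm (complex_of_real (indicator S \<eta>))"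
      using Ab[of \<eta>] A0[of \<eta>] by (cases "\<eta> \<in> S") auto
  qed
  then show ?thesis by (simp add: analysis_W)
qed

text \<open>Truncated analysis is adjoint to synthesis; Fubini applies because of the local bound.\<close>

lemma analysis_adjoint:
  assumes u: "u \<in> L2" and g: "g \<in> L2"
  shows "L2inner (\<lambda>\<eta>. indicator S \<eta> *\<^sub>R analysis w R u \<eta>) g = L2inner (trunc R u) (synth w S g)"
proof -
  have [measurable]: "u \<in> borel_measurable borel" "g \<in> borel_measurable borel" using u g by auto
  let ?f = "\<lambda>\<eta> x. trunc R u x * cnj (W x \<eta>) * cnj (g \<eta>)"
  have cm [measurable]: "trunc R u \<in> borel_measurable borel" using trunc_L2[OF u] by auto
  obtain C where C: "0 \<le> C" "\<And>\<eta>. (\<integral>\<^sup>+x. ennreal ((norm (trunc R (\<lambda>x. W x \<eta>) x))\<^sup>2) \<partial>lborel) \<le> ennreal C"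
    by (rule W_local) auto
  have bound: "ennreal (norm (?f \<eta> x)) \<le> ennreal ((norm (u x))\<^sup>2) * indicator S \<eta>
      + ennreal ((norm (g \<eta>))\<^sup>2) * ennreal ((norm (trunc R (\<lambda>x. W x \<eta>) x))\<^sup>2)" for \<eta> x
  proof (cases "\<eta> \<in> S \<and> x \<in> cball 0 R")
    case True
    have "norm (?f \<eta> x) = norm (u x) * (norm (g \<eta>) * norm (W x \<eta>))"
      using True by (simp add: trunc_def norm_mult)
    also have "\<dots> \<le> (norm (u x))\<^sup>2 + (norm (g \<eta>))\<^sup>2 * (norm (W x \<eta>))\<^sup>2"
      using mult_le_sum_squares[of "norm (u x)" "norm (g \<eta>) * norm (W x \<eta>)"]
      by (simp add: power_mult_distrib)
    finally show ?thesis using True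
      by (simp add: trunc_def ennreal_mult[symmetric] ennreal_plus[symmetric] ennreal_leI del: ennreal_plus)
  next
    case False
    then have f0: "?f \<eta> x = 0" by (auto simp: trunc_def W_def)
    show ?thesis unfolding f0 by simp
  qed
  have "(\<integral>\<^sup>+p. ennreal (norm (case_prod ?f p)) \<partial>(lborel \<Otimes>\<^sub>M lborel))
      = (\<integral>\<^sup>+\<eta>. \<integral>\<^sup>+x. ennreal (norm (?f \<eta> x)) \<partial>lborel \<partial>lborel)"
    by (subst lborel.nn_integral_fst[symmetric]) (auto simp: case_prod_beta)
  also have "\<dots> \<le> (\<integral>\<^sup>+\<eta>. \<integral>\<^sup>+x. ennreal ((norm (u x))\<^sup>2) * indicator S \<eta>
      + ennreal ((norm (g \<eta>))\<^sup>2) * ennreal ((norm (trunc R (\<lambda>x. W x \<eta>) x))\<^sup>2) \<partial>lborel \<partial>lborel)"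
    by (intro nn_integral_mono bound)
  also have "\<dots> = (\<integral>\<^sup>+\<eta>. (\<integral>\<^sup>+x. ennreal ((norm (u x))\<^sup>2) \<partial>lborel) * indicator S \<eta>
      + ennreal ((norm (g \<eta>))\<^sup>2) * (\<integral>\<^sup>+x. ennreal ((norm (trunc R (\<lambda>x. W x \<eta>) x))\<^sup>2) \<partial>lborel) \<partial>lborel)"
    unfolding trunc_def
    by (intro nn_integral_cong, subst nn_integral_add) (simp_all add: nn_integral_multc nn_integral_cmult)
  also have "\<dots> \<le> (\<integral>\<^sup>+\<eta>. (\<integral>\<^sup>+x. ennreal ((norm (u x))\<^sup>2) \<partial>lborel) * indicator S \<eta>
      + ennreal ((norm (g \<eta>))\<^sup>2) * ennreal C \<partial>lborel)"
    by (intro nn_integral_mono add_left_mono mult_left_mono C) auto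
  also have "\<dots> = ennreal ((L2norm u)\<^sup>2) * emeasure lborel S + ennreal ((L2norm g)\<^sup>2) * ennreal C"
    by (subst nn_integral_add) (simp_all add: nn_integral_multc nn_integral_cmult nn_integral_L2norm u g)
  also have "\<dots> < \<infinity>" using S_finite by (simp add: ennreal_mult_less_top ennreal_mult[symmetric])
  finally have fin: "(\<integral>\<^sup>+p. ennreal (norm (case_prod ?f p)) \<partial>(lborel \<Otimes>\<^sub>M lborel)) < \<infinity>" .
  have "case_prod ?f \<in> borel_measurable (lborel \<Otimes>\<^sub>M lborel)"
    by (simp add: case_prod_beta)
  with fin have int: "integrable (lborel \<Otimes>\<^sub>M lborel) (case_prod ?f)"
    by (simp add: integrable_iff_bounded)
  have "L2inner (\<lambda>\<eta>. indicator S \<eta> *\<^sub>R analysis w R u \<eta>) g = (LINT \<eta>|lborel. LINT x|lborel. ?f \<eta> x)"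
    unfolding analysis_W L2inner_def
  proof (rule arg_cong[where f="integral\<^sup>L lborel"], rule ext)
    fix \<eta>
    have "trunc R u x * cnj (trunc R (\<lambda>x. W x \<eta>) x) * cnj (g \<eta>) = ?f \<eta> x" for x
      by (simp add: trunc_def indicator_def)
    then show "(LINT x|lborel. trunc R u x * cnj (trunc R (\<lambda>x. W x \<eta>) x)) * cnj (g \<eta>) = (LINT x|lborel. ?f \<eta> x)"
      by (simp only: integral_mult_left_zero[symmetric])
  qed
  also have "\<dots> = (LINT x|lborel. LINT \<eta>|lborel. ?f \<eta> x)"
    by (rule lborel_pair.Fubini_integral[OF int, symmetric])
  also have "\<dots> = L2inner (trunc R u) (synth w S g)"
    unfolding L2inner_def synth_W
  proof (rule arg_cong[where f="integral\<^sup>L lborel"], rule ext)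
    fix x
    have "(LINT \<eta>|lborel. ?f \<eta> x) = (LINT \<eta>|lborel. trunc R u x * cnj (g \<eta> * W x \<eta>))"
      by (simp add: mult_ac)
    then show "(LINT \<eta>|lborel. ?f \<eta> x) = trunc R u x * cnj (LINT \<eta>|lborel. g \<eta> * W x \<eta>)"
      by (simp only: integral_mult_right_zero Bochner_Integration.integral_cnj)
  qed
  finally show ?thesis .
qed

text \<open>The adjoint of an isometry is a contraction.\<close>

lemma analysis_norm:
  assumes u: "u \<in> L2"
  shows "L2norm (\<lambda>\<eta>. indicator S \<eta> *\<^sub>R analysis w R u \<eta>) \<le> L2norm (trunc R u)"
proof -
  let ?A = "\<lambda>\<eta>. indicator S \<eta> *\<^sub>R analysis w R u \<eta>"
  note A = analysis_L2[OF u, of R]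
  have "complex_of_real ((L2norm ?A)\<^sup>2) = L2inner (trunc R u) (synth w S ?A)"
    unfolding L2inner_self[OF A, symmetric] by (rule analysis_adjoint[OF u A])
  then have "(L2norm ?A)\<^sup>2 = norm (L2inner (trunc R u) (synth w S ?A))"
    by (metis norm_of_real abs_of_nonneg zero_le_power2)
  also have "\<dots> \<le> L2norm (trunc R u) * L2norm (synth w S ?A)"
    by (rule L2_Cauchy_Schwarz[OF trunc_L2[OF u] synth_L2[OF A]])
  also have "L2norm (synth w S ?A) = L2norm ?A"
    unfolding synth_norm[OF A] by (rule L2norm_cong) (simp add: indicator_def)
  finally have "L2norm ?A * L2norm ?A \<le> L2norm (trunc R u) * L2norm ?A" by (simp add: power2_eq_square)
  then show ?thesis
    by (cases "L2norm ?A = 0") (auto simp: mult_le_cancel_right less_le)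
qed

text \<open>An isometry is inverted by its adjoint: comparing norms and inner products bounds the error of
  the truncated analysis of a synthesized function by the truncation error of that function.  The
  function \<open>A\<close> agrees with the analysis on \<open>S\<close> but may live on a larger set; for the Fourier transform
  this set is the whole space.\<close>

lemma analysis_recovers:
  assumes g: "g \<in> L2"
    and A: "A \<in> L2" "L2norm A \<le> L2norm (trunc R (synth w S g))"
    and AS: "\<And>\<eta>. indicator S \<eta> *\<^sub>R A \<eta> = indicator S \<eta> *\<^sub>R analysis w R (synth w S g) \<eta>"
  shows "L2norm (\<lambda>\<eta>. A \<eta> - indicator S \<eta> *\<^sub>R g \<eta>)
    \<le> L2norm (\<lambda>x. trunc R (synth w S g) x - synth w S g x)"
proof -
  let ?F = "synth w S g" and ?h = "\<lambda>\<eta>. indicator S \<eta> *\<^sub>R g \<eta>"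
  note F = synth_L2[OF g]
  have h: "?h \<in> L2" by (rule L2_indicator[OF g S_sets])
  have Fh: "synth w S ?h = ?F"
    unfolding synth_def set_lebesgue_integral_def
    by (rule ext, rule arg_cong[where f="integral\<^sup>L lborel"]) (simp add: fun_eq_iff indicator_def)
  have "L2inner A ?h = L2inner (\<lambda>\<eta>. indicator S \<eta> *\<^sub>R A \<eta>) ?h"
    unfolding L2inner_def by (rule arg_cong[where f="integral\<^sup>L lborel"]) (simp add: fun_eq_iff indicator_def)
  also have "\<dots> = L2inner (trunc R ?F) ?F"
    unfolding AS using analysis_adjoint[OF F h, of R] by (simp add: Fh)
  finally have in_eq: "L2inner A ?h = L2inner (trunc R ?F) ?F" .
  have "(L2norm (\<lambda>\<eta>. A \<eta> - ?h \<eta>))\<^sup>2 \<le> (L2norm (\<lambda>x. trunc R ?F x - ?F x))\<^sup>2"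
    unfolding L2norm_diff_power2[OF A(1) h] L2norm_diff_power2[OF trunc_L2[OF F] F] in_eq
    using power_mono[OF A(2), of 2] synth_norm[OF g] by simp
  then show ?thesis by (rule power2_le_imp_le) simp
qed

lemma analysis_synth_tendsto:
  assumes g: "g \<in> L2"
  shows "L2_tendsto S (\<lambda>R. analysis w R (synth w S g)) g at_top"
proof -
  let ?h = "\<lambda>\<eta>. indicator S \<eta> *\<^sub>R g \<eta>" and ?A = "\<lambda>R \<eta>. indicator S \<eta> *\<^sub>R analysis w R (synth w S g) \<eta>"
  note F = synth_L2[OF g]
  have "((\<lambda>R. L2norm (\<lambda>\<eta>. ?A R \<eta> - ?h \<eta>)) \<longlongrightarrow> 0) at_top"
  proof (rule tendsto_sandwich[OF _ _ tendsto_const trunc_tendsto[OF F]])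
    show "\<forall>\<^sub>F R in at_top. L2norm (\<lambda>\<eta>. ?A R \<eta> - ?h \<eta>) \<le> L2norm (\<lambda>x. trunc R (synth w S g) x - synth w S g x)"
      by (intro always_eventually allI analysis_recovers[OF g] analysis_L2[OF F] analysis_norm[OF F])
        (simp add: indicator_def)
  qed simp
  then have "L2_tendsto UNIV ?A ?h at_top"
    by (subst L2_tendsto_iff) (auto intro: analysis_L2[OF F] L2_indicator[OF g])
  moreover have "ennreal ((norm (?A R \<eta> - ?h \<eta>))\<^sup>2) * indicator UNIV \<eta>
      = ennreal ((norm (analysis w R (synth w S g) \<eta> - g \<eta>))\<^sup>2) * indicator S \<eta>" for R \<eta>
    by (simp add: indicator_def)
  ultimately show ?thesis unfolding L2_tendsto_def by simp
qed

end

subsection \<open>Scaling\<close>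

lemma lborel_scale:
  fixes c :: real
  assumes "c \<noteq> 0"
  shows "(lborel :: 'a::euclidean_space measure)
    = density (distr lborel borel (\<lambda>x. c *\<^sub>R x)) (\<lambda>_. ennreal (\<bar>c\<bar> ^ DIM('a)))"
  using lborel_affine[OF assms, of "0::'a"] by simp

lemma nn_integral_lborel_scale:
  fixes F :: "'a::euclidean_space \<Rightarrow> ennreal"
  assumes [measurable]: "F \<in> borel_measurable borel" and c: "c \<noteq> 0"
  shows "(\<integral>\<^sup>+x. F x \<partial>lborel) = ennreal (\<bar>c\<bar> ^ DIM('a)) * (\<integral>\<^sup>+x. F (c *\<^sub>R x) \<partial>lborel)"
  by (subst lborel_affine[OF c, of 0])
    (simp add: nn_integral_density nn_integral_distr nn_integral_cmult)

lemma integral_lborel_scale: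
  fixes f :: "'a::euclidean_space \<Rightarrow> 'b::{banach,second_countable_topology}"
  assumes [measurable]: "f \<in> borel_measurable borel" and c: "c \<noteq> 0"
  shows "(LINT x|lborel. f x) = \<bar>c\<bar> ^ DIM('a) *\<^sub>R (LINT x|lborel. f (c *\<^sub>R x))"
  by (subst lborel_affine[OF c, of 0])
    (simp add: integral_density integral_distr)

lemma integrable_lborel_scale:
  fixes f :: "'a::euclidean_space \<Rightarrow> 'b::{banach,second_countable_topology}"
  assumes f: "integrable lborel f" and c: "c \<noteq> 0"
  shows "integrable lborel (\<lambda>x. f (c *\<^sub>R x))"
proof -
  have [measurable]: "f \<in> borel_measurable borel" using f by auto
  have "ennreal (\<bar>c\<bar> ^ DIM('a)) * (\<integral>\<^sup>+x. ennreal (norm (f (c *\<^sub>R x))) \<partial>lborel) < \<infinity>"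
    using f nn_integral_lborel_scale[OF _ c, of "\<lambda>x. ennreal (norm (f x))"] by (simp add: integrable_iff_bounded)
  moreover have "ennreal (\<bar>c\<bar> ^ DIM('a)) \<noteq> 0" using c by (simp add: ennreal_eq_0_iff not_le)
  ultimately have "(\<integral>\<^sup>+x. ennreal (norm (f (c *\<^sub>R x))) \<partial>lborel) < \<infinity>"
    by (auto simp: ennreal_mult_less_top)
  then show ?thesis by (simp add: integrable_iff_bounded)
qed

lemma AE_lborel_scale:
  fixes P :: "'a::euclidean_space \<Rightarrow> bool"
  assumes P: "AE x in lborel. P x" and c: "c \<noteq> 0"
  shows "AE x in lborel. P (c *\<^sub>R x)"
proof -
  have "AE x in density (distr lborel borel (\<lambda>x. c *\<^sub>R x)) (\<lambda>_. ennreal (\<bar>c\<bar> ^ DIM('a))). P x"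
    using P unfolding lborel_scale[OF c, symmetric] .
  then have "AE x in distr lborel borel (\<lambda>x. c *\<^sub>R x). P x"
    using c by (simp add: AE_density)
  then show ?thesis by (rule AE_distrD[rotated]) simp
qed

lemma L2_scale:
  fixes u :: "real^'n \<Rightarrow> 'b::{banach,second_countable_topology}"
  assumes u: "u \<in> L2" and c: "c \<noteq> 0"
  shows "(\<lambda>x. u (c *\<^sub>R x)) \<in> L2"
    "(L2norm u)\<^sup>2 = \<bar>c\<bar> ^ CARD('n) * (L2norm (\<lambda>x. u (c *\<^sub>R x)))\<^sup>2"
proof -
  have [measurable]: "u \<in> borel_measurable borel" using u by auto
  show "(\<lambda>x. u (c *\<^sub>R x)) \<in> L2"
    using integrable_lborel_scale[OF L2_integrable[OF u] c] by (simp add: L2_iff)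
  show "(L2norm u)\<^sup>2 = \<bar>c\<bar> ^ CARD('n) * (L2norm (\<lambda>x. u (c *\<^sub>R x)))\<^sup>2"
    unfolding L2norm_power2 using integral_lborel_scale[OF _ c, of "\<lambda>x. (norm (u x))\<^sup>2"] by simp
qed

text \<open>The powers of \<open>\<epsilon>\<close> from the substitution in the frequency and from the one in space compensate each
  other in the norm.\<close>

lemma isometric_kernel_scale:
  fixes w :: "real^'n \<Rightarrow> real^'n \<Rightarrow> complex"
  assumes "isometric_kernel w S" and \<epsilon>: "0 < \<epsilon>"
  shows "isometric_kernel (\<lambda>x \<eta>. w ((1 / \<epsilon>) *\<^sub>R x) (\<epsilon> *\<^sub>R \<eta>)) {\<eta>. \<epsilon> *\<^sub>R \<eta> \<in> S}"
proof -
  interpret isometric_kernel w S by fact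
  let ?S = "{\<eta>. \<epsilon> *\<^sub>R \<eta> \<in> S}" and ?w = "\<lambda>x \<eta>. w ((1 / \<epsilon>) *\<^sub>R x) (\<epsilon> *\<^sub>R \<eta>)"
  have e0: "\<epsilon> \<noteq> 0" "1 / \<epsilon> \<noteq> 0" using \<epsilon> by auto
  have ind: "indicator ?S \<eta> = indicator S (\<epsilon> *\<^sub>R \<eta>)" for \<eta> by (simp add: indicator_def)
  have Sm [measurable]: "?S \<in> sets borel" by measurable
  \<comment> \<open>the change of variables for the synthesis operator\<close>
  have syn: "synth ?w ?S g x = (1 / \<epsilon>) ^ CARD('n) *\<^sub>R synth w S (\<lambda>\<zeta>. g ((1 / \<epsilon>) *\<^sub>R \<zeta>)) ((1 / \<epsilon>) *\<^sub>R x)"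
    if g: "g \<in> L2" for g x
  proof -
    have [measurable]: "g \<in> borel_measurable borel" using g by auto
    let ?f = "\<lambda>\<eta>. g \<eta> * W ((1 / \<epsilon>) *\<^sub>R x) (\<epsilon> *\<^sub>R \<eta>)"
    have "synth ?w ?S g x = (LINT \<eta>|lborel. ?f \<eta>)"
      unfolding synth_def set_lebesgue_integral_def ind W_def by simp
    also have "\<dots> = \<bar>1 / \<epsilon>\<bar> ^ DIM(real^'n) *\<^sub>R (LINT \<eta>|lborel. ?f ((1 / \<epsilon>) *\<^sub>R \<eta>))"
      by (rule integral_lborel_scale[OF _ e0(2)]) measurable
    finally show ?thesis using \<epsilon> by (simp add: synth_W)
  qed
  show ?thesis
  proof
    show "?S \<in> sets borel" by measurable
    have "ennreal (\<epsilon> ^ DIM(real^'n)) * emeasure lborel ?S = emeasure lborel S"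
      using nn_integral_lborel_scale[OF _ e0(1), of "\<lambda>x. indicator S x :: ennreal"] \<epsilon>
      by (simp flip: ind)
    then have "ennreal (\<epsilon> ^ DIM(real^'n)) * emeasure lborel ?S < \<infinity>" using S_finite by simp
    moreover have "ennreal (\<epsilon> ^ DIM(real^'n)) \<noteq> 0" using \<epsilon> by (simp add: ennreal_eq_0_iff not_le)
    ultimately show "emeasure lborel ?S < \<infinity>" by (auto simp: ennreal_mult_less_top)
    have "(\<lambda>(x, \<eta>). W ((1 / \<epsilon>) *\<^sub>R x) (\<epsilon> *\<^sub>R \<eta>)) \<in> borel_measurable (borel \<Otimes>\<^sub>M borel)" by measurable
    then show "(\<lambda>(x, \<eta>). indicator ?S \<eta> *\<^sub>R ?w x \<eta>) \<in> borel_measurable (borel \<Otimes>\<^sub>M borel)"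
      by (simp add: W_def ind)
  next
    fix R
    obtain C where C: "\<And>\<eta>. (\<integral>\<^sup>+x. ennreal ((norm (trunc (R / \<epsilon>) (\<lambda>x. W x \<eta>) x))\<^sup>2) \<partial>lborel) \<le> ennreal C" "0 \<le> C"
      by (rule W_local) auto
    show "\<exists>C. \<forall>\<eta>\<in>?S. (\<integral>\<^sup>+x. ennreal ((norm (?w x \<eta>))\<^sup>2) * indicator (cball 0 R) x \<partial>lborel) \<le> ennreal C"
    proof (intro exI ballI)
      fix \<eta> assume \<eta>: "\<eta> \<in> ?S"
      define G where "G x = ennreal ((norm (trunc (R / \<epsilon>) (\<lambda>x. W x (\<epsilon> *\<^sub>R \<eta>)) x))\<^sup>2)" for x
      have [measurable]: "G \<in> borel_measurable borel"
        unfolding G_def[abs_def] using L2_measurable[OF W_trunc_L2] by measurable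
      let ?f = "\<lambda>x. G ((1 / \<epsilon>) *\<^sub>R x)"
      have "(\<integral>\<^sup>+x. ennreal ((norm (?w x \<eta>))\<^sup>2) * indicator (cball 0 R) x \<partial>lborel) = (\<integral>\<^sup>+x. ?f x \<partial>lborel)"
        using \<eta> \<epsilon> by (intro nn_integral_cong) (auto simp: G_def trunc_def W_def indicator_def field_simps)
      also have "\<dots> = ennreal (\<epsilon> ^ DIM(real^'n)) * (\<integral>\<^sup>+x. ?f (\<epsilon> *\<^sub>R x) \<partial>lborel)"
        using \<epsilon> nn_integral_lborel_scale[OF _ e0(1), of ?f] by simp
      also have "(\<integral>\<^sup>+x. ?f (\<epsilon> *\<^sub>R x) \<partial>lborel) \<le> ennreal C" using C(1)[of "\<epsilon> *\<^sub>R \<eta>"] \<epsilon> by (simp add: G_def)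
      finally show "(\<integral>\<^sup>+x. ennreal ((norm (?w x \<eta>))\<^sup>2) * indicator (cball 0 R) x \<partial>lborel)
          \<le> ennreal (\<epsilon> ^ DIM(real^'n) * C)"
        using C(2) \<epsilon> by (simp add: ennreal_mult mult_left_mono)
    qed
  next
    fix g :: "real^'n \<Rightarrow> complex" assume g: "g \<in> L2"
    let ?g = "\<lambda>\<zeta>. g ((1 / \<epsilon>) *\<^sub>R \<zeta>)"
    have g': "?g \<in> L2" by (rule L2_scale(1)[OF g e0(2)])
    note G = synth_L2[OF g']
    have G': "(\<lambda>x. synth w S ?g ((1 / \<epsilon>) *\<^sub>R x)) \<in> L2" by (rule L2_scale(1)[OF G e0(2)])
    have syn': "synth ?w ?S g = (\<lambda>x. (1 / \<epsilon>) ^ CARD('n) *\<^sub>R synth w S ?g ((1 / \<epsilon>) *\<^sub>R x))"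
      using syn[OF g] by blast
    show "synth ?w ?S g \<in> L2"
      unfolding syn' by (rule L2_scaleR[OF G'])
    let ?n = "(1 / \<epsilon>) ^ CARD('n)"
    have n: "?n > 0" using \<epsilon> by simp
    have h: "(\<lambda>\<eta>. indicator ?S \<eta> *\<^sub>R g \<eta>) \<in> L2" by (rule L2_indicator[OF g Sm])
    have "(L2norm (synth ?w ?S g))\<^sup>2 = ?n\<^sup>2 * (L2norm (\<lambda>x. synth w S ?g ((1 / \<epsilon>) *\<^sub>R x)))\<^sup>2"
      unfolding syn' L2norm_scaleR by (simp add: power_mult_distrib)
    also have "\<dots> = ?n * (L2norm (synth w S ?g))\<^sup>2"
      using L2_scale(2)[OF G e0(2)] \<epsilon> by (simp add: power2_eq_square)
    also have "\<dots> = ?n * (L2norm (\<lambda>\<zeta>. indicator S \<zeta> *\<^sub>R ?g \<zeta>))\<^sup>2"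
      by (simp add: synth_norm[OF g'])
    also have "\<dots> = (L2norm (\<lambda>\<eta>. indicator ?S \<eta> *\<^sub>R g \<eta>))\<^sup>2"
      using L2_scale(2)[OF h e0(2)] \<epsilon> by (simp add: ind)
    finally show "L2norm (synth ?w ?S g) = L2norm (\<lambda>\<eta>. indicator ?S \<eta> *\<^sub>R g \<eta>)"
      by (rule power2_eq_imp_eq) auto
    have "AE x in lborel. integrable lborel (\<lambda>\<zeta>. indicator S \<zeta> *\<^sub>R (?g \<zeta> * w ((1 / \<epsilon>) *\<^sub>R x) \<zeta>))"
      by (rule AE_lborel_scale[OF synth_integrable[OF g'] e0(2)])
    then show "AE x in lborel. integrable lborel (\<lambda>\<eta>. indicator ?S \<eta> *\<^sub>R (g \<eta> * ?w x \<eta>))"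
    proof eventually_elim
      fix x assume "integrable lborel (\<lambda>\<zeta>. indicator S \<zeta> *\<^sub>R (?g \<zeta> * w ((1 / \<epsilon>) *\<^sub>R x) \<zeta>))"
      from integrable_lborel_scale[OF this e0(1)]
      show "integrable lborel (\<lambda>\<eta>. indicator ?S \<eta> *\<^sub>R (g \<eta> * ?w x \<eta>))"
        using \<epsilon> by (simp add: ind)
    qed
  qed
qed

subsection \<open>Modulated periodic functions\<close>

text \<open>A ball meets finitely many translates of the cell; this yields the local bound for Bloch waves.\<close>

lemma finite_lat_cball: "finite {n. \<exists>q\<in>Qcell. q + lat n \<in> cball (0 :: real^'n) R}"
proof -
  let ?m = "\<lceil>R\<rceil> + 1"
  let ?F = "(\<lambda>f::'n \<Rightarrow> int. (\<chi> i. real_of_int (f i)) :: real^'n) ` (UNIV \<rightarrow>\<^sub>E {- ?m .. ?m})"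
  have "finite ?F" by (intro finite_imageI finite_PiE) auto
  moreover have "(lat :: nat \<Rightarrow> real^'n) ` {n. \<exists>q\<in>Qcell. q + lat n \<in> cball (0 :: real^'n) R} \<subseteq> ?F"
  proof (rule image_subsetI)
    fix n assume "n \<in> {n. \<exists>q\<in>Qcell. q + lat n \<in> cball (0 :: real^'n) R}"
    then obtain q where q: "q \<in> Qcell" "norm (q + lat n :: real^'n) \<le> R" by auto
    have "\<exists>z\<in>{- ?m .. ?m}. (lat n :: real^'n) $ i = real_of_int z" for i
    proof -
      obtain z where z: "(lat n :: real^'n) $ i = real_of_int z"
        using lat_in_lattice[of n, where 'a='n] by (auto simp: lattice_def Ints_def)
      have "\<bar>(q + lat n) $ i\<bar> \<le> R" using component_le_norm_cart[of "q + lat n" i] q(2) by linarith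
      moreover have "0 \<le> q $ i" "q $ i < 1" using q(1) by (auto simp: Qcell_def)
      ultimately have "\<bar>real_of_int z\<bar> \<le> R + 1" using z by auto
      then have "\<bar>z\<bar> \<le> ?m" by linarith
      then show ?thesis using z by (intro bexI[of _ z]) auto
    qed
    then obtain f where "\<And>i. f i \<in> {- ?m .. ?m}" "\<And>i. (lat n :: real^'n) $ i = real_of_int (f i)" by metis
    then show "lat n \<in> ?F" by (intro image_eqI[of _ _ f]) (auto simp: vec_eq_iff)
  qed
  ultimately have "finite ((lat :: nat \<Rightarrow> real^'n) ` {n. \<exists>q\<in>Qcell. q + lat n \<in> cball (0 :: real^'n) R})"
    by (rule finite_subset[rotated])
  then show ?thesis by (rule finite_imageD) (auto simp: inj_on_def lat_eq_iff)
qed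

text \<open>Writing \<open>x = q + k\<close> with \<open>q\<close> in the cell and \<open>k\<close> in the lattice, the values at \<open>q + k\<close> of the
  synthesized function are the Fourier coefficients of \<open>g(\<eta>) \<Phi>(q,\<eta>) e(\<eta>\<cdot>q)\<close>.  Parseval and Tonelli
  then reduce the isometry to the normalization of \<open>\<Phi>(\<cdot>,\<eta>)\<close> on the cell.\<close>

lemma isometric_kernel_modulated:
  fixes \<Phi> :: "real^'n \<Rightarrow> real^'n \<Rightarrow> complex"
  assumes meas: "(\<lambda>(y, \<eta>). indicator Zcell \<eta> *\<^sub>R \<Phi> y \<eta>) \<in> borel_measurable (borel \<Otimes>\<^sub>M borel)"
    and per: "\<And>\<eta>. \<eta> \<in> Zcell \<Longrightarrow> Y_periodic (\<lambda>y. \<Phi> y \<eta>)"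
    and unit: "\<And>\<eta>. \<eta> \<in> Zcell \<Longrightarrow> (\<integral>\<^sup>+y. ennreal ((norm (\<Phi> y \<eta>))\<^sup>2) * indicator Qcell y \<partial>lborel) = 1"
  shows "isometric_kernel (\<lambda>x \<eta>. \<Phi> x \<eta> * cis (2 * pi * (\<eta> \<bullet> x))) Zcell"
proof -
  let ?w = "\<lambda>x \<eta>. \<Phi> x \<eta> * cis (2 * pi * (\<eta> \<bullet> x))"
  define \<Psi> where "\<Psi> y \<eta> = indicator Zcell \<eta> *\<^sub>R \<Phi> y \<eta>" for y \<eta>
  have [measurable]: "case_prod \<Psi> \<in> borel_measurable (borel \<Otimes>\<^sub>M borel)"
    using meas by (simp add: \<Psi>_def[abs_def])
  have pl: "\<Psi> (q + lat n) \<eta> = \<Psi> q \<eta>" for q n \<eta>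
    using per[of \<eta>] lat_in_lattice[of n, where 'a='n]
    by (cases "\<eta> \<in> Zcell") (auto simp: \<Psi>_def Y_periodic_def lattice_def)
  have unit': "(\<integral>\<^sup>+y. ennreal ((norm (\<Psi> y \<eta>))\<^sup>2) * indicator Qcell y \<partial>lborel) = indicator Zcell \<eta>" for \<eta>
    using unit[of \<eta>] by (cases "\<eta> \<in> Zcell") (auto simp: \<Psi>_def)
  have Wm: "(\<lambda>(x, \<eta>). \<Psi> x \<eta> * cis (2 * pi * (\<eta> \<bullet> x))) \<in> borel_measurable (borel \<Otimes>\<^sub>M borel)"
    by measurable
  have main: "synth ?w Zcell g \<in> L2 \<and> L2norm (synth ?w Zcell g) = L2norm (\<lambda>\<eta>. indicator Zcell \<eta> *\<^sub>R g \<eta>)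
      \<and> (AE x in lborel. integrable lborel (\<lambda>\<eta>. indicator Zcell \<eta> *\<^sub>R (g \<eta> * ?w x \<eta>)))"
    if g: "g \<in> L2" for g
  proof -
    have [measurable]: "g \<in> borel_measurable borel" using g by auto
    define h where "h x \<eta> = g \<eta> * (\<Psi> x \<eta> * cis (2 * pi * (\<eta> \<bullet> x)))" for x \<eta>
    have [measurable]: "case_prod h \<in> borel_measurable (borel \<Otimes>\<^sub>M borel)" unfolding h_def[abs_def] by measurable
    have h_eq: "indicator Zcell \<eta> *\<^sub>R (g \<eta> * ?w x \<eta>) = h x \<eta>" for x \<eta>
      by (simp add: h_def \<Psi>_def)
    have F: "synth ?w Zcell g = (\<lambda>x. LINT \<eta>|lborel. h x \<eta>)"
      unfolding synth_def set_lebesgue_integral_def h_eq ..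
    have Fm: "synth ?w Zcell g \<in> borel_measurable borel"
      unfolding F by (rule lborel.borel_measurable_lebesgue_integral) measurable
    define D where "D x = (\<integral>\<^sup>+\<eta>. ennreal ((norm (h x \<eta>))\<^sup>2) \<partial>lborel)" for x
    have Dm [measurable]: "D \<in> borel_measurable borel"
      unfolding D_def[abs_def] by measurable
    have hn: "(norm (h x \<eta>))\<^sup>2 = (norm (g \<eta>))\<^sup>2 * (norm (\<Psi> x \<eta>))\<^sup>2" for x \<eta>
      by (simp add: h_def norm_mult power_mult_distrib)
    have Dp: "D (q + lat n) = D q" for q n unfolding D_def hn pl ..
    have h0: "h x \<eta> = 0" if "\<eta> \<notin> Zcell" for x \<eta> using that by (simp add: h_def \<Psi>_def)
    have "(\<integral>\<^sup>+q. D q * indicator Qcell q \<partial>lborel)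
        = (\<integral>\<^sup>+q. \<integral>\<^sup>+\<eta>. ennreal ((norm (g \<eta>))\<^sup>2 * (norm (\<Psi> q \<eta>))\<^sup>2) * indicator Qcell q \<partial>lborel \<partial>lborel)"
      unfolding D_def hn by (intro nn_integral_cong nn_integral_multc[symmetric]) measurable
    also have "\<dots> = (\<integral>\<^sup>+\<eta>. \<integral>\<^sup>+q. ennreal ((norm (g \<eta>))\<^sup>2 * (norm (\<Psi> q \<eta>))\<^sup>2) * indicator Qcell q \<partial>lborel \<partial>lborel)"
      by (rule lborel_pair.Fubini') measurable
    also have "\<dots> = (\<integral>\<^sup>+\<eta>. ennreal ((norm (g \<eta>))\<^sup>2) * indicator Zcell \<eta> \<partial>lborel)"
      by (intro nn_integral_cong)
        (simp add: ennreal_mult mult.assoc nn_integral_cmult unit'[symmetric])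
    also have "\<dots> = (\<integral>\<^sup>+\<eta>. ennreal ((norm (indicator Zcell \<eta> *\<^sub>R g \<eta>))\<^sup>2) \<partial>lborel)"
      by (intro nn_integral_cong) (simp add: indicator_def)
    also have "\<dots> = ennreal ((L2norm (\<lambda>\<eta>. indicator Zcell \<eta> *\<^sub>R g \<eta>))\<^sup>2)"
      by (rule nn_integral_L2norm[OF L2_indicator[OF g Zcell_sets]])
    finally have DQ: "(\<integral>\<^sup>+q. D q * indicator Qcell q \<partial>lborel) = ennreal ((L2norm (\<lambda>\<eta>. indicator Zcell \<eta> *\<^sub>R g \<eta>))\<^sup>2)" .
    have "AE q in lborel. D q * indicator Qcell q \<noteq> \<infinity>"
      by (rule nn_integral_PInf_AE) (simp_all add: DQ)
    then have AEQ: "AE q in lborel. q \<in> Qcell \<longrightarrow> D q \<noteq> \<infinity>" by eventually_elim auto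
    have hL2: "h x \<in> L2" if "D x \<noteq> \<infinity>" for x
      using that unfolding L2_iff_nn D_def by (auto simp: top.not_eq_extremum)
    have pars: "(\<Sum>n. ennreal ((norm (synth ?w Zcell g (q + lat n)))\<^sup>2)) = D q" if q: "D q \<noteq> \<infinity>" for q
    proof -
      have "h (q + lat n) \<eta> = h q \<eta> * cis (2 * pi * (\<eta> \<bullet> lat n))" for n \<eta>
        by (simp add: h_def pl inner_add_right distrib_left cis_mult[symmetric] mult_ac)
      then have "(LINT \<eta>|lborel. h (q + lat n) \<eta>) = (LINT \<eta>|lborel. h q \<eta> * cis (2 * pi * (\<eta> \<bullet> lat n)))" for n
        by (simp only:)
      then have "(\<lambda>n. (norm (synth ?w Zcell g (q + lat n)))\<^sup>2) sums (L2norm (h q))\<^sup>2"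
        using Fourier_series_Parseval[OF hL2[OF q] h0] unfolding F by simp
      then have "(\<Sum>n. ennreal ((norm (synth ?w Zcell g (q + lat n)))\<^sup>2)) = ennreal ((L2norm (h q))\<^sup>2)"
        by (intro suminf_ennreal_eq) auto
      also have "\<dots> = D q" unfolding D_def by (rule nn_integral_L2norm[OF hL2[OF q], symmetric])
      finally show ?thesis .
    qed
    have [measurable]: "synth ?w Zcell g \<in> borel_measurable borel" by (rule Fm)
    have "(\<integral>\<^sup>+x. ennreal ((norm (synth ?w Zcell g x))\<^sup>2) \<partial>lborel)
        = (\<Sum>n. \<integral>\<^sup>+q. ennreal ((norm (synth ?w Zcell g (q + lat n)))\<^sup>2) * indicator Qcell q \<partial>lborel)"
      by (rule nn_integral_tile) measurable
    also have "\<dots> = (\<integral>\<^sup>+q. (\<Sum>n. ennreal ((norm (synth ?w Zcell g (q + lat n)))\<^sup>2) * indicator Qcell q) \<partial>lborel)"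
      by (rule nn_integral_suminf[symmetric]) measurable
    also have "\<dots> = (\<integral>\<^sup>+q. D q * indicator Qcell q \<partial>lborel)"
    proof (rule nn_integral_cong_AE, use AEQ in eventually_elim)
      fix q :: "real^'n" assume "q \<in> Qcell \<longrightarrow> D q \<noteq> \<infinity>"
      then show "(\<Sum>n. ennreal ((norm (synth ?w Zcell g (q + lat n)))\<^sup>2) * indicator Qcell q) = D q * indicator Qcell q"
      proof (cases "q \<in> Qcell")
        case True
        with \<open>q \<in> Qcell \<longrightarrow> D q \<noteq> \<infinity>\<close> have "D q \<noteq> \<infinity>" by blast
        show ?thesis using pars[OF \<open>D q \<noteq> \<infinity>\<close>] True by simp
      qed simp
    qed
    finally have nn: "(\<integral>\<^sup>+x. ennreal ((norm (synth ?w Zcell g x))\<^sup>2) \<partial>lborel) = ennreal ((L2norm (\<lambda>\<eta>. indicator Zcell \<eta> *\<^sub>R g \<eta>))\<^sup>2)"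
      unfolding DQ .
    have FL2: "synth ?w Zcell g \<in> L2" unfolding L2_iff_nn using Fm nn by simp
    have "(L2norm (synth ?w Zcell g))\<^sup>2 = (L2norm (\<lambda>\<eta>. indicator Zcell \<eta> *\<^sub>R g \<eta>))\<^sup>2"
      using nn nn_integral_L2norm[OF FL2] by simp
    then have Fn: "L2norm (synth ?w Zcell g) = L2norm (\<lambda>\<eta>. indicator Zcell \<eta> *\<^sub>R g \<eta>)"
      by (rule power2_eq_imp_eq) auto
    \<comment> \<open>\<open>D\<close> is lattice periodic, so finiteness almost everywhere spreads from the cell to the whole space\<close>
    have "(\<integral>\<^sup>+x. indicator {x. D x = \<infinity>} x \<partial>lborel)
        = (\<Sum>n. \<integral>\<^sup>+q. indicator {x. D x = \<infinity>} (q + lat n) * indicator Qcell q \<partial>lborel)"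
      by (rule nn_integral_tile) measurable
    also have "\<dots> = (\<Sum>n::nat. 0)"
    proof (rule arg_cong[where f=suminf], rule ext)
      fix n
      have "(\<integral>\<^sup>+q. indicator {x. D x = \<infinity>} (q + lat n) * indicator Qcell q \<partial>lborel) = (\<integral>\<^sup>+q. 0 \<partial>(lborel :: (real^'n) measure))"
        by (rule nn_integral_cong_AE, use AEQ in eventually_elim) (auto simp: indicator_def Dp)
      then show "(\<integral>\<^sup>+q. indicator {x. D x = \<infinity>} (q + lat n) * indicator Qcell q \<partial>lborel) = (0 :: ennreal)" by simp
    qed
    finally have "emeasure lborel {x. D x = \<infinity>} = 0" by simp
    then have "AE x in lborel. D x \<noteq> \<infinity>"
      by (intro AE_I[of _ _ "{x. D x = \<infinity>}"]) auto
    then have "AE x in lborel. integrable lborel (h x)"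
    proof eventually_elim
      fix x assume "D x \<noteq> \<infinity>"
      then show "integrable lborel (h x)" by (intro L2_Zcell_integrable hL2 h0)
    qed
    then show ?thesis using FL2 Fn by (simp add: h_eq)
  qed
  show ?thesis
  proof
    show "(Zcell :: (real^'n) set) \<in> sets borel" by (rule Zcell_sets)
    show "emeasure lborel (Zcell :: (real^'n) set) < \<infinity>" by (rule Zcell_emeasure_finite)
    show "(\<lambda>(x, \<eta>). indicator Zcell \<eta> *\<^sub>R ?w x \<eta>) \<in> borel_measurable (borel \<Otimes>\<^sub>M borel)"
      using Wm by (simp add: \<Psi>_def)
  next
    fix R
    let ?A = "{n. \<exists>q\<in>Qcell. q + lat n \<in> cball (0 :: real^'n) R}"
    have "(\<integral>\<^sup>+x. ennreal ((norm (?w x \<eta>))\<^sup>2) * indicator (cball 0 R) x \<partial>lborel) \<le> ennreal (real (card ?A))"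
      if \<eta>: "\<eta> \<in> Zcell" for \<eta>
    proof -
      have "(\<integral>\<^sup>+x. ennreal ((norm (?w x \<eta>))\<^sup>2) * indicator (cball 0 R) x \<partial>lborel)
          = (\<integral>\<^sup>+x. ennreal ((norm (\<Psi> x \<eta>))\<^sup>2) * indicator (cball 0 R) x \<partial>lborel)"
        using \<eta> by (intro nn_integral_cong) (simp add: \<Psi>_def norm_mult)
      also have "\<dots> = (\<Sum>n. \<integral>\<^sup>+q. ennreal ((norm (\<Psi> (q + lat n) \<eta>))\<^sup>2) * indicator (cball 0 R) (q + lat n) * indicator Qcell q \<partial>lborel)"
        by (rule nn_integral_tile) measurable
      also have "\<dots> \<le> (\<Sum>n. if n \<in> ?A then 1 else 0)"
      proof (rule suminf_le)
        fix n
        show "(\<integral>\<^sup>+q. ennreal ((norm (\<Psi> (q + lat n) \<eta>))\<^sup>2) * indicator (cball 0 R) (q + lat n) * indicator Qcell q \<partial>lborel)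
            \<le> (if n \<in> ?A then 1 else 0)"
        proof (cases "n \<in> ?A")
          case True
          have "(\<integral>\<^sup>+q. ennreal ((norm (\<Psi> (q + lat n) \<eta>))\<^sup>2) * indicator (cball 0 R) (q + lat n) * indicator Qcell q \<partial>lborel)
              \<le> (\<integral>\<^sup>+q. ennreal ((norm (\<Psi> q \<eta>))\<^sup>2) * indicator Qcell q \<partial>lborel)"
            by (intro nn_integral_mono) (auto simp: pl indicator_def)
          then show ?thesis using True unit'[of \<eta>] \<eta> by simp
        next
          case False
          then have "(\<integral>\<^sup>+q. ennreal ((norm (\<Psi> (q + lat n) \<eta>))\<^sup>2) * indicator (cball 0 R) (q + lat n) * indicator Qcell q \<partial>lborel)
              = (\<integral>\<^sup>+q. 0 \<partial>(lborel :: (real^'n) measure))"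
            by (intro nn_integral_cong) (auto simp: indicator_def)
          then show ?thesis by simp
        qed
      qed auto
      also have "\<dots> = (\<Sum>n\<in>?A. 1)"
        by (subst suminf_finite[OF finite_lat_cball[of R]]) auto
      also have "\<dots> = ennreal (real (card ?A))" by (simp add: ennreal_of_nat_eq_real_of_nat)
      finally show ?thesis .
    qed
    then show "\<exists>C. \<forall>\<eta>\<in>Zcell. (\<integral>\<^sup>+x. ennreal ((norm (?w x \<eta>))\<^sup>2) * indicator (cball 0 R) x \<partial>lborel) \<le> ennreal C"
      by blast
  qed (use main in blast)+
qed

section \<open>The Fourier transform on square-integrable functions\<close>

lemma L2norm_squeeze:
  assumes "\<And>i. L2norm (f i) \<le> h i" "(h \<longlongrightarrow> 0) F"
  shows "((\<lambda>i. L2norm (f i)) \<longlongrightarrow> 0) F"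
  by (rule Lim_null_comparison[OF always_eventually assms(2)]) (simp add: assms(1))

abbreviation plane :: "real^'n \<Rightarrow> real^'n \<Rightarrow> complex" where
  "plane x \<eta> \<equiv> cis (2 * pi * (\<eta> \<bullet> x))"

text \<open>The truncated transforms whose \<open>L\<^sup>2\<close> limit is \<^const>\<open>fourier\<close>.\<close>

definition ft :: "real \<Rightarrow> (real^'n \<Rightarrow> complex) \<Rightarrow> real^'n \<Rightarrow> complex" where
  "ft R u \<eta> = (LINT x:cball 0 R|lborel. u x * cis (- 2 * pi * (x \<bullet> \<eta>)))"

lemma emeasure_Qcell: "emeasure lborel (Qcell :: (real^'n) set) = 1"
proof -
  have "emeasure lborel (Zcell :: (real^'n) set) = (\<integral>\<^sup>+x. ennreal (indicator (Zcell :: (real^'n) set) x) \<partial>lborel)"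
    by (simp add: ennreal_indicator)
  also have "\<dots> = ennreal (LINT x|lborel. indicator (Zcell :: (real^'n) set) x)"
    by (rule nn_integral_eq_integral[OF indicator_Zcell_integrable]) simp
  also have "complex_of_real (LINT x|lborel. indicator (Zcell :: (real^'n) set) x) = 1"
    using integral_exp_Zcell(1)[of "0 :: real^'n"]
    by (simp add: lattice_def scaleR_conv_of_real del: integral_indicator)
  then have "(LINT x|lborel. indicator (Zcell :: (real^'n) set) x) = (1::real)"
    by (simp only: of_real_eq_1_iff)
  finally have Z: "emeasure lborel (Zcell :: (real^'n) set) = 1" by simp
  have "(\<integral>\<^sup>+x. indicator Qcell (x + (\<chi> i. 1/2) :: real^'n) \<partial>lborel) = (\<integral>\<^sup>+x. indicator (Qcell :: (real^'n) set) x \<partial>lborel)"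
    by (rule nn_integral_lborel_translate) measurable
  moreover have "indicator Qcell (x + (\<chi> i. 1/2) :: real^'n) = (indicator Zcell x :: ennreal)" for x
  proof -
    have "x + (\<chi> i. 1/2) \<in> Qcell \<longleftrightarrow> x \<in> Zcell" for x :: "real^'n"
      unfolding Qcell_def Zcell_def mem_Collect_eq
      by (intro iff_allI) (auto simp: algebra_simps)
    then show ?thesis by (simp add: indicator_def)
  qed
  ultimately show ?thesis using Z by simp
qed

text \<open>Plane waves are modulated periodic functions with \<open>\<Phi> = 1\<close>, at every scale \<open>\<epsilon>\<close>.\<close>

lemma isometric_kernel_plane:
  assumes "0 < \<epsilon>"
  shows "isometric_kernel (plane :: real^'n \<Rightarrow> _) (Zscaled \<epsilon>)"
proof -
  have "isometric_kernel (\<lambda>x \<eta>. 1 * cis (2 * pi * (\<eta> \<bullet> x)) :: complex) (Zcell :: (real^'n) set)"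
  proof (rule isometric_kernel_modulated[where \<Phi>="\<lambda>_ _. 1"])
    show "(\<integral>\<^sup>+y. ennreal ((norm (1::complex))\<^sup>2) * indicator Qcell y \<partial>(lborel :: (real^'n) measure)) = 1"
      by (simp add: emeasure_Qcell)
  qed (simp_all add: Y_periodic_def)
  from isometric_kernel_scale[OF this assms] show ?thesis
    using assms by (simp add: Zscaled_def)
qed

lemma bounded_subset_Zscaled:
  assumes "bounded (B :: (real^'n) set)"
  obtains \<epsilon> where "0 < \<epsilon>" "B \<subseteq> Zscaled \<epsilon>"
proof -
  obtain R where R: "0 < R" "\<And>x. x \<in> B \<Longrightarrow> norm x \<le> R" using assms bounded_pos by metis
  let ?e = "1 / (2 * (R + 1))"
  have "x \<in> Zscaled ?e" if "x \<in> B" for x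
    unfolding Zscaled_def Zcell_def mem_Collect_eq
  proof
    fix i
    have "\<bar>x $ i\<bar> \<le> R" using component_le_norm_cart[of x i] R(2)[OF that] by linarith
    then have "\<bar>?e * x $ i\<bar> < 1/2" using R(1) by (simp add: abs_mult field_simps)
    then show "- (1/2) \<le> (?e *\<^sub>R x) $ i \<and> (?e *\<^sub>R x) $ i < 1/2"
      unfolding vector_scaleR_component real_scaleR_def by linarith
  qed
  moreover have "0 < ?e" using R by simp
  ultimately show ?thesis using that by blast
qed

lemma Zscaled_sets [measurable]: "Zscaled \<epsilon> \<in> sets borel"
  unfolding Zscaled_def by measurable

lemma integrable_cis_mult:
  assumes "integrable lborel (f :: real^'n \<Rightarrow> complex)"
  shows "integrable lborel (\<lambda>x. f x * cis (t * (x \<bullet> \<eta>)))"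
proof (rule Bochner_Integration.integrable_bound[OF assms])
  have [measurable]: "f \<in> borel_measurable borel" using assms by auto
  show "(\<lambda>x. f x * cis (t * (x \<bullet> \<eta>))) \<in> borel_measurable lborel" by measurable
qed (simp add: norm_mult)

lemma trunc_integrable: "u \<in> L2 \<Longrightarrow> integrable lborel (trunc R (u :: real^'n \<Rightarrow> complex))"
  unfolding trunc_def[abs_def] by (rule L2_finite_integrable[OF _ cball_sets emeasure_lborel_cball_finite])

lemma ft_trunc: "ft R u \<eta> = (LINT x|lborel. trunc R u x * cis (- 2 * pi * (x \<bullet> \<eta>)))"
  unfolding ft_def set_lebesgue_integral_def trunc_def by simp

lemma ft_add:
  assumes "u \<in> L2" "v \<in> L2"
  shows "ft R (\<lambda>x. u x + v x) \<eta> = ft R u \<eta> + ft R v \<eta>"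
proof -
  have "ft R (\<lambda>x. u x + v x) \<eta>
      = (LINT x|lborel. trunc R u x * cis (- 2 * pi * (x \<bullet> \<eta>)) + trunc R v x * cis (- 2 * pi * (x \<bullet> \<eta>)))"
    unfolding ft_trunc by (simp add: trunc_def scaleR_add_right distrib_right)
  also have "\<dots> = ft R u \<eta> + ft R v \<eta>"
    unfolding ft_trunc
    by (rule Bochner_Integration.integral_add) (intro integrable_cis_mult trunc_integrable assms)+
  finally show ?thesis .
qed

lemma ft_cmult: "ft R (\<lambda>x. c * u x) \<eta> = c * ft R u \<eta>"
proof -
  have "ft R (\<lambda>x. c * u x) \<eta> = (LINT x|lborel. c * (trunc R u x * cis (- 2 * pi * (x \<bullet> \<eta>))))"
    unfolding ft_trunc by (rule arg_cong[where f="integral\<^sup>L lborel"]) (simp add: trunc_def fun_eq_iff)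
  also have "\<dots> = c * ft R u \<eta>" unfolding ft_trunc by (rule integral_mult_right_zero)
  finally show ?thesis .
qed

lemma ft_diff: "u \<in> L2 \<Longrightarrow> v \<in> L2 \<Longrightarrow> ft R (\<lambda>x. u x - v x) \<eta> = ft R u \<eta> - ft R v \<eta>"
  using ft_add[OF _ L2_cmult[of v "-1"], of u R \<eta>] ft_cmult[of R "-1" v \<eta>] by simp

lemma ft_eq_analysis: "ft R u \<eta> = analysis plane R u \<eta>"
  unfolding ft_def analysis_def by (simp add: cis_cnj inner_commute)

text \<open>Up to conjugation, the transform of a truncated function is a synthesis in which the two
  variables have exchanged their roles; so truncated transforms are isometric as well.\<close>

lemma ft_isometry:
  fixes u :: "real^'n \<Rightarrow> complex"
  assumes u: "u \<in> L2"
  shows "ft R u \<in> L2" "L2norm (ft R u) = L2norm (trunc R u)"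
proof -
  obtain \<epsilon> where e: "0 < \<epsilon>" "cball (0 :: real^'n) R \<subseteq> Zscaled \<epsilon>"
    using bounded_subset_Zscaled[OF bounded_cball] by blast
  interpret isometric_kernel "plane :: real^'n \<Rightarrow> _" "Zscaled \<epsilon>" by (rule isometric_kernel_plane[OF e(1)])
  let ?v = "\<lambda>x. cnj (trunc R u x)"
  have v: "?v \<in> L2" by (rule L2_cnj[OF trunc_L2[OF u]])
  have iv: "indicator (Zscaled \<epsilon>) x *\<^sub>R ?v x = ?v x" for x
    using e(2) by (cases "x \<in> cball 0 R") (auto simp: trunc_def)
  have eq: "ft R u = (\<lambda>\<eta>. cnj (synth plane (Zscaled \<epsilon>) ?v \<eta>))"
  proof
    fix \<eta>
    have "synth plane (Zscaled \<epsilon>) ?v \<eta> = (LINT x|lborel. cnj (trunc R u x * cis (- 2 * pi * (x \<bullet> \<eta>))))"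
      unfolding synth_def set_lebesgue_integral_def
    proof (rule arg_cong[where f="integral\<^sup>L lborel"], rule ext)
      fix x
      show "indicator (Zscaled \<epsilon>) x *\<^sub>R (?v x * cis (2 * pi * (x \<bullet> \<eta>))) = cnj (trunc R u x * cis (- 2 * pi * (x \<bullet> \<eta>)))"
        using iv[of x] by (simp add: cis_cnj flip: mult_scaleR_left)
    qed
    also have "\<dots> = cnj (ft R u \<eta>)" unfolding ft_trunc by (rule Bochner_Integration.integral_cnj)
    finally show "ft R u \<eta> = cnj (synth plane (Zscaled \<epsilon>) ?v \<eta>)" by simp
  qed
  show "ft R u \<in> L2" unfolding eq by (rule L2_cnj[OF synth_L2[OF v]])
  have "L2norm (ft R u) = L2norm (synth plane (Zscaled \<epsilon>) ?v)"
    unfolding eq by (rule L2norm_cong) simp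
  also have "\<dots> = L2norm ?v" unfolding synth_norm[OF v] iv ..
  also have "\<dots> = L2norm (trunc R u)" by (rule L2norm_cong) simp
  finally show "L2norm (ft R u) = L2norm (trunc R u)" .
qed

lemma ft_increment:
  assumes u: "u \<in> L2"
  shows "L2norm (\<lambda>\<eta>. ft R u \<eta> - ft R' u \<eta>) = L2norm (\<lambda>x. trunc R u x - trunc R' u x)"
proof -
  let ?m = "max R R'" and ?d = "\<lambda>x. trunc R u x - trunc R' u x"
  have tt: "trunc ?m (trunc R u) = trunc R u" "trunc ?m (trunc R' u) = trunc R' u" "trunc ?m ?d = ?d"
    by (auto simp: trunc_def fun_eq_iff indicator_def)
  have "ft R u \<eta> - ft R' u \<eta> = ft ?m ?d \<eta>" for \<eta>
    unfolding ft_diff[OF trunc_L2[OF u] trunc_L2[OF u]] by (simp add: ft_trunc tt)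
  then show ?thesis
    using ft_isometry(2)[OF L2_diff[OF trunc_L2[OF u] trunc_L2[OF u]], of ?m R R'] by (simp add: tt)
qed

lemma trunc_le:
  assumes u: "u \<in> L2"
  shows "L2norm (\<lambda>x. trunc R u x - trunc R' u x)
    \<le> L2norm (\<lambda>x. trunc R u x - u x) + L2norm (\<lambda>x. trunc R' u x - u x)"
  using L2norm_triangle_diff[OF trunc_L2[OF u] u trunc_L2[OF u], of R R'] L2norm_diff_commute[of u "trunc R' u"]
  by simp

text \<open>By isometry the truncated transforms inherit the Cauchy property of the truncations.\<close>

lemma ft_converges:
  fixes u :: "real^'n \<Rightarrow> complex"
  assumes u: "u \<in> L2"
  obtains g where "g \<in> L2" "((\<lambda>R. L2norm (\<lambda>\<eta>. ft R u \<eta> - g \<eta>)) \<longlongrightarrow> 0) at_top"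
proof -
  let ?t = "\<lambda>R. L2norm (\<lambda>x. trunc R u x - u x)"
  have cau: "\<exists>N. \<forall>m\<ge>N. \<forall>n\<ge>N. L2norm (\<lambda>\<eta>. ft (real m) u \<eta> - ft (real n) u \<eta>) \<le> e" if "0 < e" for e
  proof -
    have "eventually (\<lambda>R. ?t R < e / 2) at_top"
      by (rule order_tendstoD(2)[OF trunc_tendsto[OF u]]) (use that in simp)
    then obtain R where R: "\<And>r. r \<ge> R \<Longrightarrow> ?t r < e / 2" by (auto simp: eventually_at_top_linorder)
    obtain N where N: "R \<le> real N" using real_arch_simple by blast
    have "L2norm (\<lambda>\<eta>. ft (real m) u \<eta> - ft (real n) u \<eta>) \<le> e" if "m \<ge> N" "n \<ge> N" for m n
      using trunc_le[OF u, of "real m" "real n"] R[of "real m"] R[of "real n"] N that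
      unfolding ft_increment[OF u] by simp
    then show ?thesis by blast
  qed
  obtain g where g: "g \<in> L2" "(\<lambda>n. L2norm (\<lambda>\<eta>. ft (real n) u \<eta> - g \<eta>)) \<longlonglongrightarrow> 0"
    using L2_complete[OF ft_isometry(1)[OF u] cau] by blast
  have seq: "(\<lambda>n. ?t (real n)) \<longlonglongrightarrow> 0"
    by (rule filterlim_compose[OF trunc_tendsto[OF u] filterlim_real_sequentially])
  have le: "L2norm (\<lambda>\<eta>. ft R u \<eta> - g \<eta>) \<le> ?t R" for R
  proof (rule tendsto_lowerbound)
    have "L2norm (\<lambda>\<eta>. ft R u \<eta> - g \<eta>) \<le> ?t R + ?t (real n) + L2norm (\<lambda>\<eta>. ft (real n) u \<eta> - g \<eta>)" for n
      using L2norm_triangle_diff[OF ft_isometry(1)[OF u] ft_isometry(1)[OF u] g(1), of R "real n"]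
        trunc_le[OF u, of R "real n"] unfolding ft_increment[OF u] by simp
    then show "\<forall>\<^sub>F n in sequentially. L2norm (\<lambda>\<eta>. ft R u \<eta> - g \<eta>) \<le> ?t R + ?t (real n) + L2norm (\<lambda>\<eta>. ft (real n) u \<eta> - g \<eta>)"
      by simp
    show "(\<lambda>n. ?t R + ?t (real n) + L2norm (\<lambda>\<eta>. ft (real n) u \<eta> - g \<eta>)) \<longlonglongrightarrow> ?t R"
      using tendsto_add[OF tendsto_add[OF tendsto_const[of "?t R"] seq] g(2)] by simp
  qed simp
  have "((\<lambda>R. L2norm (\<lambda>\<eta>. ft R u \<eta> - g \<eta>)) \<longlongrightarrow> 0) at_top"
    by (rule L2norm_squeeze[OF le trunc_tendsto[OF u]])
  with g(1) show ?thesis by (rule that)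
qed

lemma is_fourier_iff:
  assumes "u \<in> L2"
  shows "is_fourier u g \<longleftrightarrow> g \<in> L2 \<and> ((\<lambda>R. L2norm (\<lambda>\<eta>. ft R u \<eta> - g \<eta>)) \<longlongrightarrow> 0) at_top"
  unfolding is_fourier_def ft_def[symmetric]
  using L2_tendsto_iff[of "\<lambda>R. ft R u" g at_top] ft_isometry(1)[OF assms] by auto

lemma fourier_is: "(u :: real^'n \<Rightarrow> complex) \<in> L2 \<Longrightarrow> is_fourier u (fourier u)"
proof -
  assume u: "u \<in> L2"
  obtain g where "g \<in> L2" "((\<lambda>R. L2norm (\<lambda>\<eta>. ft R u \<eta> - g \<eta>)) \<longlongrightarrow> 0) at_top"
    using ft_converges[OF u] .
  then have "is_fourier u g" using is_fourier_iff[OF u] by blast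
  then show "is_fourier u (fourier u)" unfolding fourier_def by (rule someI[of "is_fourier u"])
qed

lemma fourier_L2: "u \<in> L2 \<Longrightarrow> fourier u \<in> L2"
  using fourier_is is_fourier_iff by blast

lemma fourier_tendsto: "u \<in> L2 \<Longrightarrow> ((\<lambda>R. L2norm (\<lambda>\<eta>. ft R u \<eta> - fourier u \<eta>)) \<longlongrightarrow> 0) at_top"
  using fourier_is is_fourier_iff by blast

lemma fourier_unique:
  assumes "u \<in> L2" "g \<in> L2" "((\<lambda>R. L2norm (\<lambda>\<eta>. ft R u \<eta> - g \<eta>)) \<longlongrightarrow> 0) at_top"
  shows "AE \<eta> in lborel. fourier u \<eta> = g \<eta>"
  by (rule L2_limit_unique[OF ft_isometry(1)[OF assms(1)] fourier_L2[OF assms(1)] assms(2) _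
        fourier_tendsto[OF assms(1)] assms(3)]) simp

lemma L2norm_tendsto:
  assumes "\<And>i. f i \<in> L2" "g \<in> L2" "((\<lambda>i. L2norm (\<lambda>x. f i x - g x)) \<longlongrightarrow> 0) F"
  shows "((\<lambda>i. L2norm (f i)) \<longlongrightarrow> L2norm g) F"
proof -
  have "((\<lambda>i. L2norm (f i) - L2norm g) \<longlongrightarrow> 0) F"
    by (rule Lim_null_comparison[OF _ assms(3)])
      (use L2norm_diff_ineq[OF assms(1,2)] in \<open>simp add: always_eventually\<close>)
  then show ?thesis by (simp add: LIM_zero_iff)
qed

text \<open>Plancherel's theorem: isometry passes to the limit of the truncated transforms.\<close>

lemma fourier_norm:
  assumes u: "u \<in> L2" shows "L2norm (fourier u) = L2norm u"
proof -
  have "((\<lambda>R. L2norm (ft R u)) \<longlongrightarrow> L2norm (fourier u)) at_top"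
    by (rule L2norm_tendsto[OF ft_isometry(1)[OF u] fourier_L2[OF u] fourier_tendsto[OF u]])
  moreover have "((\<lambda>R. L2norm (ft R u)) \<longlongrightarrow> L2norm u) at_top"
    unfolding ft_isometry(2)[OF u] by (rule L2norm_tendsto[OF trunc_L2[OF u] u trunc_tendsto[OF u]])
  ultimately show ?thesis by (rule tendsto_unique[rotated]) simp
qed

lemma fourier_add:
  assumes u: "u \<in> L2" and v: "v \<in> L2"
  shows "AE \<eta> in lborel. fourier (\<lambda>x. u x + v x) \<eta> = fourier u \<eta> + fourier v \<eta>"
proof (rule fourier_unique[OF L2_add[OF u v] L2_add[OF fourier_L2[OF u] fourier_L2[OF v]]])
  have "L2norm (\<lambda>\<eta>. ft R (\<lambda>x. u x + v x) \<eta> - (fourier u \<eta> + fourier v \<eta>))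
      \<le> L2norm (\<lambda>\<eta>. ft R u \<eta> - fourier u \<eta>) + L2norm (\<lambda>\<eta>. ft R v \<eta> - fourier v \<eta>)" for R
  proof -
    have eq: "ft R (\<lambda>x. u x + v x) \<eta> - (fourier u \<eta> + fourier v \<eta>)
        = (ft R u \<eta> - fourier u \<eta>) + (ft R v \<eta> - fourier v \<eta>)" for \<eta>
      by (simp add: ft_add[OF u v])
    show ?thesis
      unfolding eq by (rule L2norm_triangle[OF L2_diff[OF ft_isometry(1)[OF u] fourier_L2[OF u]]
          L2_diff[OF ft_isometry(1)[OF v] fourier_L2[OF v]]])
  qed
  then show "((\<lambda>R. L2norm (\<lambda>\<eta>. ft R (\<lambda>x. u x + v x) \<eta> - (fourier u \<eta> + fourier v \<eta>))) \<longlongrightarrow> 0) at_top"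
    using tendsto_add[OF fourier_tendsto[OF u] fourier_tendsto[OF v]]
    by - (rule L2norm_squeeze, simp_all)
qed

lemma fourier_cmult:
  assumes u: "u \<in> L2"
  shows "AE \<eta> in lborel. fourier (\<lambda>x. c * u x) \<eta> = c * fourier u \<eta>"
proof (rule fourier_unique[OF L2_cmult[OF u] L2_cmult[OF fourier_L2[OF u]]])
  have "L2norm (\<lambda>\<eta>. ft R (\<lambda>x. c * u x) \<eta> - c * fourier u \<eta>) = norm c * L2norm (\<lambda>\<eta>. ft R u \<eta> - fourier u \<eta>)" for R
    unfolding ft_cmult right_diff_distrib[symmetric] L2norm_cmult ..
  then show "((\<lambda>R. L2norm (\<lambda>\<eta>. ft R (\<lambda>x. c * u x) \<eta> - c * fourier u \<eta>)) \<longlongrightarrow> 0) at_top"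
    using tendsto_mult_right_zero[OF fourier_tendsto[OF u], of "norm c"] by simp
qed

lemma fourier_diff:
  assumes u: "u \<in> L2" and v: "v \<in> L2"
  shows "AE \<eta> in lborel. fourier (\<lambda>x. u x - v x) \<eta> = fourier u \<eta> - fourier v \<eta>"
  using fourier_add[OF u L2_cmult[OF v, of "-1"]] fourier_cmult[OF v, of "-1"]
  by eventually_elim simp

lemma fourier_sum:
  fixes u :: "'i \<Rightarrow> real^'n \<Rightarrow> complex"
  assumes "finite I" "\<And>i. i \<in> I \<Longrightarrow> u i \<in> L2"
  shows "AE \<eta> in lborel. fourier (\<lambda>x. \<Sum>i\<in>I. c i * u i x) \<eta> = (\<Sum>i\<in>I. c i * fourier (u i) \<eta>)"
  using assms
proof (induction I rule: finite_induct)
  case empty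
  have "AE \<eta> in lborel. fourier (\<lambda>x::real^'n. 0 * (0::complex)) \<eta> = 0 * fourier (\<lambda>x. 0) \<eta>"
    by (rule fourier_cmult[OF L2_zero])
  then show ?case by simp
next
  case (insert i I)
  have "AE \<eta> in lborel. fourier (\<lambda>x. c i * u i x + (\<Sum>i\<in>I. c i * u i x)) \<eta>
      = fourier (\<lambda>x. c i * u i x) \<eta> + fourier (\<lambda>x. \<Sum>i\<in>I. c i * u i x) \<eta>"
    by (rule fourier_add) (auto intro!: L2_cmult L2_sum insert.prems)
  moreover have "AE \<eta> in lborel. fourier (\<lambda>x. c i * u i x) \<eta> = c i * fourier (u i) \<eta>"
    by (rule fourier_cmult) (simp add: insert.prems)
  moreover have "AE \<eta> in lborel. fourier (\<lambda>x. \<Sum>i\<in>I. c i * u i x) \<eta> = (\<Sum>i\<in>I. c i * fourier (u i) \<eta>)"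
    by (rule insert.IH) (simp add: insert.prems)
  ultimately show ?case
  proof eventually_elim
    case (elim \<eta>) then show ?case using insert.hyps by simp
  qed
qed

lemma fourier_norm_diff:
  assumes u: "u \<in> L2" and v: "v \<in> L2"
  shows "L2norm (\<lambda>\<eta>. fourier u \<eta> - fourier v \<eta>) = L2norm (\<lambda>x. u x - v x)"
  using fourier_norm[OF L2_diff[OF u v]]
    L2norm_cong_AE[OF fourier_L2[OF L2_diff[OF u v]] L2_diff[OF fourier_L2[OF u] fourier_L2[OF v]] fourier_diff[OF u v]]
  by simp

lemma fourier_eq_iff:
  assumes u: "u \<in> L2" and v: "v \<in> L2"
  shows "(AE \<eta> in lborel. fourier u \<eta> = fourier v \<eta>) \<longleftrightarrow> (AE x in lborel. u x = v x)"
  unfolding L2norm_diff_eq_0[OF u v, symmetric] fourier_norm_diff[OF u v, symmetric]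
    L2norm_diff_eq_0[OF fourier_L2[OF u] fourier_L2[OF v]] ..

lemma fourier_inner:
  assumes u: "u \<in> L2" and v: "v \<in> L2"
  shows "L2inner (fourier u) (fourier v) = L2inner u v"
proof -
  have n: "L2norm (\<lambda>\<eta>. fourier u \<eta> + c * fourier v \<eta>) = L2norm (\<lambda>x. u x + c * v x)" for c
  proof -
    have "AE \<eta> in lborel. fourier (\<lambda>x. u x + c * v x) \<eta> = fourier u \<eta> + c * fourier v \<eta>"
      using fourier_add[OF u L2_cmult[OF v, of c]] fourier_cmult[OF v, of c] by eventually_elim simp
    then have "L2norm (fourier (\<lambda>x. u x + c * v x)) = L2norm (\<lambda>\<eta>. fourier u \<eta> + c * fourier v \<eta>)"
      by (intro L2norm_cong_AE fourier_L2 L2_add L2_cmult u v)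
    then show ?thesis by (simp add: fourier_norm L2_add L2_cmult u v)
  qed
  show ?thesis
    unfolding L2inner_polarization[OF u v] L2inner_polarization[OF fourier_L2[OF u] fourier_L2[OF v]]
      fourier_norm[OF u] fourier_norm[OF v]
    using n[of 1] n[of \<i>] by simp
qed

text \<open>For an integrable function the truncated transforms converge pointwise as well, and Fatou's lemma
  identifies the two limits.\<close>

lemma fourier_integrable:
  fixes u :: "real^'n \<Rightarrow> complex"
  assumes u: "u \<in> L2" and i: "integrable lborel u"
  shows "AE \<eta> in lborel. fourier u \<eta> = (LINT x|lborel. u x * cis (- 2 * pi * (x \<bullet> \<eta>)))"
proof -
  have [measurable]: "u \<in> borel_measurable borel" using u by auto
  let ?F = "\<lambda>\<eta>. LINT x|lborel. u x * cis (- 2 * pi * (x \<bullet> \<eta>))"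
  have Fm: "?F \<in> borel_measurable borel"
    by (rule borel_measurable_integral_lborel) measurable
  have lim: "(\<lambda>n. ft (real n) u \<eta>) \<longlonglongrightarrow> ?F \<eta>" for \<eta>
    unfolding ft_trunc
  proof (rule integral_dominated_convergence[where w="\<lambda>x. norm (u x)"])
    show "integrable lborel (\<lambda>x. norm (u x))" using i by simp
    show "AE x in lborel. (\<lambda>n. trunc (real n) u x * cis (- 2 * pi * (x \<bullet> \<eta>))) \<longlonglongrightarrow> u x * cis (- 2 * pi * (x \<bullet> \<eta>))"
    proof (rule AE_I2)
      fix x :: "real^'n"
      obtain N where N: "norm x \<le> real N" using real_arch_simple by blast
      have "\<forall>\<^sub>F n in sequentially. trunc (real n) u x * cis (- 2 * pi * (x \<bullet> \<eta>)) = u x * cis (- 2 * pi * (x \<bullet> \<eta>))"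
        using eventually_ge_at_top[of N]
      proof eventually_elim
        case (elim n)
        then have "norm x \<le> real n" using N by linarith
        then show ?case by (simp add: trunc_def)
      qed
      then show "(\<lambda>n. trunc (real n) u x * cis (- 2 * pi * (x \<bullet> \<eta>))) \<longlonglongrightarrow> u x * cis (- 2 * pi * (x \<bullet> \<eta>))"
        by (rule tendsto_eventually)
    qed
    show "AE x in lborel. norm (trunc (real n) u x * cis (- 2 * pi * (x \<bullet> \<eta>))) \<le> norm (u x)" for n
      by (auto simp: trunc_def norm_mult indicator_def)
  qed (auto simp: trunc_def)
  have seq: "(\<lambda>n. L2norm (\<lambda>\<eta>. ft (real n) u \<eta> - fourier u \<eta>)) \<longlonglongrightarrow> 0"
    by (rule filterlim_compose[OF fourier_tendsto[OF u] filterlim_real_sequentially])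
  have Dm: "(\<lambda>\<eta>. ?F \<eta> - fourier u \<eta>) \<in> borel_measurable borel"
    by (rule borel_measurable_diff[OF Fm L2_measurable[OF fourier_L2[OF u]]])
  have fat: "(\<lambda>\<eta>. ?F \<eta> - fourier u \<eta>) \<in> L2 \<and> L2norm (\<lambda>\<eta>. ?F \<eta> - fourier u \<eta>) \<le> e" if "0 < e" for e
  proof -
    have "\<forall>\<^sub>F n in sequentially. L2norm (\<lambda>\<eta>. ft (real n) u \<eta> - fourier u \<eta>) \<le> e"
      using order_tendstoD(2)[OF seq that] by eventually_elim simp
    moreover have "AE \<eta> in lborel. (\<lambda>n. ft (real n) u \<eta> - fourier u \<eta>) \<longlonglongrightarrow> ?F \<eta> - fourier u \<eta>"
      by (intro AE_I2 tendsto_diff lim tendsto_const)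
    ultimately show ?thesis
      using L2_Fatou[OF L2_diff[OF ft_isometry(1)[OF u] fourier_L2[OF u]] Dm] by blast
  qed
  have D: "(\<lambda>\<eta>. ?F \<eta> - fourier u \<eta>) \<in> L2" using fat[of 1] by simp
  have "L2norm (\<lambda>\<eta>. ?F \<eta> - fourier u \<eta>) \<le> 0"
    by (rule field_le_epsilon) (use fat in simp)
  then have "L2norm (\<lambda>\<eta>. ?F \<eta> - fourier u \<eta>) = 0" using L2norm_nonneg[of "\<lambda>\<eta>. ?F \<eta> - fourier u \<eta>"] by linarith
  then have "AE \<eta> in lborel. ?F \<eta> - fourier u \<eta> = 0" using L2norm_eq_0[OF D] by blast
  then show ?thesis by eventually_elim simp
qed

lemma fourier_cnj:
  fixes u :: "real^'n \<Rightarrow> complex"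
  assumes u: "u \<in> L2"
  shows "AE \<eta> in lborel. fourier (\<lambda>x. cnj (u x)) \<eta> = cnj (fourier u (- \<eta>))"
proof (rule fourier_unique[OF L2_cnj[OF u]])
  have r: "(\<lambda>\<eta>. v (- \<eta>)) \<in> L2" "L2norm (\<lambda>\<eta>. v (- \<eta>)) = L2norm v" if "v \<in> L2" for v :: "real^'n \<Rightarrow> complex"
    using L2_scale(1)[OF that, of "-1"] L2_scale(2)[OF that, of "-1"] by simp_all
  show "(\<lambda>\<eta>. cnj (fourier u (- \<eta>))) \<in> L2" by (rule L2_cnj[OF r(1)[OF fourier_L2[OF u]]])
  have "ft R (\<lambda>x. cnj (u x)) \<eta> = cnj (ft R u (- \<eta>))" for R \<eta>
  proof -
    have "trunc R (\<lambda>x. cnj (u x)) x * cis (- 2 * pi * (x \<bullet> \<eta>)) = cnj (trunc R u x * cis (- 2 * pi * (x \<bullet> - \<eta>)))" for x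
      by (simp add: trunc_def cis_cnj)
    then show ?thesis unfolding ft_trunc Bochner_Integration.integral_cnj[symmetric] by (simp only:)
  qed
  then have "L2norm (\<lambda>\<eta>. ft R (\<lambda>x. cnj (u x)) \<eta> - cnj (fourier u (- \<eta>)))
      = L2norm (\<lambda>\<eta>. ft R u \<eta> - fourier u \<eta>)" for R
    using r(2)[OF L2_diff[OF ft_isometry(1)[OF u] fourier_L2[OF u]], of R]
      L2norm_cong[of "\<lambda>\<eta>. cnj (ft R u (- \<eta>)) - cnj (fourier u (- \<eta>))" "\<lambda>\<eta>. ft R u (- \<eta>) - fourier u (- \<eta>)"]
    by (simp flip: complex_cnj_diff)
  then show "((\<lambda>R. L2norm (\<lambda>\<eta>. ft R (\<lambda>x. cnj (u x)) \<eta> - cnj (fourier u (- \<eta>)))) \<longlongrightarrow> 0) at_top"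
    using fourier_tendsto[OF u] by simp
qed

subsection \<open>Band-limited functions\<close>

text \<open>For \<open>S\<close> inside a large cell \<open>Zscaled \<epsilon>\<close>, this is the recovery of the coefficients of a synthesis.\<close>

lemma synth_plane:
  fixes g :: "real^'n \<Rightarrow> complex"
  assumes g: "g \<in> L2" and S: "S \<in> sets borel" "bounded S"
  shows "synth plane S g \<in> L2" "AE \<eta> in lborel. fourier (synth plane S g) \<eta> = indicator S \<eta> *\<^sub>R g \<eta>"
proof -
  obtain \<epsilon> where e: "0 < \<epsilon>" "S \<subseteq> Zscaled \<epsilon>" using bounded_subset_Zscaled[OF S(2)] by blast
  interpret isometric_kernel "plane :: real^'n \<Rightarrow> _" "Zscaled \<epsilon>" by (rule isometric_kernel_plane[OF e(1)])
  let ?h = "\<lambda>\<eta>. indicator S \<eta> *\<^sub>R g \<eta>"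
  have h: "?h \<in> L2" by (rule L2_indicator[OF g S(1)])
  have eq: "synth plane S g = synth plane (Zscaled \<epsilon>) ?h"
    unfolding synth_def set_lebesgue_integral_def
    by (rule ext, rule arg_cong[where f="integral\<^sup>L lborel"]) (use e(2) in \<open>auto simp: fun_eq_iff indicator_def\<close>)
  have ih: "indicator (Zscaled \<epsilon>) \<eta> *\<^sub>R ?h \<eta> = ?h \<eta>" for \<eta>
    using e(2) by (auto simp: indicator_def)
  note F = synth_L2[OF h]
  show "synth plane S g \<in> L2" unfolding eq by (rule F)
  show "AE \<eta> in lborel. fourier (synth plane S g) \<eta> = ?h \<eta>"
    unfolding eq
  proof (rule fourier_unique[OF F h])
    have "L2norm (\<lambda>\<eta>. ft R (synth plane (Zscaled \<epsilon>) ?h) \<eta> - ?h \<eta>)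
        \<le> L2norm (\<lambda>x. trunc R (synth plane (Zscaled \<epsilon>) ?h) x - synth plane (Zscaled \<epsilon>) ?h x)" for R
      using analysis_recovers[OF h ft_isometry(1)[OF F, of R] eq_refl[OF ft_isometry(2)[OF F, of R]]]
      unfolding ih by (simp add: ft_eq_analysis)
    then show "((\<lambda>R. L2norm (\<lambda>\<eta>. ft R (synth plane (Zscaled \<epsilon>) ?h) \<eta> - ?h \<eta>)) \<longlongrightarrow> 0) at_top"
      by (rule L2norm_squeeze[OF _ trunc_tendsto[OF F]])
  qed
qed

text \<open>Fourier inversion for band-limited functions follows from injectivity of the transform.\<close>

lemma fourier_inversion:
  fixes u :: "real^'n \<Rightarrow> complex"
  assumes u: "u \<in> L2" and S: "S \<in> sets borel" "bounded S"
    and supp: "AE \<eta> in lborel. \<eta> \<notin> S \<longrightarrow> fourier u \<eta> = 0"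
  shows "AE x in lborel. u x = synth plane S (fourier u) x"
proof -
  note s = synth_plane[OF fourier_L2[OF u] S]
  have "AE \<eta> in lborel. fourier u \<eta> = fourier (synth plane S (fourier u)) \<eta>"
    using s(2) supp by eventually_elim (auto simp: indicator_def)
  then show ?thesis using fourier_eq_iff[OF u s(1)] by blast
qed

section \<open>Test functions\<close>

subsection \<open>Bump functions\<close>

text \<open>The function \<open>exp (-1/r)\<close> extended by zero is \<open>flat 0\<close>; the index counts the negative powers of \<open>r\<close> that
  differentiation produces.\<close>

definition flat :: "nat \<Rightarrow> real \<Rightarrow> real" where
  "flat m r = (if 0 < r then exp (- (1 / r)) / r ^ m else 0)"

lemma flat_tendsto_0: "(flat m \<longlongrightarrow> 0) (at 0)"
proof -
  have "((\<lambda>x::real. x ^ m / exp x) \<longlongrightarrow> 0) at_top" by (rule tendsto_power_div_exp_0)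
  from filterlim_compose[OF this filterlim_inverse_at_top_right]
  have lim: "((\<lambda>r::real. inverse r ^ m / exp (inverse r)) \<longlongrightarrow> 0) (at_right 0)" .
  have right: "(flat m \<longlongrightarrow> 0) (at_right 0)"
  proof (rule Lim_transform_eventually[OF lim])
    show "\<forall>\<^sub>F r in at_right 0. inverse r ^ m / exp (inverse r) = flat m r"
      using eventually_at_right_less[of "0::real"]
      by eventually_elim (simp add: flat_def exp_minus field_simps power_inverse)
  qed
  have left: "(flat m \<longlongrightarrow> 0) (at_left 0)"
  proof (rule tendsto_eventually)
    show "\<forall>\<^sub>F r in at_left 0. flat m r = 0"
      unfolding eventually_at_filter by (auto simp: flat_def)
  qed
  show ?thesis using left right by (simp add: filterlim_at_split)
qed

lemma flat_deriv: "(flat m has_real_derivative (flat (m + 2) r - real m * flat (m + 1) r)) (at r)"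
proof (cases r "0::real" rule: linorder_cases)
  case less
  have "((\<lambda>_. 0) has_real_derivative 0) (at r)" by simp
  then have "(flat m has_real_derivative 0) (at r)"
    by (rule has_field_derivative_transform_within_open[of _ _ _ "{..<0}"]) (use less in \<open>auto simp: flat_def\<close>)
  then show ?thesis using less by (simp add: flat_def)
next
  case equal
  have "(flat m has_real_derivative 0) (at 0)"
    unfolding has_field_derivative_iff
  proof (rule Lim_transform_eventually[OF flat_tendsto_0[of "m + 1"]])
    show "\<forall>\<^sub>F h in at 0. flat (m + 1) h = (flat m h - flat m 0) / (h - 0)"
      by (rule always_eventually) (auto simp: flat_def)
  qed
  then show ?thesis using equal by (simp add: flat_def)
next
  case greater
  have "((\<lambda>r. exp (- (1 / r)) * (inverse r) ^ m) has_real_derivative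
      (exp (- (1 / r)) * (inverse r ^ 2) * inverse r ^ m
        + exp (- (1 / r)) * (real m * inverse r ^ (m - 1) * (- (inverse r ^ 2))))) (at r)"
    using greater
    by (auto intro!: derivative_eq_intros simp: power2_eq_square divide_inverse)
  then have d: "(flat m has_real_derivative
      (exp (- (1 / r)) * (inverse r ^ 2) * inverse r ^ m
        + exp (- (1 / r)) * (real m * inverse r ^ (m - 1) * (- (inverse r ^ 2))))) (at r)"
    by (rule has_field_derivative_transform_within_open[of _ _ _ "{0<..}"])
      (use greater in \<open>auto simp: flat_def divide_inverse power_inverse\<close>)
  have "exp (- (1 / r)) * (inverse r ^ 2) * inverse r ^ m
        + exp (- (1 / r)) * (real m * inverse r ^ (m - 1) * (- (inverse r ^ 2)))
      = flat (m + 2) r - real m * flat (m + 1) r"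
  proof (cases m)
    case 0
    then show ?thesis using greater by (simp add: flat_def divide_inverse power_inverse power2_eq_square)
  next
    case (Suc k)
    then show ?thesis using greater
      by (simp add: flat_def divide_inverse power_inverse power2_eq_square algebra_simps)
  qed
  with d show ?thesis by simp
qed

lemma flat_continuous: "continuous_on S (flat m)"
  by (rule DERIV_continuous_on[OF has_field_derivative_at_within[OF flat_deriv]])

lemma flat_nonneg: "0 \<le> flat m r"
  by (simp add: flat_def)

text \<open>The smallest class that contains the bump functions \<open>flat m (a - \<bar>x\<bar>\<^sup>2)\<close> and is visibly closed
  under partial derivatives.\<close>

inductive_set bumps :: "real \<Rightarrow> (real^'n \<Rightarrow> real) set" for a :: real where
  base: "(\<lambda>x. flat m (a - x \<bullet> x)) \<in> bumps a"
| scale: "f \<in> bumps a \<Longrightarrow> (\<lambda>x. c * f x) \<in> bumps a"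
| coord: "f \<in> bumps a \<Longrightarrow> (\<lambda>x. x $ i * f x) \<in> bumps a"
| add: "f \<in> bumps a \<Longrightarrow> g \<in> bumps a \<Longrightarrow> (\<lambda>x. f x + g x) \<in> bumps a"

lemma bumps_continuous: "f \<in> bumps a \<Longrightarrow> continuous_on UNIV f"
proof (induction rule: bumps.induct)
  case (base m)
  show ?case by (rule continuous_on_compose2[OF flat_continuous[of UNIV m]]) (auto intro!: continuous_intros)
qed (auto intro!: continuous_intros)

lemma bumps_support: "f \<in> bumps a \<Longrightarrow> a \<le> x \<bullet> x \<Longrightarrow> f x = 0"
  by (induction rule: bumps.induct) (auto simp: flat_def)

lemma bumps_deriv:
  "(f :: real^'n \<Rightarrow> real) \<in> bumps a \<Longrightarrow> \<exists>g\<in>bumps a. \<forall>x. ((\<lambda>t. f (x + t *\<^sub>R axis j 1)) has_real_derivative g x) (at 0)"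
proof (induction rule: bumps.induct)
  case (base m)
  let ?g = "\<lambda>x::real^'n. (-2) * (x $ j * (flat (m + 2) (a - x \<bullet> x) + (- real m) * flat (m + 1) (a - x \<bullet> x)))"
  have gb: "?g \<in> bumps a" by (intro bumps.intros)
  have d: "((\<lambda>t. flat m (a - (x + t *\<^sub>R axis j 1) \<bullet> (x + t *\<^sub>R axis j 1))) has_real_derivative ?g x) (at 0)" for x :: "real^'n"
  proof -
    have eq: "a - (x + t *\<^sub>R axis j 1) \<bullet> (x + t *\<^sub>R axis j 1) = a - x \<bullet> x - 2 * t * x $ j - t\<^sup>2" for t
      by (simp add: inner_add_left inner_add_right inner_axis inner_axis' power2_eq_square algebra_simps)
    have q: "((\<lambda>t. a - x \<bullet> x - 2 * t * x $ j - t\<^sup>2) has_real_derivative (-2 * x $ j)) (at 0)"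
      by (auto intro!: derivative_eq_intros)
    have "((\<lambda>t. flat m (a - x \<bullet> x - 2 * t * x $ j - t\<^sup>2)) has_real_derivative
        (flat (m + 2) (a - x \<bullet> x) - real m * flat (m + 1) (a - x \<bullet> x)) * (-2 * x $ j)) (at 0)"
      by (rule DERIV_chain2[OF _ q]) (use flat_deriv[of m "a - x \<bullet> x"] in simp)
    then show ?thesis unfolding eq by (rule DERIV_cong) (simp add: algebra_simps)
  qed
  show ?case by (rule bexI[OF _ gb]) (intro allI d)
next
  case (scale f c)
  then obtain g where g: "g \<in> bumps a" "\<And>x. ((\<lambda>t. f (x + t *\<^sub>R axis j 1)) has_real_derivative g x) (at 0)" by blast
  show ?case
    by (rule bexI[OF _ bumps.scale[OF g(1), of c]]) (use g(2) in \<open>auto intro!: derivative_eq_intros\<close>)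
next
  case (coord f i)
  then obtain g where g: "g \<in> bumps a" "\<And>x. ((\<lambda>t. f (x + t *\<^sub>R axis j 1)) has_real_derivative g x) (at 0)" by blast
  let ?g = "\<lambda>x. (if i = j then 1 else 0) * f x + x $ i * g x"
  have gb: "?g \<in> bumps a" by (intro bumps.intros coord.hyps g(1))
  have d: "((\<lambda>t. (x + t *\<^sub>R axis j 1) $ i * f (x + t *\<^sub>R axis j 1)) has_real_derivative ?g x) (at 0)" for x
  proof -
    have "((\<lambda>t. (x + t *\<^sub>R axis j 1) $ i) has_real_derivative (if i = j then 1 else 0)) (at 0)"
      by (auto intro!: derivative_eq_intros simp: axis_def)
    from DERIV_mult[OF this g(2)[of x]] show ?thesis
      by (rule DERIV_cong) (simp add: mult.commute)
  qed
  show ?case by (rule bexI[OF _ gb]) (intro allI d)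
next
  case (add f1 f2)
  then obtain g1 g2 where g: "g1 \<in> bumps a" "\<And>x. ((\<lambda>t. f1 (x + t *\<^sub>R axis j 1)) has_real_derivative g1 x) (at 0)"
    "g2 \<in> bumps a" "\<And>x. ((\<lambda>t. f2 (x + t *\<^sub>R axis j 1)) has_real_derivative g2 x) (at 0)" by blast
  show ?case
    by (rule bexI[OF _ bumps.add[OF g(1,3)]]) (use g(2,4) in \<open>auto intro!: derivative_eq_intros\<close>)
qed

lemma bumps_partial_deriv: "f \<in> bumps a \<Longrightarrow> partial_deriv j f \<in> bumps a"
proof -
  assume "f \<in> bumps a"
  then obtain g where g: "g \<in> bumps a" "\<And>x. ((\<lambda>t. f (x + t *\<^sub>R axis j 1)) has_real_derivative g x) (at 0)"
    using bumps_deriv by blast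
  have "partial_deriv j f = g" unfolding partial_deriv_def using DERIV_imp_deriv[OF g(2)] by blast
  then show ?thesis using g(1) by simp
qed

lemma bumps_partial_derivs: "f \<in> bumps a \<Longrightarrow> partial_derivs js f \<in> bumps a"
  unfolding partial_derivs_def by (induction js) (auto intro: bumps_partial_deriv)

lemma bumps_test_function:
  fixes f :: "real^'n \<Rightarrow> real"
  assumes f: "f \<in> bumps a" shows "test_function f"
  unfolding test_function_def smooth_def
proof (intro conjI allI)
  fix js :: "'n list" and j x
  show "continuous_on UNIV (partial_derivs js f)" by (rule bumps_continuous[OF bumps_partial_derivs[OF f]])
  show "(\<lambda>t. partial_derivs js f (x + t *\<^sub>R axis j 1)) field_differentiable at 0"
    using bumps_deriv[OF bumps_partial_derivs[OF f, of js], of j] by (auto simp: field_differentiable_def)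
next
  have "{x. f x \<noteq> 0} \<subseteq> cball 0 (sqrt \<bar>a\<bar>)"
  proof
    fix x assume "x \<in> {x. f x \<noteq> 0}"
    then have "x \<bullet> x < a" using bumps_support[OF f, of x] by force
    then have "sqrt (x \<bullet> x) \<le> sqrt \<bar>a\<bar>" by (intro real_sqrt_le_mono) linarith
    then show "x \<in> cball 0 (sqrt \<bar>a\<bar>)" by (simp add: norm_eq_sqrt_inner)
  qed
  then have "bounded {x. f x \<noteq> 0}" using bounded_cball bounded_subset by blast
  then show "compact (closure {x. f x \<noteq> 0})" by simp
qed

subsection \<open>Derivatives and translates of test functions\<close>

definition ft1 :: "(real^'n \<Rightarrow> real) \<Rightarrow> real^'n \<Rightarrow> complex" where
  "ft1 \<phi> \<eta> = (LINT x|lborel. complex_of_real (\<phi> x) * cis (- 2 * pi * (x \<bullet> \<eta>)))"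

lemma test_continuous: "test_function \<phi> \<Longrightarrow> continuous_on UNIV \<phi>"
  unfolding test_function_def smooth_def partial_derivs_def by (metis foldr_Nil id_apply)

lemma test_deriv:
  assumes "test_function \<phi>"
  shows "((\<lambda>t. \<phi> (x + t *\<^sub>R axis j 1)) has_real_derivative partial_deriv j \<phi> (x + s *\<^sub>R axis j 1)) (at s)"
proof -
  have "(\<lambda>t. partial_derivs [] \<phi> ((x + s *\<^sub>R axis j 1) + t *\<^sub>R axis j 1)) field_differentiable at 0"
    using assms unfolding test_function_def smooth_def by blast
  then have "((\<lambda>t. \<phi> ((x + s *\<^sub>R axis j 1) + t *\<^sub>R axis j 1)) has_real_derivative partial_deriv j \<phi> (x + s *\<^sub>R axis j 1)) (at 0)"
    unfolding partial_deriv_def by (simp add: partial_derivs_def field_differentiable_derivI)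
  then have "((\<lambda>t. \<phi> (x + (t + s) *\<^sub>R axis j 1)) has_real_derivative partial_deriv j \<phi> (x + s *\<^sub>R axis j 1)) (at 0)"
    by (simp add: scaleR_add_left add_ac)
  then show ?thesis using DERIV_shift[of "\<lambda>t. \<phi> (x + t *\<^sub>R axis j 1)" _ 0 s] by simp
qed

lemma test_support_bounded:
  assumes "test_function \<phi>"
  obtains R where "0 < R" "\<And>x. R < norm x \<Longrightarrow> \<phi> x = 0"
proof -
  have "bounded {x. \<phi> x \<noteq> 0}"
    using assms unfolding test_function_def by (meson bounded_subset closure_subset compact_imp_bounded)
  then obtain R where R: "0 < R" "\<forall>x\<in>{x. \<phi> x \<noteq> 0}. norm x \<le> R" unfolding bounded_pos by blast
  have "\<phi> x = 0" if "R < norm x" for x using R(2) that by force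
  with R(1) show ?thesis by (rule that)
qed

lemma test_partial_deriv:
  fixes \<phi> :: "real^'n \<Rightarrow> real"
  assumes t: "test_function \<phi>" shows "test_function (partial_deriv j \<phi>)"
  unfolding test_function_def
proof
  have eq: "partial_derivs js (partial_deriv j \<phi>) = partial_derivs (js @ [j]) \<phi>" for js
    by (simp add: partial_derivs_def)
  show "smooth (partial_deriv j \<phi>)"
    using t unfolding smooth_def eq test_function_def by blast
  obtain R where R: "0 < R" "\<And>x. R < norm x \<Longrightarrow> \<phi> x = 0" using test_support_bounded[OF t] by blast
  have "partial_deriv j \<phi> x = 0" if x: "R < norm x" for x
  proof -
    have "open {t. R < norm (x + t *\<^sub>R axis j 1)}"
      by (rule open_Collect_less) (intro continuous_intros)+
    then have "((\<lambda>t. \<phi> (x + t *\<^sub>R axis j 1)) has_real_derivative 0) (at 0)"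
      by (rule has_field_derivative_transform_within_open[of "\<lambda>_. 0", rotated])
        (use R x in auto)
    then show ?thesis unfolding partial_deriv_def by (rule DERIV_imp_deriv)
  qed
  then have "{x. partial_deriv j \<phi> x \<noteq> 0} \<subseteq> cball 0 R" by force
  then have "bounded {x. partial_deriv j \<phi> x \<noteq> 0}" using bounded_cball bounded_subset by blast
  then show "compact (closure {x. partial_deriv j \<phi> x \<noteq> 0})" by simp
qed

lemma test_partial_derivs: "test_function \<phi> \<Longrightarrow> test_function (partial_derivs js \<phi>)"
  unfolding partial_derivs_def by (induction js) (auto intro: test_partial_deriv)

lemma test_bounded:
  assumes t: "test_function \<phi>"
  obtains B where "\<And>x. \<bar>\<phi> x\<bar> \<le> B"
proof -
  obtain R where R: "0 < R" "\<And>x. R < norm x \<Longrightarrow> \<phi> x = 0" using test_support_bounded[OF t] by blast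
  have "compact (\<phi> ` cball 0 R)"
    by (rule compact_continuous_image[OF continuous_on_subset[OF test_continuous[OF t]]]) auto
  then obtain B where B: "\<And>x. x \<in> cball 0 R \<Longrightarrow> \<bar>\<phi> x\<bar> \<le> B"
    using compact_imp_bounded bounded_iff by (metis imageI real_norm_def)
  have B0: "0 \<le> B" using B[of 0] R(1) by simp
  have "\<bar>\<phi> x\<bar> \<le> B" for x using B[of x] R(2)[of x] B0 by (cases "R < norm x") auto
  then show ?thesis by (rule that)
qed

lemma test_measurable: "test_function \<phi> \<Longrightarrow> \<phi> \<in> borel_measurable borel"
  by (rule borel_measurable_continuous_onI[OF test_continuous])

lemma test_integrable:
  fixes \<phi> :: "real^'n \<Rightarrow> real"
  assumes t: "test_function \<phi>" shows "integrable lborel (\<lambda>x. complex_of_real (\<phi> x))" and "\<phi> \<in> L2"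
proof -
  obtain R where R: "0 < R" "\<And>x. R < norm x \<Longrightarrow> \<phi> x = 0" using test_support_bounded[OF t] by blast
  obtain B where B: "\<And>x. \<bar>\<phi> x\<bar> \<le> B" by (rule test_bounded[OF t]) auto
  have B0: "0 \<le> B" using B[of 0] by linarith
  have [measurable]: "\<phi> \<in> borel_measurable borel" by (rule test_measurable[OF t])
  have ib: "integrable lborel (indicator (cball (0::real^'n) R) :: _ \<Rightarrow> real)"
    by (rule integrable_real_indicator) (simp_all add: emeasure_lborel_cball_finite[simplified])
  have 1: "integrable lborel (\<lambda>x::real^'n. B * indicator (cball 0 R) x)" "integrable lborel (\<lambda>x::real^'n. B\<^sup>2 * indicator (cball 0 R) x)"
    using ib by auto
  have "norm (complex_of_real (\<phi> x)) \<le> norm (B * indicator (cball 0 R) x)" for x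
    using B[of x] B0 R(2)[of x] by (cases "norm x \<le> R") auto
  then show "integrable lborel (\<lambda>x. complex_of_real (\<phi> x))"
    by (intro Bochner_Integration.integrable_bound[OF 1(1)]) auto
  have "norm ((norm (\<phi> x))\<^sup>2) \<le> norm (B\<^sup>2 * indicator (cball 0 R) x)" for x
    using power_mono[OF B[of x], of 2] R(2)[of x] by (cases "norm x \<le> R") auto
  then have "integrable lborel (\<lambda>x. (norm (\<phi> x))\<^sup>2)"
    by (intro Bochner_Integration.integrable_bound[OF 1(2)]) auto
  then show "\<phi> \<in> L2" unfolding L2_iff by simp
qed

lemma test_fourier:
  assumes t: "test_function \<phi>"
  shows "AE \<eta> in lborel. rfourier \<phi> \<eta> = ft1 \<phi> \<eta>"
  unfolding ft1_def
  by (rule fourier_integrable[OF _ test_integrable(1)[OF t]]) (simp add: L2_of_real test_integrable(2)[OF t])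

lemma integral_lborel_translate:
  fixes f :: "'a::euclidean_space \<Rightarrow> 'b::{banach,second_countable_topology}"
  assumes [measurable]: "f \<in> borel_measurable borel"
  shows "(LINT x|lborel. f (x + a)) = (LINT x|lborel. f x)"
  by (subst (2) lborel_distr_plus[of a, symmetric]) (simp add: integral_distr add.commute)

lemma test_translate:
  fixes \<phi> :: "real^'n \<Rightarrow> real"
  assumes t: "test_function \<phi>"
  shows "test_function (\<lambda>x. \<phi> (x + a))" "partial_derivs js (\<lambda>x. \<phi> (x + a)) = (\<lambda>x. partial_derivs js \<phi> (x + a))"
proof -
  have pd: "partial_deriv j (\<lambda>x. f (x + a)) = (\<lambda>x. partial_deriv j f (x + a))" for j and f :: "real^'n \<Rightarrow> real"
    by (simp add: partial_deriv_def fun_eq_iff add_ac)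
  show pds: "partial_derivs js (\<lambda>x. \<phi> (x + a)) = (\<lambda>x. partial_derivs js \<phi> (x + a))" for js
    unfolding partial_derivs_def by (induction js) (simp_all add: pd)
  obtain R where R: "0 < R" "\<And>x. R < norm x \<Longrightarrow> \<phi> x = 0" using test_support_bounded[OF t] by blast
  have sm: "smooth \<phi>" using t by (simp add: test_function_def)
  show "test_function (\<lambda>x. \<phi> (x + a))"
    unfolding test_function_def smooth_def pds
  proof (intro conjI allI)
    fix js :: "'n list" and j x
    have "continuous_on UNIV (partial_derivs js \<phi>)" using sm by (simp add: smooth_def)
    then show "continuous_on UNIV (\<lambda>x. partial_derivs js \<phi> (x + a))"
      by (rule continuous_on_compose2) (auto intro!: continuous_intros)
    have "(\<lambda>t. partial_derivs js \<phi> ((x + a) + t *\<^sub>R axis j 1)) field_differentiable at 0"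
      using sm unfolding smooth_def by blast
    then show "(\<lambda>t. partial_derivs js \<phi> (x + t *\<^sub>R axis j 1 + a)) field_differentiable at 0"
      by (simp add: add_ac)
  next
    have "{x. \<phi> (x + a) \<noteq> 0} \<subseteq> cball 0 (R + norm a)"
    proof
      fix x assume "x \<in> {x. \<phi> (x + a) \<noteq> 0}"
      then have "norm (x + a) \<le> R" using R(2)[of "x + a"] by force
      then show "x \<in> cball 0 (R + norm a)" using norm_triangle_ineq4[of "x + a" a] by simp
    qed
    then have "bounded {x. \<phi> (x + a) \<noteq> 0}" using bounded_cball bounded_subset by blast
    then show "compact (closure {x. \<phi> (x + a) \<noteq> 0})" by simp
  qed
qed

lemma ft1_translate:
  assumes t: "test_function \<phi>"
  shows "ft1 (\<lambda>x. \<phi> (x + a)) \<eta> = cis (2 * pi * (a \<bullet> \<eta>)) * ft1 \<phi> \<eta>"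
proof -
  have [measurable]: "\<phi> \<in> borel_measurable borel" by (rule test_measurable[OF t])
  let ?f = "\<lambda>x. cis (2 * pi * (a \<bullet> \<eta>)) * (complex_of_real (\<phi> x) * cis (- 2 * pi * (x \<bullet> \<eta>)))"
  have "complex_of_real (\<phi> (x + a)) * cis (- 2 * pi * (x \<bullet> \<eta>)) = ?f (x + a)" for x
  proof -
    have "cis (- 2 * pi * (x \<bullet> \<eta>)) = cis (2 * pi * (a \<bullet> \<eta>)) * cis (- 2 * pi * ((x + a) \<bullet> \<eta>))"
      by (simp add: cis_mult inner_add_left algebra_simps)
    then show ?thesis by (simp only: mult.left_commute)
  qed
  then have "ft1 (\<lambda>x. \<phi> (x + a)) \<eta> = (LINT x|lborel. ?f (x + a))"
    unfolding ft1_def by (simp only:)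
  also have "\<dots> = (LINT x|lborel. ?f x)" by (rule integral_lborel_translate) measurable
  also have "\<dots> = cis (2 * pi * (a \<bullet> \<eta>)) * ft1 \<phi> \<eta>" unfolding ft1_def by (rule integral_mult_right_zero)
  finally show ?thesis .
qed

text \<open>Differentiating the translation rule for \<open>ft1\<close> at the shift \<open>0\<close> avoids integration by parts.\<close>

lemma ft1_partial_deriv:
  fixes \<phi> :: "real^'n \<Rightarrow> real"
  assumes t: "test_function \<phi>"
  shows "ft1 (partial_deriv j \<phi>) \<eta> = 2 * pi * \<i> * of_real (\<eta> $ j) * ft1 \<phi> \<eta>"
proof -
  let ?e = "axis j 1 :: real^'n"
  define s where "s n = inverse (real (Suc n))" for n
  have s: "0 < s n" "s n \<le> 1" for n by (auto simp: s_def field_simps)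
  have s0: "s \<longlonglongrightarrow> 0" unfolding s_def[abs_def] by (rule LIMSEQ_inverse_real_of_nat)
  have sat: "filterlim s (at 0) sequentially"
    using s s0 by (auto simp: filterlim_at less_imp_neq[symmetric])
  have [measurable]: "\<phi> \<in> borel_measurable borel" by (rule test_measurable[OF t])
  have [measurable]: "partial_deriv j \<phi> \<in> borel_measurable borel" by (rule test_measurable[OF test_partial_deriv[OF t]])
  obtain R where R: "0 < R" "\<And>x. R < norm x \<Longrightarrow> \<phi> x = 0" using test_support_bounded[OF t] by blast
  obtain B where B: "\<And>x. \<bar>partial_deriv j \<phi> x\<bar> \<le> B" by (rule test_bounded[OF test_partial_deriv[OF t]]) auto
  have B0: "0 \<le> B" using B[of 0] by linarith
  define q where "q n x = (\<phi> (x + s n *\<^sub>R ?e) - \<phi> x) / s n" for n x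
  have qb: "\<bar>q n x\<bar> \<le> B * indicator (cball 0 (R + 1)) x" for n x
  proof (cases "norm x \<le> R + 1")
    case True
    obtain z where "\<phi> (x + s n *\<^sub>R ?e) - \<phi> (x + 0 *\<^sub>R ?e) = (s n - 0) * partial_deriv j \<phi> (x + z *\<^sub>R ?e)"
      using MVT2[of 0 "s n" "\<lambda>t. \<phi> (x + t *\<^sub>R ?e)" "\<lambda>z. partial_deriv j \<phi> (x + z *\<^sub>R ?e)"]
        test_deriv[OF t] s(1)[of n] by blast
    then have "q n x = partial_deriv j \<phi> (x + z *\<^sub>R ?e)" using s(1)[of n] by (simp add: q_def)
    then show ?thesis using B True by simp
  next
    case False
    have "norm x \<le> norm (x + s n *\<^sub>R ?e) + norm (s n *\<^sub>R ?e)" using norm_triangle_ineq4[of "x + s n *\<^sub>R ?e" "s n *\<^sub>R ?e"] by simp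
    also have "norm (s n *\<^sub>R ?e) \<le> 1" using s[of n] by simp
    finally have "R < norm (x + s n *\<^sub>R ?e)" using False by linarith
    then show ?thesis using R(2) False by (simp add: q_def)
  qed
  have ib: "integrable lborel (\<lambda>x::real^'n. B * indicator (cball 0 (R + 1)) x)"
    by (intro integrable_mult_right integrable_real_indicator) (simp_all add: emeasure_lborel_cball_finite[simplified])
  have qlim: "(\<lambda>n. q n x) \<longlonglongrightarrow> partial_deriv j \<phi> x" for x
  proof -
    have "((\<lambda>h. (\<phi> (x + (0 + h) *\<^sub>R ?e) - \<phi> (x + 0 *\<^sub>R ?e)) / h) \<longlongrightarrow> partial_deriv j \<phi> (x + 0 *\<^sub>R ?e)) (at 0)"
      using test_deriv[OF t, of x j 0] by (simp add: DERIV_def)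
    from filterlim_compose[OF this sat] show ?thesis by (simp add: q_def)
  qed
  have "(\<lambda>n. LINT x|lborel. complex_of_real (q n x) * cis (- 2 * pi * (x \<bullet> \<eta>)))
      \<longlonglongrightarrow> (LINT x|lborel. complex_of_real (partial_deriv j \<phi> x) * cis (- 2 * pi * (x \<bullet> \<eta>)))"
  proof (rule integral_dominated_convergence[OF _ _ ib])
    show "AE x in lborel. (\<lambda>n. complex_of_real (q n x) * cis (- 2 * pi * (x \<bullet> \<eta>)))
        \<longlonglongrightarrow> complex_of_real (partial_deriv j \<phi> x) * cis (- 2 * pi * (x \<bullet> \<eta>))"
      by (intro AE_I2 tendsto_intros qlim)
    show "AE x in lborel. norm (complex_of_real (q n x) * cis (- 2 * pi * (x \<bullet> \<eta>))) \<le> B * indicator (cball 0 (R + 1)) x" for n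
      using qb[of n] by (intro AE_I2) (simp add: norm_mult)
  qed (auto simp: q_def)
  moreover have "(LINT x|lborel. complex_of_real (q n x) * cis (- 2 * pi * (x \<bullet> \<eta>)))
      = (cis (2 * pi * \<eta> $ j * s n) - 1) / of_real (s n) * ft1 \<phi> \<eta>" for n
  proof -
    let ?c = "\<lambda>x. cis (- 2 * pi * (x \<bullet> \<eta>))"
    note tt = test_translate(1)[OF t, of "s n *\<^sub>R ?e"]
    have "(LINT x|lborel. complex_of_real (q n x) * ?c x)
        = (LINT x|lborel. (complex_of_real (\<phi> (x + s n *\<^sub>R ?e)) * ?c x - complex_of_real (\<phi> x) * ?c x) / of_real (s n))"
      by (simp add: q_def left_diff_distrib)
    also have "\<dots> = (ft1 (\<lambda>x. \<phi> (x + s n *\<^sub>R ?e)) \<eta> - ft1 \<phi> \<eta>) / of_real (s n)"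
      unfolding ft1_def
      by (simp only: integral_divide_zero Bochner_Integration.integral_diff[OF
            integrable_cis_mult[OF test_integrable(1)[OF tt]] integrable_cis_mult[OF test_integrable(1)[OF t]]])
    also have "\<dots> = (cis (2 * pi * \<eta> $ j * s n) - 1) / of_real (s n) * ft1 \<phi> \<eta>"
      by (simp add: ft1_translate[OF t] inner_axis' algebra_simps diff_divide_distrib)
    finally show ?thesis .
  qed
  moreover have "(\<lambda>n. (cis (2 * pi * \<eta> $ j * s n) - 1) / of_real (s n) * ft1 \<phi> \<eta>)
      \<longlonglongrightarrow> 2 * pi * \<i> * of_real (\<eta> $ j) * ft1 \<phi> \<eta>"
  proof -
    let ?w = "2 * pi * \<i> * of_real (\<eta> $ j)"
    have "((\<lambda>z. exp (?w * z)) has_field_derivative ?w) (at 0)"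
      by (auto intro!: derivative_eq_intros)
    then have l: "((\<lambda>h. (exp (?w * (0 + h)) - exp (?w * 0)) / h) \<longlongrightarrow> ?w) (at 0)" by (simp only: DERIV_def)
    have "filterlim (\<lambda>n. complex_of_real (s n)) (at 0) sequentially"
      unfolding filterlim_at
    proof
      show "\<forall>\<^sub>F n in sequentially. complex_of_real (s n) \<in> UNIV \<and> complex_of_real (s n) \<noteq> 0"
        by (rule always_eventually) (use s(1) in \<open>simp add: less_imp_neq[symmetric]\<close>)
      show "(\<lambda>n. complex_of_real (s n)) \<longlonglongrightarrow> 0" using tendsto_of_real[OF s0, where 'a=complex] by simp
    qed
    from filterlim_compose[OF l this]
    have "(\<lambda>n. (cis (2 * pi * \<eta> $ j * s n) - 1) / of_real (s n)) \<longlonglongrightarrow> ?w"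
      by (simp add: cis_conv_exp mult_ac)
    then show ?thesis by (intro tendsto_intros)
  qed
  ultimately show ?thesis unfolding ft1_def[of "partial_deriv j \<phi>"] by (simp add: LIMSEQ_unique)
qed

text \<open>The Fourier multiplier of the partial derivative encoded by a list of directions.\<close>

definition deriv_symbol :: "'n list \<Rightarrow> real^'n \<Rightarrow> complex" where
  "deriv_symbol js \<eta> = prod_list (map (\<lambda>j. 2 * pi * \<i> * of_real (\<eta> $ j)) js)"

lemma ft1_partial_derivs:
  assumes t: "test_function \<phi>"
  shows "ft1 (partial_derivs js \<phi>) \<eta> = deriv_symbol js \<eta> * ft1 \<phi> \<eta>"
proof (induction js)
  case Nil
  show ?case by (simp add: partial_derivs_def deriv_symbol_def)
next
  case (Cons j js)
  have "ft1 (partial_derivs (j # js) \<phi>) \<eta> = ft1 (partial_deriv j (partial_derivs js \<phi>)) \<eta>"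
    by (simp add: partial_derivs_def)
  then show ?case
    unfolding ft1_partial_deriv[OF test_partial_derivs[OF t]] Cons.IH by (simp add: deriv_symbol_def)
qed

text \<open>A nonnegative bump supported in a ball of radius about \<open>1/k\<close> cannot see the oscillation of \<open>cis\<close> at
  frequencies much below \<open>k\<close>, so that its transform does not vanish there.\<close>

definition bump :: "nat \<Rightarrow> real^'n \<Rightarrow> real" where
  "bump k x = flat 0 ((1 / real (Suc k))\<^sup>2 - x \<bullet> x)"

lemma bump_test: "test_function (bump k)"
  unfolding bump_def[abs_def] by (rule bumps_test_function[OF bumps.base])

lemma bump_pos_iff: "0 < bump k x \<longleftrightarrow> norm x < 1 / real (Suc k)"
proof -
  have "norm x < 1 / real (Suc k) \<longleftrightarrow> (norm x)\<^sup>2 < (1 / real (Suc k))\<^sup>2"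
    by (metis abs_le_square_iff abs_norm_cancel abs_of_nonneg not_le of_nat_0_le_iff zero_le_divide_1_iff)
  then show ?thesis by (simp add: bump_def flat_def power2_norm_eq_inner)
qed

lemma ft1_bump_nonzero:
  fixes \<eta> :: "real^'n"
  obtains k where "ft1 (bump k) \<eta> \<noteq> 0"
proof -
  obtain k where k: "4 * norm \<eta> < real k" using reals_Archimedean2 by blast
  let ?f = "\<lambda>x. bump k x * cos (2 * pi * (x \<bullet> \<eta>))"
  have pos: "0 < ?f x" if x: "norm x < 1 / real (Suc k)" for x
  proof -
    have "\<bar>x \<bullet> \<eta>\<bar> \<le> norm x * norm \<eta>" by (rule Cauchy_Schwarz_ineq2)
    also have "\<dots> \<le> 1 / real (Suc k) * norm \<eta>" using x by (intro mult_right_mono) auto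
    also have "\<dots> < 1 / 4" using k by (simp add: field_simps)
    finally have "\<bar>2 * pi * (x \<bullet> \<eta>)\<bar> < pi / 2" by (simp add: abs_mult)
    then have "0 < cos (2 * pi * (x \<bullet> \<eta>))" by (intro cos_gt_zero_pi) linarith+
    then show ?thesis using x bump_pos_iff[of k x] by simp
  qed
  have zero: "?f x = 0" if "\<not> norm x < 1 / real (Suc k)" for x
    using that bump_pos_iff[of k x] flat_nonneg[of 0 "(1 / real (Suc k))\<^sup>2 - x \<bullet> x"] by (simp add: bump_def)
  have nn: "0 \<le> ?f x" for x using pos[of x] zero[of x] by (cases "norm x < 1 / real (Suc k)") auto
  have int: "integrable lborel (\<lambda>x::real^'n. complex_of_real (bump k x) * cis (- 2 * pi * (x \<bullet> \<eta>)))"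
    by (rule integrable_cis_mult[OF test_integrable(1)[OF bump_test]])
  have fRe: "?f x = Re (complex_of_real (bump k x) * cis (- 2 * pi * (x \<bullet> \<eta>)))" for x by simp
  have intf: "integrable lborel ?f" unfolding fRe by (rule integrable_Re[OF int])
  have "ft1 (bump k) \<eta> \<noteq> 0"
  proof
    assume "ft1 (bump k) \<eta> = 0"
    then have "(LINT x|lborel. ?f x) = 0"
      unfolding fRe ft1_def using integral_Re[OF int] by simp
    then have "AE x in lborel. ?f x = 0"
      using integral_nonneg_eq_0_iff_AE[OF intf] nn by simp
    then have "AE x in lborel. x \<notin> ball (0::real^'n) (1 / real (Suc k))"
    proof eventually_elim
      fix x assume "?f x = 0"
      then show "x \<notin> ball (0::real^'n) (1 / real (Suc k))" using pos[of x] by auto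
    qed
    then have "AE x in lebesgue. x \<notin> ball (0::real^'n) (1 / real (Suc k))" by (simp only: AE_completion_iff)
    then have "ball (0::real^'n) (1 / real (Suc k)) \<in> null_sets lebesgue"
      by (simp add: AE_iff_null_sets)
    then have "negligible (ball (0::real^'n) (1 / real (Suc k)))" by (simp add: negligible_iff_null_sets)
    then show False using open_not_negligible[OF open_ball, of "0::real^'n" "1 / real (Suc k)"] by simp
  qed
  then show ?thesis by (rule that)
qed

section \<open>Weak derivatives on the Fourier side\<close>

lemma deriv_symbol_measurable [measurable]: "deriv_symbol js \<in> borel_measurable borel"
proof (induction js)
  case (Cons j js)
  have "deriv_symbol (j # js) = (\<lambda>\<eta>. (2 * pi * \<i> * of_real (\<eta> $ j)) * deriv_symbol js \<eta>)" by (simp add: deriv_symbol_def fun_eq_iff)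
  then show ?case using Cons by simp
qed (simp add: deriv_symbol_def[abs_def])

lemma deriv_symbol_cnj: "cnj (deriv_symbol js \<eta>) = (-1) ^ length js * deriv_symbol js \<eta>"
  by (induction js) (simp_all add: deriv_symbol_def)

lemma deriv_symbol_reflect: "deriv_symbol js (- \<eta>) = cnj (deriv_symbol js \<eta>)"
  by (induction js) (simp_all add: deriv_symbol_def)

lemma norm_deriv_symbol: "norm (deriv_symbol js \<eta>) \<le> (2 * pi * norm \<eta>) ^ length js"
proof (induction js)
  case (Cons j js)
  have "norm (deriv_symbol (j # js) \<eta>) = (2 * pi * \<bar>\<eta> $ j\<bar>) * norm (deriv_symbol js \<eta>)"
    by (simp add: deriv_symbol_def norm_mult)
  also have "\<dots> \<le> (2 * pi * norm \<eta>) * (2 * pi * norm \<eta>) ^ length js"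
    by (intro mult_mono Cons mult_left_mono component_le_norm_cart) auto
  finally show ?case by simp
qed (simp add: deriv_symbol_def)

lemma L2_bounded_mult:
  fixes g :: "real^'n \<Rightarrow> complex"
  assumes g: "g \<in> L2" and b: "b \<in> borel_measurable borel" "\<And>x. norm (b x) \<le> C"
  shows "(\<lambda>x. b x * g x) \<in> L2" "L2norm (\<lambda>x. b x * g x) \<le> C * L2norm g"
proof -
  have [measurable]: "g \<in> borel_measurable borel" "b \<in> borel_measurable borel" using g b by auto
  have le: "norm (b x * g x) \<le> C * norm (g x)" for x
    unfolding norm_mult by (intro mult_right_mono b) auto
  have C: "0 \<le> C" using b(2)[of undefined] norm_ge_zero order_trans by blast
  show "(\<lambda>x. b x * g x) \<in> L2" by (rule L2_bound(1)[OF g _ le]) measurable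
  show "L2norm (\<lambda>x. b x * g x) \<le> C * L2norm g" by (rule L2_bound(2)[OF g _ le C]) measurable
qed

lemma ft1_norm:
  assumes t: "test_function \<phi>" shows "norm (ft1 \<phi> \<eta>) \<le> (LINT x|lborel. \<bar>\<phi> x\<bar>)"
  unfolding ft1_def
  by (rule order_trans[OF integral_norm_bound]) (simp add: norm_mult)

lemma ft1_measurable [measurable]:
  assumes t: "test_function \<phi>" shows "ft1 \<phi> \<in> borel_measurable borel"
proof -
  have [measurable]: "\<phi> \<in> borel_measurable borel" by (rule test_measurable[OF t])
  show ?thesis unfolding ft1_def[abs_def] by (rule borel_measurable_integral_lborel) measurable
qed

lemma ft1_L2:
  assumes t: "test_function \<phi>" shows "ft1 \<phi> \<in> L2"
proof -
  have c: "(\<lambda>x. complex_of_real (\<phi> x)) \<in> L2" using test_integrable(2)[OF t] by (simp add: L2_of_real)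
  have "integrable lborel (\<lambda>\<eta>. (norm (ft1 \<phi> \<eta>))\<^sup>2)"
  proof (rule integrable_cong_AE_imp[OF L2_integrable[OF fourier_L2[OF c]]])
    show "AE \<eta> in lborel. (norm (rfourier \<phi> \<eta>))\<^sup>2 = (norm (ft1 \<phi> \<eta>))\<^sup>2"
      using test_fourier[OF t] by eventually_elim simp
  qed (use ft1_measurable[OF t] in measurable)
  then show ?thesis using ft1_measurable[OF t] by (simp add: L2_iff)
qed

text \<open>The weak formulation on the Fourier side: Plancherel moves the pairing with a test function to
  the transforms.\<close>

lemma pair_test:
  assumes u: "u \<in> L2" and t: "test_function \<phi>"
  shows "complex_of_real (LINT x|lborel. u x * \<phi> x) = L2inner (rfourier u) (ft1 \<phi>)"
proof -
  have u': "(\<lambda>x. complex_of_real (u x)) \<in> L2" using u by (simp add: L2_of_real)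
  have c: "(\<lambda>x. complex_of_real (\<phi> x)) \<in> L2" using test_integrable(2)[OF t] by (simp add: L2_of_real)
  have "complex_of_real (LINT x|lborel. u x * \<phi> x) = L2inner (\<lambda>x. complex_of_real (u x)) (\<lambda>x. complex_of_real (\<phi> x))"
    unfolding L2inner_def by (simp flip: of_real_mult integral_complex_of_real)
  also have "\<dots> = L2inner (rfourier u) (rfourier \<phi>)" by (rule fourier_inner[OF u' c, symmetric])
  also have "\<dots> = L2inner (rfourier u) (ft1 \<phi>)"
    by (rule L2inner_cong_AE) (auto intro: fourier_L2 u' c ft1_L2[OF t] test_fourier[OF t])
  finally show ?thesis .
qed

lemma is_weak_deriv_fourierI:
  assumes u: "u \<in> L2" and v: "v \<in> L2" and eq: "AE \<eta> in lborel. rfourier v \<eta> = deriv_symbol js \<eta> * rfourier u \<eta>"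
  shows "is_weak_deriv js u v"
  unfolding is_weak_deriv_def
proof (intro allI impI)
  fix \<phi> :: "real^'a \<Rightarrow> real" assume t: "test_function \<phi>"
  note td = test_partial_derivs[OF t, of js]
  have u': "rfourier u \<in> L2" and v': "rfourier v \<in> L2" using u v by (auto intro!: fourier_L2 simp: L2_of_real)
  have m: "rfourier u \<in> borel_measurable borel" "rfourier v \<in> borel_measurable borel" "ft1 \<phi> \<in> borel_measurable borel"
    using u' v' ft1_measurable[OF t] by auto
  have "L2inner (rfourier u) (ft1 (partial_derivs js \<phi>)) = (LINT \<eta>|lborel. (-1) ^ length js * (rfourier v \<eta> * cnj (ft1 \<phi> \<eta>)))"
    unfolding L2inner_def
  proof (rule integral_cong_AE)
    show "AE \<eta> in lborel. rfourier u \<eta> * cnj (ft1 (partial_derivs js \<phi>) \<eta>) = (-1) ^ length js * (rfourier v \<eta> * cnj (ft1 \<phi> \<eta>))"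
      using eq by eventually_elim (simp add: ft1_partial_derivs[OF t] deriv_symbol_cnj)
  qed (use m ft1_measurable[OF td] in measurable)
  also have "\<dots> = (-1) ^ length js * L2inner (rfourier v) (ft1 \<phi>)"
    unfolding L2inner_def by (rule integral_mult_right_zero)
  finally have "complex_of_real (LINT x|lborel. u x * partial_derivs js \<phi> x)
      = complex_of_real ((-1) ^ length js * (LINT x|lborel. v x * \<phi> x))"
    unfolding pair_test[OF u td, symmetric] pair_test[OF v t, symmetric] by simp
  then show "(LINT x|lborel. u x * partial_derivs js \<phi> x) = (-1) ^ length js * (LINT x|lborel. v x * \<phi> x)"
    by (simp only: of_real_eq_iff)
qed

text \<open>For the converse, testing with all translates of \<open>\<phi>\<close> shows that the function
  \<open>(deriv_symbol js * rfourier u - rfourier v) * cnj (ft1 \<phi>)\<close> has Fourier transform zero.  It is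
  square-integrable because the transforms of \<open>\<phi>\<close> and of its derivatives are bounded, so it vanishes by
  Plancherel.  At every frequency some bump has \<open>ft1 \<phi> \<noteq> 0\<close>, and one can divide.\<close>

lemma is_weak_deriv_fourierD:
  fixes u v :: "real^'n \<Rightarrow> real"
  assumes u: "u \<in> L2" and v: "v \<in> L2" and w: "is_weak_deriv js u v"
  shows "AE \<eta> in lborel. rfourier v \<eta> = deriv_symbol js \<eta> * rfourier u \<eta>"
proof -
  have u': "rfourier u \<in> L2" and v': "rfourier v \<in> L2" using u v by (auto intro!: fourier_L2 simp: L2_of_real)
  have [measurable]: "rfourier u \<in> borel_measurable borel" "rfourier v \<in> borel_measurable borel"
    using u' v' by auto
  let ?s = "(-1) ^ length js :: complex"
  have key: "AE \<eta> in lborel. (deriv_symbol js \<eta> * rfourier u \<eta> - rfourier v \<eta>) * cnj (ft1 \<phi> \<eta>) = 0"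
    if t: "test_function \<phi>" for \<phi> :: "real^'n \<Rightarrow> real"
  proof -
    note td = test_partial_derivs[OF t, of js]
    have [measurable]: "ft1 \<phi> \<in> borel_measurable borel" by (rule ft1_measurable[OF t])
    have [measurable]: "ft1 (partial_derivs js \<phi>) \<in> borel_measurable borel" by (rule ft1_measurable[OF td])
    define h1 where "h1 \<eta> = rfourier u \<eta> * cnj (ft1 (partial_derivs js \<phi>) \<eta>)" for \<eta>
    define h2 where "h2 \<eta> = ?s * (rfourier v \<eta> * cnj (ft1 \<phi> \<eta>))" for \<eta>
    define h where "h \<eta> = h1 \<eta> - h2 \<eta>" for \<eta>
    have i: "integrable lborel h1" "integrable lborel h2"
      unfolding h1_def h2_def using L2_inner_integrable[OF u' ft1_L2[OF td]] L2_inner_integrable[OF v' ft1_L2[OF t]]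
      by auto
    have "(\<lambda>\<eta>. cnj (ft1 (partial_derivs js \<phi>) \<eta>) * rfourier u \<eta>) \<in> L2"
      by (rule L2_bounded_mult(1)[OF u', of _ "LINT x|lborel. \<bar>partial_derivs js \<phi> x\<bar>"])
        (use ft1_norm[OF td] in simp_all)
    moreover have "(\<lambda>\<eta>. cnj (ft1 \<phi> \<eta>) * rfourier v \<eta>) \<in> L2"
      by (rule L2_bounded_mult(1)[OF v', of _ "LINT x|lborel. \<bar>\<phi> x\<bar>"])
        (use ft1_norm[OF t] in simp_all)
    ultimately have hL2: "h \<in> L2"
      unfolding h_def h1_def h2_def by (intro L2_diff L2_cmult) (simp_all add: mult.commute)
    have hi: "integrable lborel h" unfolding h_def using i by auto
    have "(LINT \<eta>|lborel. h \<eta> * cis (- 2 * pi * (\<eta> \<bullet> a))) = 0" for a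
    proof -
      let ?c = "\<lambda>\<eta>. cis (- 2 * pi * (\<eta> \<bullet> a))"
      note ta = test_translate(1)[OF t, of a]
      note tda = test_partial_derivs[OF ta, of js]
      have e1: "L2inner (rfourier u) (ft1 (partial_derivs js (\<lambda>x. \<phi> (x + a)))) = (LINT \<eta>|lborel. h1 \<eta> * ?c \<eta>)"
        unfolding L2inner_def test_translate(2)[OF t] ft1_translate[OF td] h1_def
        by (rule arg_cong[where f="integral\<^sup>L lborel"]) (simp add: fun_eq_iff cis_cnj inner_commute mult_ac)
      have "L2inner (rfourier v) (ft1 (\<lambda>x. \<phi> (x + a))) = (LINT \<eta>|lborel. rfourier v \<eta> * cnj (ft1 \<phi> \<eta>) * ?c \<eta>)"
        unfolding L2inner_def ft1_translate[OF t]
        by (rule arg_cong[where f="integral\<^sup>L lborel"]) (simp add: fun_eq_iff cis_cnj inner_commute mult_ac)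
      then have e2: "?s * L2inner (rfourier v) (ft1 (\<lambda>x. \<phi> (x + a))) = (LINT \<eta>|lborel. h2 \<eta> * ?c \<eta>)"
        unfolding h2_def by (simp only: integral_mult_right_zero[symmetric] mult.assoc)
      have "(LINT x|lborel. u x * partial_derivs js (\<lambda>x. \<phi> (x + a)) x) = (-1) ^ length js * (LINT x|lborel. v x * \<phi> (x + a))"
        using w ta unfolding is_weak_deriv_def by blast
      then have "complex_of_real (LINT x|lborel. u x * partial_derivs js (\<lambda>x. \<phi> (x + a)) x)
          = ?s * complex_of_real (LINT x|lborel. v x * \<phi> (x + a))" by simp
      then have "(LINT \<eta>|lborel. h1 \<eta> * ?c \<eta>) = (LINT \<eta>|lborel. h2 \<eta> * ?c \<eta>)"
        unfolding pair_test[OF u tda] pair_test[OF v ta] e1 e2 .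
      moreover have "(LINT \<eta>|lborel. h \<eta> * ?c \<eta>) = (LINT \<eta>|lborel. h1 \<eta> * ?c \<eta>) - (LINT \<eta>|lborel. h2 \<eta> * ?c \<eta>)"
        unfolding h_def left_diff_distrib
        by (rule Bochner_Integration.integral_diff) (intro integrable_cis_mult i)+
      ultimately show ?thesis by simp
    qed
    then have "AE a in lborel. fourier h a = 0" using fourier_integrable[OF hL2 hi] by simp
    then have "L2norm h = 0" using fourier_norm[OF hL2] L2norm_eq_0[OF fourier_L2[OF hL2]] by simp
    then have "AE \<eta> in lborel. h \<eta> = 0" using L2norm_eq_0[OF hL2] by simp
    then show ?thesis
    proof eventually_elim
      fix \<eta> assume "h \<eta> = 0"
      then have "?s * ((deriv_symbol js \<eta> * rfourier u \<eta> - rfourier v \<eta>) * cnj (ft1 \<phi> \<eta>)) = 0"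
        unfolding h_def h1_def h2_def ft1_partial_derivs[OF t] by (simp add: deriv_symbol_cnj algebra_simps)
      then show "(deriv_symbol js \<eta> * rfourier u \<eta> - rfourier v \<eta>) * cnj (ft1 \<phi> \<eta>) = 0" by simp
    qed
  qed
  have "AE \<eta> in lborel. \<forall>k. (deriv_symbol js \<eta> * rfourier u \<eta> - rfourier v \<eta>) * cnj (ft1 (bump k) \<eta>) = 0"
    unfolding AE_all_countable using key[OF bump_test] by blast
  then show ?thesis
  proof eventually_elim
    fix \<eta> assume *: "\<forall>k. (deriv_symbol js \<eta> * rfourier u \<eta> - rfourier v \<eta>) * cnj (ft1 (bump k) \<eta>) = 0"
    obtain k where "ft1 (bump k) \<eta> \<noteq> 0" by (rule ft1_bump_nonzero)
    then show "rfourier v \<eta> = deriv_symbol js \<eta> * rfourier u \<eta>" using *[rule_format, of k] by simp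
  qed
qed

text \<open>In particular the choice made in \<^const>\<open>weak_deriv\<close> does not matter up to null sets.\<close>

lemma weak_deriv_fourier:
  assumes y: "y \<in> Hk k" and js: "length js \<le> k"
  shows "weak_deriv js y \<in> L2" "AE \<eta> in lborel. rfourier (weak_deriv js y) \<eta> = deriv_symbol js \<eta> * rfourier y \<eta>"
proof -
  have y2: "y \<in> L2" using y by (simp add: Hk_def)
  have "\<exists>v. v \<in> L2 \<and> is_weak_deriv js y v" using y js by (auto simp: Hk_def)
  then have w: "weak_deriv js y \<in> L2 \<and> is_weak_deriv js y (weak_deriv js y)"
    unfolding weak_deriv_def by (rule someI_ex)
  then show "weak_deriv js y \<in> L2" by blast
  show "AE \<eta> in lborel. rfourier (weak_deriv js y) \<eta> = deriv_symbol js \<eta> * rfourier y \<eta>"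
    using is_weak_deriv_fourierD[OF y2] w by blast
qed

subsection \<open>Real band-limited functions\<close>

lemma rfourier_reflect:
  fixes u :: "real^'n \<Rightarrow> real"
  assumes u: "u \<in> L2" shows "AE \<eta> in lborel. rfourier u (- \<eta>) = cnj (rfourier u \<eta>)"
proof -
  have "AE \<eta> in lborel. fourier (\<lambda>x. cnj (complex_of_real (u x))) \<eta> = cnj (rfourier u (- \<eta>))"
    using u by (intro fourier_cnj) (simp add: L2_of_real)
  then show ?thesis by eventually_elim simp
qed

text \<open>Conjugate symmetry of the coefficients makes the synthesized function and its conjugate have the
  same transform.\<close>

lemma real_synth:
  fixes g :: "real^'n \<Rightarrow> complex"
  assumes g: "g \<in> L2" and S: "S \<in> sets borel" "bounded S" "uminus ` S = S"
    and refl: "AE \<eta> in lborel. g (- \<eta>) = cnj (g \<eta>)"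
  defines "v \<equiv> \<lambda>x. Re (synth plane S g x)"
  shows "v \<in> L2" "AE x in lborel. complex_of_real (v x) = synth plane S g x"
    "AE \<eta> in lborel. rfourier v \<eta> = indicator S \<eta> *\<^sub>R g \<eta>"
proof -
  let ?F = "synth plane S g"
  note s = synth_plane[OF g S(1,2)]
  have iS: "indicator S (- \<eta>) = (indicator S \<eta> :: real)" for \<eta>
  proof -
    have "- \<eta> \<in> S \<longleftrightarrow> \<eta> \<in> S" using S(3) by (metis imageI minus_minus)
    then show ?thesis by (simp add: indicator_def)
  qed
  have "AE \<eta> in lborel. fourier ?F (- \<eta>) = indicator S (- \<eta>) *\<^sub>R g (- \<eta>)"
    using AE_lborel_scale[OF s(2), of "-1"] by simp
  with fourier_cnj[OF s(1)] s(2) refl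
  have "AE \<eta> in lborel. fourier (\<lambda>x. cnj (?F x)) \<eta> = fourier ?F \<eta>"
  proof eventually_elim
    case (elim \<eta>)
    then show ?case by (simp add: iS)
  qed
  then have "AE x in lborel. cnj (?F x) = ?F x" using fourier_eq_iff[OF L2_cnj[OF s(1)] s(1)] by blast
  then show r: "AE x in lborel. complex_of_real (v x) = ?F x"
    unfolding v_def by eventually_elim (simp add: complex_eq_iff)
  show v: "v \<in> L2" unfolding v_def by (rule L2_Re[OF s(1)])
  then have "AE \<eta> in lborel. rfourier v \<eta> = fourier ?F \<eta>"
    using r fourier_eq_iff[OF _ s(1), of "\<lambda>x. complex_of_real (v x)"] by (simp add: L2_of_real)
  then show "AE \<eta> in lborel. rfourier v \<eta> = indicator S \<eta> *\<^sub>R g \<eta>" using s(2) by eventually_elim simp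
qed

text \<open>On the bounded set \<open>K\<close> all Fourier multipliers of derivatives are bounded.\<close>

lemma band_limited_Hk:
  fixes z :: "real^'n \<Rightarrow> real"
  assumes z: "z \<in> L2" and K: "compact K" "uminus ` K = K" and supp: "fourier_supported_in K z"
  shows "z \<in> Hk k"
  unfolding Hk_def
proof (intro CollectI conjI z allI impI)
  fix js :: "'n list"
  have KS: "K \<in> sets borel" "bounded K" using K(1) by (auto simp: borel_compact compact_imp_bounded)
  have z': "rfourier z \<in> L2" using z by (auto intro!: fourier_L2 simp: L2_of_real)
  obtain R where R: "0 < R" "\<forall>x\<in>K. norm x \<le> R" using KS(2) unfolding bounded_pos by blast
  have [measurable]: "K \<in> sets borel" by (rule KS(1))
  let ?b = "\<lambda>\<eta>. indicator K \<eta> *\<^sub>R deriv_symbol js \<eta>"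
  have bb: "norm (?b \<eta>) \<le> (2 * pi * R) ^ length js" for \<eta>
  proof (cases "\<eta> \<in> K")
    case True
    have "norm (deriv_symbol js \<eta>) \<le> (2 * pi * norm \<eta>) ^ length js" by (rule norm_deriv_symbol)
    also have "\<dots> \<le> (2 * pi * R) ^ length js" using R True by (intro power_mono mult_left_mono) auto
    finally show ?thesis using True by simp
  qed (use R(1) in simp)
  let ?g = "\<lambda>\<eta>. ?b \<eta> * rfourier z \<eta>"
  have g: "?g \<in> L2" by (rule L2_bounded_mult(1)[OF z' _ bb]) measurable
  have refl: "AE \<eta> in lborel. ?g (- \<eta>) = cnj (?g \<eta>)"
    using rfourier_reflect[OF z]
  proof eventually_elim
    case (elim \<eta>)
    have "- \<eta> \<in> K \<longleftrightarrow> \<eta> \<in> K" using K(2) by (metis imageI minus_minus)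
    then show ?case using elim by (simp add: indicator_def deriv_symbol_reflect)
  qed
  let ?v = "\<lambda>x. Re (synth plane K ?g x)"
  note rs = real_synth[OF g KS K(2) refl]
  have "AE \<eta> in lborel. rfourier ?v \<eta> = deriv_symbol js \<eta> * rfourier z \<eta>"
    using rs(3) supp unfolding fourier_supported_in_def by eventually_elim (auto simp: indicator_def)
  then have "is_weak_deriv js z ?v" by (rule is_weak_deriv_fourierI[OF z rs(1)])
  then show "\<exists>v\<in>L2. is_weak_deriv js z v" using rs(1) by blast
qed

section \<open>The effective operator as a Fourier multiplier\<close>

lemma finite_index_lists: "finite {js :: 'n::finite list. length js = m}"
  using finite_lists_length_eq[of "UNIV :: 'n set" m] by simp

lemma deriv_symbol_eq: "deriv_symbol js \<eta> = (2 * pi * \<i>) ^ length js * of_real (prod_list (map (\<lambda>j. \<eta> $ j) js))"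
  by (induction js) (simp_all add: deriv_symbol_def)

text \<open>Even order makes the powers of the imaginary unit real; the sign cancels against the factor
  \<open>(-1)^k\<close> of the state equation.\<close>

lemma deriv_symbol_even:
  assumes "length js = 2 * k"
  shows "deriv_symbol js \<eta> = of_real ((-1) ^ k * (2 * pi) ^ (2 * k) * prod_list (map (\<lambda>j. \<eta> $ j) js))"
proof -
  have "(2 * pi * \<i>) ^ (2 * k) = of_real ((2 * pi) ^ (2 * k)) * (-1) ^ k"
    by (simp only: power_mult_distrib[of _ \<i>] power_mult[of \<i> 2 k] power2_i of_real_power)
  then show ?thesis unfolding deriv_symbol_eq assms by simp
qed

text \<open>In the energy the powers of the imaginary unit cancel because the two factors have equal order and
  one of them is conjugated.\<close>

lemma deriv_symbol_split:
  assumes js: "length js = 2 * k"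
  shows "deriv_symbol (take k js) \<eta> * cnj (deriv_symbol (drop k js) \<eta>)
    = of_real ((2 * pi) ^ (2 * k) * prod_list (map (\<lambda>j. \<eta> $ j) js))"
proof -
  have "deriv_symbol (take k js) \<eta> * deriv_symbol (drop k js) \<eta> = deriv_symbol js \<eta>"
    unfolding deriv_symbol_def prod_list.append[symmetric] map_append[symmetric] append_take_drop_id ..
  moreover have "length (drop k js) = k" using js by simp
  ultimately have "deriv_symbol (take k js) \<eta> * cnj (deriv_symbol (drop k js) \<eta>) = (-1) ^ k * deriv_symbol js \<eta>"
    unfolding deriv_symbol_cnj by (metis mult.left_commute)
  also have "\<dots> = of_real (((-1) ^ k * (-1) ^ k) * ((2 * pi) ^ (2 * k) * prod_list (map (\<lambda>j. \<eta> $ j) js)))"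
    unfolding deriv_symbol_even[OF js] by simp
  also have "(-1) ^ k * (-1) ^ k = (1 :: real)" by (simp flip: power_mult_distrib)
  finally show ?thesis by simp
qed

lemma prod_list_continuous: "continuous_on S (\<lambda>\<eta>::real^'n. prod_list (map (\<lambda>j. \<eta> $ j) js))"
  by (induction js) (auto intro!: continuous_intros)

lemma Psym_continuous: "continuous_on S (Psym T \<epsilon> M)"
  unfolding Psym_def[abs_def] tensor_apply_def
  by (intro continuous_intros prod_list_continuous)

lemma Psym_measurable [measurable]: "Psym T \<epsilon> M \<in> borel_measurable borel"
  by (rule borel_measurable_continuous_onI[OF Psym_continuous])

lemma tensor_apply_scale: "tensor_apply T k (t *\<^sub>R \<eta>) = t ^ (2 * k) * tensor_apply T k \<eta>"
proof -
  have h: "prod_list (map (\<lambda>j. (t *\<^sub>R \<eta>) $ j) js) = t ^ length js * prod_list (map (\<lambda>j. \<eta> $ j) js)" for js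
    by (induction js) simp_all
  show ?thesis
    unfolding tensor_apply_def sum_distrib_left h by (intro sum.cong) (simp_all add: mult_ac)
qed

text \<open>Along every ray \<open>1 + Psym\<close> is a polynomial with value \<open>1\<close> at the origin, so it has finitely many
  zeros there.  Integrating over dilations of its zero set shows that this set is null.\<close>

lemma Psym_plus_1_nonzero:
  fixes T :: "'n::finite tensors"
  shows "AE \<eta> in lborel. Psym T \<epsilon> M \<eta> + 1 \<noteq> 0"
proof -
  define N where "N = {\<eta>. Psym T \<epsilon> M \<eta> + 1 = 0}"
  have [measurable]: "N \<in> sets borel" unfolding N_def by measurable
  have fin: "finite {t. t *\<^sub>R \<eta> \<in> N}" for \<eta>
  proof -
    define p where "p = 1 + (\<Sum>k=1..M. monom (\<epsilon> ^ (2 * k - 2) * (2 * pi) ^ (2 * k) * tensor_apply T k \<eta>) (2 * k))"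
    have p: "poly p t = Psym T \<epsilon> M (t *\<^sub>R \<eta>) + 1" for t
      by (simp add: p_def Psym_def poly_sum poly_monom tensor_apply_scale mult_ac)
    have "poly p 0 = 1" by (auto simp: p_def poly_sum poly_monom intro!: sum.neutral)
    then have "p \<noteq> 0" by auto
    from poly_roots_finite[OF this] show ?thesis by (simp add: N_def p)
  qed
  have "(\<integral>\<^sup>+t. indicator {1..2} t * (\<integral>\<^sup>+\<eta>. indicator N (t *\<^sub>R \<eta>) \<partial>lborel) \<partial>(lborel :: real measure))
      = (\<integral>\<^sup>+t. \<integral>\<^sup>+\<eta>. indicator {1..2} t * indicator N (t *\<^sub>R \<eta>) \<partial>lborel \<partial>(lborel :: real measure))"
    by (intro nn_integral_cong nn_integral_cmult[symmetric]) measurable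
  also have "\<dots> = (\<integral>\<^sup>+\<eta>. \<integral>\<^sup>+t. indicator {1..2} t * indicator N (t *\<^sub>R \<eta>) \<partial>(lborel :: real measure) \<partial>lborel)"
    by (rule lborel_pair.Fubini') measurable
  also have "\<dots> = (\<integral>\<^sup>+\<eta>. 0 \<partial>(lborel :: (real^'n) measure))"
  proof (rule nn_integral_cong)
    fix \<eta> :: "real^'n"
    have "AE t in lborel. t \<notin> {t. t *\<^sub>R \<eta> \<in> N}"
      by (rule AE_not_in[OF finite_imp_null_set_lborel[OF fin]])
    then have "AE t in lborel. indicator {1..2} t * indicator N (t *\<^sub>R \<eta>) = (0 :: ennreal)"
      by eventually_elim (simp add: indicator_def)
    from nn_integral_cong_AE[OF this]
    show "(\<integral>\<^sup>+t. indicator {1..2} t * indicator N (t *\<^sub>R \<eta>) \<partial>(lborel :: real measure)) = 0" by simp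
  qed
  finally have "(\<integral>\<^sup>+t. indicator {1..2} t * (\<integral>\<^sup>+\<eta>. indicator N (t *\<^sub>R \<eta>) \<partial>lborel) \<partial>(lborel :: real measure)) = 0"
    by simp
  then have "AE t in (lborel :: real measure). indicator {1..2} t * (\<integral>\<^sup>+\<eta>. indicator N (t *\<^sub>R \<eta>) \<partial>lborel) = 0"
    by (rule iffD1[OF nn_integral_0_iff_AE, rotated]) measurable
  then have ae: "AE t in (lborel :: real measure). t \<in> {1..2} \<longrightarrow> (\<integral>\<^sup>+\<eta>. indicator N (t *\<^sub>R \<eta>) \<partial>lborel) = 0"
    by eventually_elim auto
  \<comment> \<open>one dilation with a null zero set suffices, since dilations preserve null sets\<close>
  have "\<exists>t\<in>{1..2::real}. (\<integral>\<^sup>+\<eta>. indicator N (t *\<^sub>R \<eta>) \<partial>lborel) = 0"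
  proof (rule ccontr)
    assume "\<not> ?thesis"
    with ae have "AE t in (lborel :: real measure). t \<notin> {1..2}" by (auto elim: eventually_mono)
    then have "{1..2::real} \<in> null_sets lborel" by (subst (asm) AE_iff_null_sets[symmetric]) auto
    then have "emeasure lborel {1..2::real} = 0" by (rule null_setsD1)
    then show False by simp
  qed
  then obtain t :: real where t: "t \<in> {1..2}" "(\<integral>\<^sup>+\<eta>. indicator N (t *\<^sub>R \<eta>) \<partial>lborel) = 0" by blast
  then have t0: "t \<noteq> 0" by auto
  have "(\<integral>\<^sup>+\<eta>. indicator N \<eta> \<partial>lborel) = 0"
    by (subst nn_integral_lborel_scale[OF _ t0]) (simp_all add: t(2))
  then have "N \<in> null_sets lborel" by (auto simp: null_sets_def)
  from AE_not_in[OF this] show ?thesis by eventually_elim (simp add: N_def)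
qed

lemma effective_operator_fourier:
  fixes T :: "'n::finite tensors" and y :: "real^'n \<Rightarrow> real" and \<epsilon> :: real
  assumes y: "y \<in> Hk (2 * M)"
  defines "G \<equiv> \<lambda>x. (\<Sum>k=1..M. \<epsilon> ^ (2 * k - 2) * (-1) ^ k * tensor_diff T k y x) + y x"
  shows "G \<in> L2" "AE \<eta> in lborel. rfourier G \<eta> = of_real (Psym T \<epsilon> M \<eta> + 1) * rfourier y \<eta>"
proof -
  have y2: "y \<in> L2" using y by (simp add: Hk_def)
  let ?I = "Sigma {1..M} (\<lambda>k. {js :: 'n list. length js = 2 * k})"
  define c where "c = (\<lambda>(k, js). \<epsilon> ^ (2 * k - 2) * (-1) ^ k * T k js)"
  define D where "D p = weak_deriv (snd p) y" for p :: "nat \<times> 'n list"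
  have fI: "finite ?I" by (intro finite_SigmaI finite_index_lists) simp
  have len: "length (snd p) \<le> 2 * M" if "p \<in> ?I" for p using that by auto
  have D: "D p \<in> L2" "AE \<eta> in lborel. rfourier (D p) \<eta> = deriv_symbol (snd p) \<eta> * rfourier y \<eta>" if "p \<in> ?I" for p
    unfolding D_def using weak_deriv_fourier[OF y len[OF that]] by auto
  have Geq: "G x = (\<Sum>p\<in>?I. c p * D p x) + y x" for x
  proof -
    have "(\<Sum>k=1..M. \<epsilon> ^ (2 * k - 2) * (-1) ^ k * tensor_diff T k y x)
        = (\<Sum>k\<in>{1..M}. \<Sum>js\<in>{js. length js = 2 * k}. c (k, js) * D (k, js) x)"
      by (rule sum.cong) (simp_all add: tensor_diff_def sum_distrib_left c_def D_def mult_ac)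
    also have "\<dots> = (\<Sum>p\<in>?I. c p * D p x)"
      by (subst sum.Sigma) (simp_all add: finite_index_lists split_def)
    finally show ?thesis by (simp add: G_def)
  qed
  show G: "G \<in> L2" unfolding Geq[abs_def] by (intro L2_add L2_sum L2_cmult D(1) y2)
  have D': "(\<lambda>x. complex_of_real (D p x)) \<in> L2" if "p \<in> ?I" for p using D(1)[OF that] by (simp add: L2_of_real)
  have y': "(\<lambda>x. complex_of_real (y x)) \<in> L2" using y2 by (simp add: L2_of_real)
  have Gc: "(\<lambda>x. complex_of_real (G x)) = (\<lambda>x. (\<Sum>p\<in>?I. of_real (c p) * of_real (D p x)) + of_real (y x))"
    by (simp add: Geq fun_eq_iff)
  have 1: "AE \<eta> in lborel. rfourier G \<eta> = fourier (\<lambda>x. \<Sum>p\<in>?I. complex_of_real (c p) * of_real (D p x)) \<eta> + rfourier y \<eta>"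
    unfolding Gc by (rule fourier_add[OF L2_sum[OF L2_cmult[OF D']] y'])
  have 2: "AE \<eta> in lborel. fourier (\<lambda>x. \<Sum>p\<in>?I. complex_of_real (c p) * of_real (D p x)) \<eta> = (\<Sum>p\<in>?I. of_real (c p) * rfourier (D p) \<eta>)"
    by (rule fourier_sum[OF fI D'])
  have 3: "AE \<eta> in lborel. \<forall>p\<in>?I. rfourier (D p) \<eta> = deriv_symbol (snd p) \<eta> * rfourier y \<eta>"
    by (rule AE_finite_allI[OF fI D(2)])
  from 1 2 3 show "AE \<eta> in lborel. rfourier G \<eta> = of_real (Psym T \<epsilon> M \<eta> + 1) * rfourier y \<eta>"
  proof eventually_elim
    case (elim \<eta>)
    have "(\<Sum>p\<in>?I. of_real (c p) * rfourier (D p) \<eta>) = (\<Sum>p\<in>?I. of_real (c p) * deriv_symbol (snd p) \<eta>) * rfourier y \<eta>"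
      unfolding sum_distrib_right using elim(3) by (intro sum.cong) (auto simp: mult_ac)
    also have "(\<Sum>p\<in>?I. of_real (c p) * deriv_symbol (snd p) \<eta>)
        = (\<Sum>k\<in>{1..M}. \<Sum>js\<in>{js. length js = 2 * k}. of_real (c (k, js)) * deriv_symbol js \<eta>)"
      by (subst sum.Sigma) (simp_all add: finite_index_lists split_def)
    also have "\<dots> = (\<Sum>k\<in>{1..M}. \<Sum>js\<in>{js. length js = 2 * k}.
        of_real (\<epsilon> ^ (2 * k - 2) * (2 * pi) ^ (2 * k) * (T k js * prod_list (map (\<lambda>j. \<eta> $ j) js))))"
    proof (intro sum.cong refl)
      fix k :: nat and js :: "'n list" assume "js \<in> {js. length js = 2 * k}"
      then have s: "deriv_symbol js \<eta> = of_real ((-1) ^ k * (2 * pi) ^ (2 * k) * prod_list (map (\<lambda>j. \<eta> $ j) js))"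
        by (intro deriv_symbol_even) simp
      have "c (k, js) * ((-1) ^ k * (2 * pi) ^ (2 * k) * prod_list (map (\<lambda>j. \<eta> $ j) js))
          = ((-1) ^ k * (-1) ^ k) * (\<epsilon> ^ (2 * k - 2) * (2 * pi) ^ (2 * k) * (T k js * prod_list (map (\<lambda>j. \<eta> $ j) js)))"
        by (simp add: c_def)
      also have "(-1) ^ k * (-1) ^ k = (1 :: real)" by (simp flip: power_mult_distrib)
      finally have "c (k, js) * ((-1) ^ k * (2 * pi) ^ (2 * k) * prod_list (map (\<lambda>j. \<eta> $ j) js))
          = \<epsilon> ^ (2 * k - 2) * (2 * pi) ^ (2 * k) * (T k js * prod_list (map (\<lambda>j. \<eta> $ j) js))" by simp
      then show "of_real (c (k, js)) * deriv_symbol js \<eta>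
          = of_real (\<epsilon> ^ (2 * k - 2) * (2 * pi) ^ (2 * k) * (T k js * prod_list (map (\<lambda>j. \<eta> $ j) js)))"
        unfolding s by (simp only: of_real_mult[symmetric])
    qed
    also have "\<dots> = of_real (Psym T \<epsilon> M \<eta>)"
      by (simp add: Psym_def tensor_apply_def sum_distrib_left)
    finally show ?case using elim(1,2) by (simp add: distrib_right)
  qed
qed

lemma state_equation_fourier:
  fixes T :: "'n::finite tensors" and y :: "real^'n \<Rightarrow> real"
  assumes y: "y \<in> Hk (2 * M)" and f: "f \<in> L2" and u: "u \<in> L2"
  shows "state_equation T \<epsilon> M f u y \<longleftrightarrow>
    (AE \<eta> in lborel. of_real (Psym T \<epsilon> M \<eta> + 1) * rfourier y \<eta> = rfourier f \<eta> + rfourier u \<eta>)"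
proof -
  let ?G = "\<lambda>x. (\<Sum>k=1..M. \<epsilon> ^ (2 * k - 2) * (-1) ^ k * tensor_diff T k y x) + y x"
  note G = effective_operator_fourier[OF y, of \<epsilon> T]
  have G': "(\<lambda>x. complex_of_real (?G x)) \<in> L2" using G(1) unfolding L2_of_real .
  have f': "(\<lambda>x. complex_of_real (f x)) \<in> L2" and u': "(\<lambda>x. complex_of_real (u x)) \<in> L2"
    using f u by (auto simp: L2_of_real)
  have "state_equation T \<epsilon> M f u y \<longleftrightarrow> (AE x in lborel. complex_of_real (?G x) = of_real (f x) + of_real (u x))"
    unfolding state_equation_def of_real_add[symmetric] of_real_eq_iff ..
  also have "\<dots> \<longleftrightarrow> (AE \<eta> in lborel. rfourier ?G \<eta> = fourier (\<lambda>x. of_real (f x) + of_real (u x)) \<eta>)"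
    by (rule fourier_eq_iff[OF G' L2_add[OF f' u'], symmetric])
  also have "\<dots> \<longleftrightarrow> (AE \<eta> in lborel. of_real (Psym T \<epsilon> M \<eta> + 1) * rfourier y \<eta> = rfourier f \<eta> + rfourier u \<eta>)"
    (is "?L \<longleftrightarrow> ?R")
  proof
    assume ?L with G(2) fourier_add[OF f' u'] show ?R by eventually_elim simp
  next
    assume ?R with G(2) fourier_add[OF f' u'] show ?L by eventually_elim simp
  qed
  finally show ?thesis .
qed

text \<open>Plancherel, applied to each product of two weak derivatives.  The total symbol is that of the
  operator of the state equation.\<close>

lemma E_star_fourier:
  fixes T :: "'n::finite tensors" and z :: "real^'n \<Rightarrow> real"
  assumes z: "z \<in> Hk M"
  shows "E_star T \<epsilon> M z = (LINT \<eta>|lborel. (Psym T \<epsilon> M \<eta> + 1) * (norm (rfourier z \<eta>))\<^sup>2)"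
proof -
  have z2: "z \<in> L2" using z by (simp add: Hk_def)
  have z': "rfourier z \<in> L2" using z2 by (auto intro!: fourier_L2 simp: L2_of_real)
  let ?I = "Sigma {1..M} (\<lambda>k. {js :: 'n list. length js = 2 * k})"
  define c where "c = (\<lambda>(k, js). \<epsilon> ^ (2 * k - 2) * T k js)"
  define D where "D = (\<lambda>(k, js) x. weak_deriv (take k js) z x * weak_deriv (drop k js) z x)"
  define S where "S = (\<lambda>(k, js) \<eta>::real^'n. (2 * pi) ^ (2 * k) * prod_list (map (\<lambda>j. \<eta> $ j) js) * (norm (rfourier z \<eta>))\<^sup>2)"
  have fI: "finite ?I" by (intro finite_SigmaI finite_index_lists) simp
  have DS: "integrable lborel (D p) \<and> integrable lborel (S p) \<and> (LINT x|lborel. D p x) = (LINT \<eta>|lborel. S p \<eta>)"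
    if p: "p \<in> ?I" for p
  proof -
    obtain k js where kj: "p = (k, js)" "k \<le> M" "length js = 2 * k" using p by auto
    let ?a = "weak_deriv (take k js) z" and ?b = "weak_deriv (drop k js) z"
    have a: "?a \<in> L2" "AE \<eta> in lborel. rfourier ?a \<eta> = deriv_symbol (take k js) \<eta> * rfourier z \<eta>"
      using weak_deriv_fourier[OF z, of "take k js"] kj by auto
    have b: "?b \<in> L2" "AE \<eta> in lborel. rfourier ?b \<eta> = deriv_symbol (drop k js) \<eta> * rfourier z \<eta>"
      using weak_deriv_fourier[OF z, of "drop k js"] kj by auto
    have a': "(\<lambda>x. complex_of_real (?a x)) \<in> L2" and b': "(\<lambda>x. complex_of_real (?b x)) \<in> L2"
      using a(1) b(1) by (auto simp: L2_of_real)
    have iD: "integrable lborel (D p)" unfolding kj(1) D_def by (simp add: L2_mult_integrable a(1) b(1))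
    have i: "integrable lborel (\<lambda>\<eta>. rfourier ?a \<eta> * cnj (rfourier ?b \<eta>))"
      by (rule L2_inner_integrable[OF fourier_L2[OF a'] fourier_L2[OF b']])
    have ae: "AE \<eta> in lborel. rfourier ?a \<eta> * cnj (rfourier ?b \<eta>) = complex_of_real (S p \<eta>)"
      using a(2) b(2)
    proof eventually_elim
      case (elim \<eta>)
      have "rfourier ?a \<eta> * cnj (rfourier ?b \<eta>) = (deriv_symbol (take k js) \<eta> * cnj (deriv_symbol (drop k js) \<eta>)) * (rfourier z \<eta> * cnj (rfourier z \<eta>))"
        unfolding elim by (simp add: mult_ac)
      also have "\<dots> = complex_of_real (S p \<eta>)"
        unfolding deriv_symbol_split[OF kj(3)] complex_norm_square[symmetric] kj(1) S_def by simp
      finally show ?case .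
    qed
    have [measurable]: "rfourier z \<in> borel_measurable borel" using z' by auto
    have pm [measurable]: "(\<lambda>\<eta>::real^'n. prod_list (map (\<lambda>j. \<eta> $ j) js)) \<in> borel_measurable borel"
      by (rule borel_measurable_continuous_onI[OF prod_list_continuous])
    have Sm [measurable]: "S p \<in> borel_measurable borel" unfolding kj(1) S_def by simp
    have iS: "integrable lborel (\<lambda>\<eta>. complex_of_real (S p \<eta>))"
      by (rule integrable_cong_AE_imp[OF i _ ae]) measurable
    have "complex_of_real (LINT x|lborel. D p x) = L2inner (\<lambda>x. complex_of_real (?a x)) (\<lambda>x. complex_of_real (?b x))"
      unfolding L2inner_def kj(1) D_def by (simp flip: of_real_mult integral_complex_of_real)
    also have "\<dots> = L2inner (rfourier ?a) (rfourier ?b)" by (rule fourier_inner[OF a' b', symmetric])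
    also have "\<dots> = (LINT \<eta>|lborel. complex_of_real (S p \<eta>))"
      unfolding L2inner_def by (rule integral_cong_AE) (use i iS ae in auto)
    also have "\<dots> = complex_of_real (LINT \<eta>|lborel. S p \<eta>)" by (rule integral_complex_of_real)
    finally have "(LINT x|lborel. D p x) = (LINT \<eta>|lborel. S p \<eta>)" by (simp only: of_real_eq_iff)
    moreover have "integrable lborel (S p)" using iS by (simp only: complex_of_real_integrable_eq)
    ultimately show ?thesis using iD by blast
  qed
  have iz: "integrable lborel (\<lambda>x. (norm (z x))\<^sup>2)" "integrable lborel (\<lambda>\<eta>. (norm (rfourier z \<eta>))\<^sup>2)"
    by (rule L2_integrable[OF z2], rule L2_integrable[OF z'])
  have "(\<Sum>k=1..M. \<epsilon> ^ (2 * k - 2) * tensor_energy T k z x) = (\<Sum>p\<in>?I. c p * D p x)" for x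
  proof -
    have "(\<Sum>k=1..M. \<epsilon> ^ (2 * k - 2) * tensor_energy T k z x)
        = (\<Sum>k\<in>{1..M}. \<Sum>js\<in>{js. length js = 2 * k}. c (k, js) * D (k, js) x)"
      by (rule sum.cong) (simp_all add: tensor_energy_def sum_distrib_left c_def D_def mult_ac)
    also have "\<dots> = (\<Sum>p\<in>?I. c p * D p x)"
      by (subst sum.Sigma) (simp_all add: finite_index_lists split_def)
    finally show ?thesis .
  qed
  then have "E_star T \<epsilon> M z = (LINT x|lborel. (\<Sum>p\<in>?I. c p * D p x) + (norm (z x))\<^sup>2)"
    by (simp add: E_star_def)
  also have "\<dots> = (\<Sum>p\<in>?I. c p * (LINT x|lborel. D p x)) + (LINT x|lborel. (norm (z x))\<^sup>2)"
    using DS iz by (subst Bochner_Integration.integral_add) auto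
  also have "\<dots> = (\<Sum>p\<in>?I. c p * (LINT \<eta>|lborel. S p \<eta>)) + (LINT \<eta>|lborel. (norm (rfourier z \<eta>))\<^sup>2)"
  proof -
    have "(LINT x|lborel. (norm (z x))\<^sup>2) = (L2norm (\<lambda>x. complex_of_real (z x)))\<^sup>2" by (simp add: L2norm_power2)
    also have "\<dots> = (LINT \<eta>|lborel. (norm (rfourier z \<eta>))\<^sup>2)"
      using fourier_norm[of "\<lambda>x. complex_of_real (z x)"] z2 by (simp add: L2_of_real flip: L2norm_power2)
    finally show ?thesis using DS by simp
  qed
  also have "\<dots> = (LINT \<eta>|lborel. (\<Sum>p\<in>?I. c p * S p \<eta>) + (norm (rfourier z \<eta>))\<^sup>2)"
    using DS iz by (subst Bochner_Integration.integral_add) auto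
  also have "\<dots> = (LINT \<eta>|lborel. (Psym T \<epsilon> M \<eta> + 1) * (norm (rfourier z \<eta>))\<^sup>2)"
  proof (rule arg_cong[where f="integral\<^sup>L lborel"], rule ext)
    fix \<eta>
    have "(\<Sum>p\<in>?I. c p * S p \<eta>) = (\<Sum>k\<in>{1..M}. \<Sum>js\<in>{js. length js = 2 * k}. c (k, js) * S (k, js) \<eta>)"
      by (subst sum.Sigma) (simp_all add: finite_index_lists split_def)
    also have "\<dots> = Psym T \<epsilon> M \<eta> * (norm (rfourier z \<eta>))\<^sup>2"
      by (simp add: Psym_def tensor_apply_def sum_distrib_left sum_distrib_right c_def S_def mult_ac)
    finally show "(\<Sum>p\<in>?I. c p * S p \<eta>) + (norm (rfourier z \<eta>))\<^sup>2 = (Psym T \<epsilon> M \<eta> + 1) * (norm (rfourier z \<eta>))\<^sup>2"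
      by (simp add: distrib_right)
  qed
  finally show ?thesis .
qed

section \<open>Minimization of strictly convex functionals\<close>

lemma L2_parallelogram:
  fixes a b :: "real^'n \<Rightarrow> 'b::{real_inner,banach,second_countable_topology}"
  assumes "a \<in> L2" "b \<in> L2"
  shows "(L2norm (\<lambda>x. (1/2) *\<^sub>R (a x + b x)))\<^sup>2 + (L2norm (\<lambda>x. (1/2) *\<^sub>R (a x - b x)))\<^sup>2
    = ((L2norm a)\<^sup>2 + (L2norm b)\<^sup>2) / 2"
proof -
  note i = L2_integrable[OF L2_scaleR[OF L2_add[OF assms], of "1/2"]] L2_integrable[OF L2_scaleR[OF L2_diff[OF assms], of "1/2"]]
    assms[THEN L2_integrable]
  have "(norm ((1/2) *\<^sub>R (p + q)))\<^sup>2 + (norm ((1/2) *\<^sub>R (p - q)))\<^sup>2 = ((norm p)\<^sup>2 + (norm q)\<^sup>2) / 2" for p q :: 'b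
    by (simp add: power2_norm_eq_inner inner_add_left inner_add_right inner_diff_left inner_diff_right inner_commute field_simps)
  then have "(LINT x|lborel. (norm ((1/2) *\<^sub>R (a x + b x)))\<^sup>2 + (norm ((1/2) *\<^sub>R (a x - b x)))\<^sup>2)
      = (LINT x|lborel. ((norm (a x))\<^sup>2 + (norm (b x))\<^sup>2) / 2)" by (simp only:)
  then show ?thesis unfolding L2norm_power2
    by (subst (asm) Bochner_Integration.integral_add[OF i(1,2)]) (use i(3,4) in simp)
qed

text \<open>The quantitative convexity \<open>conv\<close> bounds the distance of two almost minimizers, so that minimizing
  sequences are Cauchy and minimizers are unique.\<close>

lemma L2_strictly_convex_minimizer:
  fixes C :: "(real^'n \<Rightarrow> real) set" and j :: "(real^'n \<Rightarrow> real) \<Rightarrow> real"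
  assumes ne: "C \<noteq> {}" and sub: "C \<subseteq> L2" and closed: "L2_closed C" and \<kappa>: "0 < \<kappa>"
    and mid: "\<And>u v. u \<in> C \<Longrightarrow> v \<in> C \<Longrightarrow> (\<lambda>x. (1/2) *\<^sub>R (u x + v x)) \<in> C"
    and nonneg: "\<And>u. u \<in> C \<Longrightarrow> 0 \<le> j u"
    and conv: "\<And>u v. u \<in> C \<Longrightarrow> v \<in> C \<Longrightarrow>
      j (\<lambda>x. (1/2) *\<^sub>R (u x + v x)) + \<kappa> * (L2norm (\<lambda>x. u x - v x))\<^sup>2 \<le> (j u + j v) / 2"
    and cont: "\<And>u v. (\<And>n::nat. u n \<in> C) \<Longrightarrow> v \<in> C \<Longrightarrow> (\<lambda>n. L2norm (\<lambda>x. u n x - v x)) \<longlonglongrightarrow> 0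
      \<Longrightarrow> (\<lambda>n. j (u n)) \<longlonglongrightarrow> j v"
  obtains u where "u \<in> C" "\<And>v. v \<in> C \<Longrightarrow> j u \<le> j v"
    "\<And>v. v \<in> C \<Longrightarrow> j v \<le> j u \<Longrightarrow> AE x in lborel. v x = u x"
proof -
  let ?m = "Inf (j ` C)"
  have bdd: "bdd_below (j ` C)" using nonneg by (intro bdd_belowI2[of _ 0]) auto
  have m: "?m \<le> j u" if "u \<in> C" for u using that bdd by (intro cInf_lower) auto
  have "\<exists>u\<in>C. j u < ?m + 1 / real (Suc n)" for n
  proof -
    have "?m < ?m + 1 / real (Suc n)" by simp
    from cInf_lessD[OF _ this] show ?thesis using ne by auto
  qed
  then obtain u where u: "\<And>n. u n \<in> C" "\<And>n. j (u n) < ?m + 1 / real (Suc n)" by metis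
  have uL: "u n \<in> L2" for n using u(1) sub by blast
  have gap: "\<kappa> * (L2norm (\<lambda>x. u p x - u q x))\<^sup>2 \<le> 1 / real (Suc N)" if "p \<ge> N" "q \<ge> N" for p q N
  proof -
    have le: "1 / real (Suc p) \<le> 1 / real (Suc N)" "1 / real (Suc q) \<le> 1 / real (Suc N)"
      using that by (auto simp: frac_le)
    have arith: "X \<le> e" if "a + X \<le> (c + d) / 2" "i \<le> a" "c < i + e1" "d < i + e2" "e1 \<le> e" "e2 \<le> e"
      for X a c d i e e1 e2 :: real
      using that by argo
    show ?thesis
      by (rule arith[OF conv[OF u(1) u(1)] m[OF mid[OF u(1) u(1)]] u(2) u(2) le])
  qed
  have cau: "\<exists>N. \<forall>p\<ge>N. \<forall>q\<ge>N. L2norm (\<lambda>x. u p x - u q x) \<le> e" if e: "0 < e" for e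
  proof -
    obtain N where N: "1 / real (Suc N) < \<kappa> * e\<^sup>2"
      using reals_Archimedean[of "\<kappa> * e\<^sup>2"] \<kappa> e by (auto simp: inverse_eq_divide)
    have "L2norm (\<lambda>x. u p x - u q x) \<le> e" if "p \<ge> N" "q \<ge> N" for p q
    proof (rule power2_le_imp_le)
      have "\<kappa> * (L2norm (\<lambda>x. u p x - u q x))\<^sup>2 \<le> \<kappa> * e\<^sup>2" using gap[OF that] N by linarith
      then show "(L2norm (\<lambda>x. u p x - u q x))\<^sup>2 \<le> e\<^sup>2" using \<kappa> by simp
    qed (use e in simp)
    then show ?thesis by blast
  qed
  obtain v where v: "v \<in> L2" "(\<lambda>n. L2norm (\<lambda>x. u n x - v x)) \<longlonglongrightarrow> 0"
    using L2_complete[OF uL cau] by blast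
  have "L2_tendsto UNIV u v sequentially" by (rule iffD2[OF L2_tendsto_iff[OF uL v(1)] v(2)])
  then have vC: "v \<in> C" using closed u(1) v(1) unfolding L2_closed_def by blast
  have "j v \<le> ?m"
  proof (rule tendsto_le[OF sequentially_bot _ cont[OF u(1) vC v(2)]])
    show "(\<lambda>n. ?m + 1 / real (Suc n)) \<longlonglongrightarrow> ?m"
      using tendsto_add[OF tendsto_const[of ?m] LIMSEQ_inverse_real_of_nat] by (simp add: inverse_eq_divide)
    show "\<forall>\<^sub>F n in sequentially. j (u n) \<le> ?m + 1 / real (Suc n)"
      using u(2) by (intro always_eventually allI less_imp_le)
  qed
  then have vm: "j v \<le> j z" if "z \<in> C" for z using m[OF that] by linarith
  have "AE x in lborel. z x = v x" if z: "z \<in> C" "j z \<le> j v" for z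
  proof -
    have arith: "X \<le> 0" if "a + X \<le> (c + d) / 2" "d \<le> a" "c \<le> d" for X a c d :: real
      using that by argo
    have "\<kappa> * (L2norm (\<lambda>x. z x - v x))\<^sup>2 \<le> 0"
      by (rule arith[OF conv[OF z(1) vC] vm[OF mid[OF z(1) vC]] z(2)])
    then have "(L2norm (\<lambda>x. z x - v x))\<^sup>2 \<le> 0" using \<kappa> by (simp add: mult_le_0_iff)
    then have "L2norm (\<lambda>x. z x - v x) = 0" by simp
    then show ?thesis using L2norm_diff_eq_0[of z v] z(1) v(1) sub by blast
  qed
  with vC vm show ?thesis by (rule that)
qed

lemma rfourier_L2: "u \<in> L2 \<Longrightarrow> rfourier u \<in> L2"
  by (rule fourier_L2) (simp add: L2_of_real)

lemma rfourier_measurable [measurable_dest]: "u \<in> L2 \<Longrightarrow> rfourier u \<in> borel_measurable borel"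
  by (rule L2_measurable[OF rfourier_L2])

lemma rfourier_norm_diff:
  assumes u: "u \<in> L2" and v: "v \<in> L2"
  shows "L2norm (\<lambda>\<eta>. rfourier u \<eta> - rfourier v \<eta>) = L2norm (\<lambda>x. u x - v x)"
proof -
  have "L2norm (\<lambda>\<eta>. rfourier u \<eta> - rfourier v \<eta>) = L2norm (\<lambda>x. complex_of_real (u x) - complex_of_real (v x))"
    by (rule fourier_norm_diff) (simp_all add: u v L2_of_real)
  also have "\<dots> = L2norm (\<lambda>x. u x - v x)"
    by (rule L2norm_cong) (simp flip: of_real_diff)
  finally show ?thesis .
qed

lemma rfourier_diff:
  assumes u: "u \<in> L2" and v: "v \<in> L2"
  shows "AE \<eta> in lborel. rfourier (\<lambda>x. u x - v x) \<eta> = rfourier u \<eta> - rfourier v \<eta>"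
  using fourier_diff[of "\<lambda>x. complex_of_real (u x)" "\<lambda>x. complex_of_real (v x)"] u v by (simp add: L2_of_real)

lemma rfourier_mid:
  assumes u: "u \<in> L2" and v: "v \<in> L2"
  shows "AE \<eta> in lborel. rfourier (\<lambda>x. (1/2) *\<^sub>R (u x + v x)) \<eta> = (1/2) *\<^sub>R (rfourier u \<eta> + rfourier v \<eta>)"
proof -
  have u': "(\<lambda>x. complex_of_real (u x)) \<in> L2" and v': "(\<lambda>x. complex_of_real (v x)) \<in> L2" using u v by (simp_all add: L2_of_real)
  have eq: "(\<lambda>x. complex_of_real ((1/2) *\<^sub>R (u x + v x))) = (\<lambda>x. (1/2) * (of_real (u x) + of_real (v x)))"
    by (simp add: fun_eq_iff)
  from fourier_cmult[OF L2_add[OF u' v'], of "1/2"] fourier_add[OF u' v']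
  show ?thesis unfolding eq by eventually_elim (simp add: scaleR_conv_of_real)
qed

lemma rfourier_eq_iff:
  assumes u: "u \<in> L2" and v: "v \<in> L2"
  shows "(AE \<eta> in lborel. rfourier u \<eta> = rfourier v \<eta>) \<longleftrightarrow> (AE x in lborel. u x = v x)"
  using fourier_eq_iff[of "\<lambda>x. complex_of_real (u x)" "\<lambda>x. complex_of_real (v x)"] u v by (simp add: L2_of_real)

text \<open>Each tracking term of the reduced functional is the squared norm of an affine function of the
  transform of the control.\<close>

lemma affine_square:
  fixes w h :: "real^'n \<Rightarrow> complex"
  assumes w: "w \<in> borel_measurable borel" "\<And>\<eta>. norm (w \<eta>) \<le> 1" and h: "h \<in> L2"
  defines "A \<equiv> \<lambda>u \<eta>. w \<eta> * rfourier u \<eta> + h \<eta>"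
  shows affine_square_mid: "u \<in> L2 \<Longrightarrow> v \<in> L2 \<Longrightarrow>
      (L2norm (A (\<lambda>x. (1/2) *\<^sub>R (u x + v x))))\<^sup>2 \<le> ((L2norm (A u))\<^sup>2 + (L2norm (A v))\<^sup>2) / 2"
    and affine_square_tendsto: "(\<And>n. s n \<in> L2) \<Longrightarrow> v \<in> L2 \<Longrightarrow> (\<lambda>n. L2norm (\<lambda>x. s n x - v x)) \<longlonglongrightarrow> 0
      \<Longrightarrow> (\<lambda>n. (L2norm (A (s n)))\<^sup>2) \<longlonglongrightarrow> (L2norm (A v))\<^sup>2"
proof -
  have A: "A u \<in> L2" if "u \<in> L2" for u
    unfolding A_def by (intro L2_add h L2_bounded_mult(1)[OF rfourier_L2[OF that] w])
  {
    assume u: "u \<in> L2" and v: "v \<in> L2"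
    let ?m = "\<lambda>x. (1/2) *\<^sub>R (u x + v x)"
    have m: "?m \<in> L2" by (intro L2_scaleR L2_add u v)
    have "AE \<eta> in lborel. A ?m \<eta> = (1/2) *\<^sub>R (A u \<eta> + A v \<eta>)"
      using rfourier_mid[OF u v] by eventually_elim (simp add: A_def scaleR_conv_of_real algebra_simps)
    then have eq: "L2norm (A ?m) = L2norm (\<lambda>\<eta>. (1/2) *\<^sub>R (A u \<eta> + A v \<eta>))"
      by (intro L2norm_cong_AE A m L2_scaleR L2_add u v)
    have arith: "a \<le> c" if "a + b = c" "0 \<le> b" for a b c :: real using that by linarith
    show "(L2norm (A ?m))\<^sup>2 \<le> ((L2norm (A u))\<^sup>2 + (L2norm (A v))\<^sup>2) / 2"
      unfolding eq by (rule arith[OF L2_parallelogram[OF A[OF u] A[OF v]] zero_le_power2])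
  next
    assume s: "\<And>n. s n \<in> L2" and v: "v \<in> L2" and lim: "(\<lambda>n. L2norm (\<lambda>x. s n x - v x)) \<longlonglongrightarrow> 0"
    have "L2norm (\<lambda>\<eta>. A (s n) \<eta> - A v \<eta>) \<le> L2norm (\<lambda>x. s n x - v x)" for n
    proof -
      have "(\<lambda>\<eta>. A (s n) \<eta> - A v \<eta>) = (\<lambda>\<eta>. w \<eta> * (rfourier (s n) \<eta> - rfourier v \<eta>))"
        by (simp add: A_def fun_eq_iff algebra_simps)
      then show ?thesis
        using L2_bounded_mult(2)[OF L2_diff[OF rfourier_L2[OF s] rfourier_L2[OF v]] w, of n]
          rfourier_norm_diff[OF s v, of n] by simp
    qed
    then have "(\<lambda>n. L2norm (\<lambda>\<eta>. A (s n) \<eta> - A v \<eta>)) \<longlonglongrightarrow> 0" by (rule L2norm_squeeze[OF _ lim])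
    from L2norm_tendsto[OF A[OF s] A[OF v] this]
    show "(\<lambda>n. (L2norm (A (s n)))\<^sup>2) \<longlonglongrightarrow> (L2norm (A v))\<^sup>2" by (rule tendsto_power)
  }
qed

section \<open>Bloch waves of the lowest band\<close>

lemma AE_Ycell_Qcell: "AE x in lborel. x \<in> (Ycell :: (real^'n) set) \<longleftrightarrow> x \<in> Qcell"
proof -
  let ?C = "cbox (\<chi> i. 0) (\<chi> i. 1) :: (real^'n) set" and ?B = "box (\<chi> i. 0) (\<chi> i. 1) :: (real^'n) set"
  have "AE x in lebesgue. x \<notin> ?C - ?B"
    using negligible_frontier_interval[of "\<chi> i. 0" "\<chi> i. 1 :: real^'n"]
    unfolding negligible_iff_null_sets by (rule AE_not_in)
  then have "AE x in lborel. x \<notin> ?C - ?B" by (simp only: AE_completion_iff)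
  then show ?thesis
  proof eventually_elim
    case (elim x)
    then show ?case by (auto simp: mem_box_cart Ycell_def Qcell_def less_imp_le)
  qed
qed

lemma Ycell_sets [measurable]: "Ycell \<in> sets borel"
  unfolding Ycell_def by measurable

text \<open>For a fixed frequency \<open>\<Phi> 0\<close> is periodic and, as a member of an orthonormal basis, normalized on the
  cell \<open>Ycell\<close>, which differs from the half-open cell by a null set.\<close>

lemma isometric_kernel_bloch_wave:
  assumes b: "bloch_system A lam \<Phi>" and \<epsilon>: "0 < \<epsilon>"
  shows "isometric_kernel (bloch_wave \<Phi> \<epsilon> 0) (Zscaled \<epsilon>)"
proof -
  have "set_borel_measurable borel (UNIV \<times> Zcell) (\<lambda>(y, \<eta>). \<Phi> 0 y \<eta>)"
    using b unfolding bloch_system_def by blast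
  then have m: "(\<lambda>(y, \<eta>). indicator Zcell \<eta> *\<^sub>R \<Phi> 0 y \<eta>) \<in> borel_measurable (borel \<Otimes>\<^sub>M borel)"
    unfolding set_borel_measurable_def borel_prod by (simp add: split_def indicator_times)
  have onb: "per_orthonormal_basis (\<lambda>m y. \<Phi> m y \<eta>)" if "\<eta> \<in> Zcell" for \<eta>
    using b that unfolding bloch_system_def by blast
  have "isometric_kernel (\<lambda>x \<eta>. \<Phi> 0 x \<eta> * cis (2 * pi * (\<eta> \<bullet> x))) Zcell"
  proof (rule isometric_kernel_modulated[OF m])
    fix \<eta> :: "real^'a" assume \<eta>: "\<eta> \<in> Zcell"
    let ?p = "\<lambda>y. \<Phi> 0 y \<eta>"
    have p: "?p \<in> L2_per" "per_inner ?p ?p = 1" using onb[OF \<eta>] unfolding per_orthonormal_basis_def by auto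
    show "Y_periodic ?p" using p(1) by (simp add: L2_per_def)
    have i: "integrable lborel (\<lambda>y. indicator Ycell y * (norm (?p y))\<^sup>2)" and [measurable]: "?p \<in> borel_measurable borel"
      using p(1) by (auto simp: L2_per_def L2_on_def set_integrable_def)
    have "1 = (LINT y|lborel. complex_of_real (indicator Ycell y * (norm (?p y))\<^sup>2))"
      unfolding p(2)[symmetric] per_inner_def set_lebesgue_integral_def
      by (rule arg_cong[where f="integral\<^sup>L lborel"]) (simp add: fun_eq_iff complex_norm_square[symmetric] scaleR_conv_of_real)
    then have "complex_of_real (LINT y|lborel. indicator Ycell y * (norm (?p y))\<^sup>2) = 1"
      by (simp only: integral_complex_of_real)
    then have 1: "(LINT y|lborel. indicator Ycell y * (norm (?p y))\<^sup>2) = 1"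
      by (simp only: of_real_eq_1_iff)
    have "(\<integral>\<^sup>+y. ennreal ((norm (?p y))\<^sup>2) * indicator Qcell y \<partial>lborel)
        = (\<integral>\<^sup>+y. ennreal (indicator Ycell y * (norm (?p y))\<^sup>2) \<partial>lborel)"
      by (rule nn_integral_cong_AE, use AE_Ycell_Qcell in eventually_elim) (auto simp: indicator_def)
    also have "\<dots> = ennreal 1" unfolding 1[symmetric] by (rule nn_integral_eq_integral[OF i]) simp
    finally show "(\<integral>\<^sup>+y. ennreal ((norm (?p y))\<^sup>2) * indicator Qcell y \<partial>lborel) = 1" by simp
  qed
  from isometric_kernel_scale[OF this \<epsilon>]
  have "isometric_kernel (\<lambda>x \<eta>. \<Phi> 0 ((1 / \<epsilon>) *\<^sub>R x) (\<epsilon> *\<^sub>R \<eta>) * cis (2 * pi * (\<epsilon> *\<^sub>R \<eta> \<bullet> (1 / \<epsilon>) *\<^sub>R x))) (Zscaled \<epsilon>)"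
    by (simp only: Zscaled_def)
  moreover have "bloch_wave \<Phi> \<epsilon> 0 = (\<lambda>x \<eta>. \<Phi> 0 ((1 / \<epsilon>) *\<^sub>R x) (\<epsilon> *\<^sub>R \<eta>) * cis (2 * pi * (\<epsilon> *\<^sub>R \<eta> \<bullet> (1 / \<epsilon>) *\<^sub>R x)))"
    using \<epsilon> by (simp add: bloch_wave_def fun_eq_iff)
  ultimately show ?thesis by simp
qed

context isometric_kernel
begin

lemma W_fst_measurable: "(\<lambda>\<eta>. W x \<eta>) \<in> borel_measurable borel"
  by measurable

lemma W_snd_measurable: "(\<lambda>x. W x \<eta>) \<in> borel_measurable borel"
  by measurable

lemma synth_cong_AE:
  assumes g: "g \<in> L2" and h: "h \<in> L2" and eq: "AE \<eta> in lborel. \<eta> \<in> S \<longrightarrow> g \<eta> = h \<eta>"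
  shows "synth w S g x = synth w S h x"
  unfolding synth_W
proof (rule integral_cong_AE)
  have [measurable]: "g \<in> borel_measurable borel" "h \<in> borel_measurable borel" using g h by auto
  show "(\<lambda>\<eta>. g \<eta> * W x \<eta>) \<in> borel_measurable lborel" "(\<lambda>\<eta>. h \<eta> * W x \<eta>) \<in> borel_measurable lborel"
    by measurable
  show "AE \<eta> in lborel. g \<eta> * W x \<eta> = h \<eta> * W x \<eta>"
    using eq by eventually_elim (auto simp: W_def indicator_def)
qed

lemma synth_dist:
  assumes g: "g \<in> L2" and h: "h \<in> L2"
  shows "L2norm (\<lambda>x. synth w S g x - synth w S h x) \<le> L2norm (\<lambda>\<eta>. g \<eta> - h \<eta>)"
proof -
  note d = L2_diff[OF g h]
  have "AE x in lborel. synth w S (\<lambda>\<eta>. g \<eta> - h \<eta>) x = synth w S g x - synth w S h x"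
    using synth_add[OF g L2_cmult[OF h, of "-1"]] synth_cmult[of "-1" h] by (simp add: synth_def)
  then have "L2norm (\<lambda>x. synth w S g x - synth w S h x) = L2norm (synth w S (\<lambda>\<eta>. g \<eta> - h \<eta>))"
    by (intro L2norm_cong_AE L2_diff synth_L2 g h) (auto elim: eventually_mono)
  also have "\<dots> = L2norm (\<lambda>\<eta>. indicator S \<eta> *\<^sub>R (g \<eta> - h \<eta>))" by (rule synth_norm[OF d])
  also have "\<dots> \<le> 1 * L2norm (\<lambda>\<eta>. g \<eta> - h \<eta>)"
    by (rule L2_bound(2)[OF d L2_measurable[OF L2_indicator[OF d S_sets]]]) (auto simp: indicator_def)
  finally show ?thesis by simp
qed

lemma synth_subset:
  assumes "B \<subseteq> S" shows "synth w B g = synth w S (\<lambda>\<eta>. indicator B \<eta> *\<^sub>R g \<eta>)"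
  unfolding synth_def set_lebesgue_integral_def
  by (rule ext, rule arg_cong[where f="integral\<^sup>L lborel"]) (use assms in \<open>auto simp: fun_eq_iff indicator_def\<close>)

text \<open>Multiplication by the indicator of \<open>S\<close> turns limits on \<open>S\<close> into limits in \<open>L2\<close>, which are unique.\<close>

lemma analysis_limit_unique:
  assumes F: "F \<in> L2" and g: "g \<in> L2_on S" "L2_tendsto S (\<lambda>R. analysis w R F) g at_top"
    and h: "h \<in> L2_on S" "L2_tendsto S (\<lambda>R. analysis w R F) h at_top"
  shows "AE \<eta> in lborel. \<eta> \<in> S \<longrightarrow> g \<eta> = h \<eta>"
proof -
  have L: "(\<lambda>\<eta>. indicator S \<eta> *\<^sub>R k \<eta>) \<in> L2" if "k \<in> L2_on S" for k :: "real^'n \<Rightarrow> complex"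
  proof -
    have [measurable]: "k \<in> borel_measurable borel" using that by (simp add: L2_on_def)
    have "(\<lambda>x. (norm (indicator S x *\<^sub>R k x))\<^sup>2) = (\<lambda>x. indicator S x * (norm (k x))\<^sup>2)"
      by (auto simp: indicator_def)
    then show ?thesis using that by (simp add: L2_iff L2_on_def set_integrable_def)
  qed
  have T: "((\<lambda>R. L2norm (\<lambda>\<eta>. indicator S \<eta> *\<^sub>R analysis w R F \<eta> - indicator S \<eta> *\<^sub>R k \<eta>)) \<longlongrightarrow> 0) at_top"
    if k: "k \<in> L2_on S" "L2_tendsto S (\<lambda>R. analysis w R F) k at_top" for k
  proof -
    have "ennreal ((norm (indicator S \<eta> *\<^sub>R analysis w R F \<eta> - indicator S \<eta> *\<^sub>R k \<eta>))\<^sup>2) * indicator UNIV \<eta>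
      = ennreal ((norm (analysis w R F \<eta> - k \<eta>))\<^sup>2) * indicator S \<eta>" for R \<eta>
      by (simp add: indicator_def)
    then have "L2_tendsto UNIV (\<lambda>R \<eta>. indicator S \<eta> *\<^sub>R analysis w R F \<eta>) (\<lambda>\<eta>. indicator S \<eta> *\<^sub>R k \<eta>) at_top"
      using k(2) unfolding L2_tendsto_def by simp
    then show ?thesis by (subst (asm) L2_tendsto_iff[OF analysis_L2[OF F] L[OF k(1)]])
  qed
  have "AE \<eta> in lborel. indicator S \<eta> *\<^sub>R g \<eta> = indicator S \<eta> *\<^sub>R h \<eta>"
    by (rule L2_limit_unique[OF analysis_L2[OF F] L[OF g(1)] L[OF h(1)] _ T[OF g] T[OF h]]) simp
  then show ?thesis by eventually_elim auto
qed

lemma analysis_cong_AE: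
  assumes u: "u \<in> borel_measurable borel" and v: "v \<in> borel_measurable borel"
    and eq: "AE x in lborel. u x = v x" and \<eta>: "\<eta> \<in> S"
  shows "analysis w R u \<eta> = analysis w R v \<eta>"
proof -
  have wm [measurable]: "(\<lambda>x. w x \<eta>) \<in> borel_measurable borel"
    using W_snd_measurable[of \<eta>] \<eta> by (simp add: W_def)
  note [measurable] = u v
  show ?thesis unfolding analysis_def set_lebesgue_integral_def
  proof (rule integral_cong_AE)
    show "AE x in lborel. indicator (cball 0 R) x *\<^sub>R (u x * cnj (w x \<eta>)) = indicator (cball 0 R) x *\<^sub>R (v x * cnj (w x \<eta>))"
      using eq by eventually_elim simp
  qed measurable
qed

end

lemma adaption_eq_synth: "adaption \<Phi> \<epsilon> f = synth (bloch_wave \<Phi> \<epsilon> 0) (Zscaled \<epsilon>) (fourier f)"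
  by (simp add: fun_eq_iff adaption_def synth_def)

text \<open>Truncated analysis recovers the input \<open>g\<close> of the synthesis in the limit; uniqueness of this limit
  identifies whichever function the choice in \<^const>\<open>bloch_coeff\<close> has picked.\<close>

lemma bloch_coeff_synth:
  assumes b: "bloch_system A lam \<Phi>" and \<epsilon>: "0 < \<epsilon>" and g: "g \<in> L2" and v: "v \<in> L2"
    and eq: "AE x in lborel. synth (bloch_wave \<Phi> \<epsilon> 0) (Zscaled \<epsilon>) g x = v x"
  shows "bloch_coeff \<Phi> \<epsilon> 0 v \<in> L2_on (Zscaled \<epsilon>)"
    "AE \<eta> in lborel. \<eta> \<in> Zscaled \<epsilon> \<longrightarrow> bloch_coeff \<Phi> \<epsilon> 0 v \<eta> = g \<eta>"
proof -
  interpret isometric_kernel "bloch_wave \<Phi> \<epsilon> 0" "Zscaled \<epsilon>" by (rule isometric_kernel_bloch_wave[OF b \<epsilon>])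
  let ?w = "bloch_wave \<Phi> \<epsilon> 0" and ?S = "Zscaled \<epsilon>"
  have an: "analysis ?w R v \<eta> = analysis ?w R (synth ?w ?S g) \<eta>" if "\<eta> \<in> ?S" for R \<eta>
    by (rule analysis_cong_AE[OF _ _ _ that]) (use v synth_L2[OF g] eq in \<open>auto elim: eventually_mono\<close>)
  have "ennreal ((norm (analysis ?w R v \<eta> - g \<eta>))\<^sup>2) * indicator ?S \<eta>
      = ennreal ((norm (analysis ?w R (synth ?w ?S g) \<eta> - g \<eta>))\<^sup>2) * indicator ?S \<eta>" for R \<eta>
    using an[of \<eta> R] by (cases "\<eta> \<in> ?S") auto
  then have T: "L2_tendsto ?S (\<lambda>R. analysis ?w R v) g at_top"
    using analysis_synth_tendsto[OF g] unfolding L2_tendsto_def by simp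
  have gS: "g \<in> L2_on ?S"
  proof -
    have [measurable]: "g \<in> borel_measurable borel" using g by auto
    have "integrable lborel (\<lambda>x. indicator ?S x *\<^sub>R (norm (g x))\<^sup>2)"
      by (rule integrable_mult_indicator[OF _ L2_integrable[OF g]]) simp
    then show ?thesis by (simp add: L2_on_def set_integrable_def)
  qed
  have "is_bloch_coeff \<Phi> \<epsilon> 0 v g"
    unfolding is_bloch_coeff_def analysis_def[symmetric] using gS T by blast
  then have "is_bloch_coeff \<Phi> \<epsilon> 0 v (bloch_coeff \<Phi> \<epsilon> 0 v)"
    unfolding bloch_coeff_def by (rule someI[of "is_bloch_coeff \<Phi> \<epsilon> 0 v"])
  then have c: "bloch_coeff \<Phi> \<epsilon> 0 v \<in> L2_on ?S" "L2_tendsto ?S (\<lambda>R. analysis ?w R v) (bloch_coeff \<Phi> \<epsilon> 0 v) at_top"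
    unfolding is_bloch_coeff_def analysis_def[symmetric] by blast+
  show "bloch_coeff \<Phi> \<epsilon> 0 v \<in> L2_on ?S" by (rule c(1))
  show "AE \<eta> in lborel. \<eta> \<in> ?S \<longrightarrow> bloch_coeff \<Phi> \<epsilon> 0 v \<eta> = g \<eta>"
    by (rule analysis_limit_unique[OF v c gS T])
qed

section \<open>The effective admissible set\<close>

locale effective_setting =
  fixes A :: "real^'n \<Rightarrow> real^'n^'n" and lam and \<Phi> :: "nat \<Rightarrow> real^'n \<Rightarrow> real^'n \<Rightarrow> complex"
    and K :: "(real^'n) set" and U :: "real \<Rightarrow> (real^'n \<Rightarrow> real) set" and \<epsilon> :: real
  assumes bloch: "bloch_system A lam \<Phi>" and eps: "0 < \<epsilon>"
    and K_compact: "compact K" and K_sym: "uminus ` K = K" and K_Z: "K \<subseteq> Zscaled \<epsilon>"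
    and adm: "admissible_sets \<Phi> K U"
begin

sublocale bw: isometric_kernel "bloch_wave \<Phi> \<epsilon> 0" "Zscaled \<epsilon>"
  by (rule isometric_kernel_bloch_wave[OF bloch eps])

abbreviation "w \<equiv> bloch_wave \<Phi> \<epsilon> 0"
abbreviation "Z \<equiv> Zscaled \<epsilon> :: (real^'n) set"

lemma K_sets [measurable]: "K \<in> sets borel" and K_bounded: "bounded K"
  using K_compact by (auto simp: borel_compact compact_imp_bounded)

text \<open>Fourier inversion turns the reconstruction formula in \<^const>\<open>U_star\<close> into a condition on the support.\<close>

lemma supported_iff:
  assumes u: "u \<in> L2"
  shows "fourier_supported_in K u \<longleftrightarrow> (AE x in lborel. complex_of_real (u x)
      = (LINT \<eta>:K|lborel. rfourier u \<eta> * cis (2 * pi * (\<eta> \<bullet> x))))"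
proof -
  have u': "(\<lambda>x. complex_of_real (u x)) \<in> L2" using u by (simp add: L2_of_real)
  note s = synth_plane[OF rfourier_L2[OF u] K_sets K_bounded]
  have "fourier_supported_in K u \<longleftrightarrow> (AE x in lborel. complex_of_real (u x) = synth plane K (rfourier u) x)"
  proof
    assume "fourier_supported_in K u"
    then show "AE x in lborel. complex_of_real (u x) = synth plane K (rfourier u) x"
      unfolding fourier_supported_in_def by (intro fourier_inversion[OF u' K_sets K_bounded])
  next
    assume "AE x in lborel. complex_of_real (u x) = synth plane K (rfourier u) x"
    then have "AE \<eta> in lborel. rfourier u \<eta> = fourier (synth plane K (rfourier u)) \<eta>"
      using fourier_eq_iff[OF u' s(1)] by blast
    then show "fourier_supported_in K u"
      using s(2) unfolding fourier_supported_in_def by eventually_elim auto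
  qed
  then show ?thesis by (simp add: synth_def)
qed

lemma U_star_iff:
  "u \<in> U_star \<Phi> K U \<epsilon> \<longleftrightarrow> u \<in> L2 \<and> fourier_supported_in K u \<and> ae_mem (synth w Z (rfourier u)) (U \<epsilon>)"
  unfolding U_star_def adaption_eq_synth using supported_iff by auto

lemma U_props: "U \<epsilon> \<subseteq> L2" "fun_convex (U \<epsilon>)" "L2_closed (U \<epsilon>)"
  using adm eps unfolding admissible_sets_def by blast+

text \<open>Projecting the adapted function \<open>u0\<close> to the band \<open>K\<close> replaces \<open>u0\<close> by its band-limited part, which
  is real because \<open>K\<close> is symmetric.\<close>

lemma U_star_nonempty: "U_star \<Phi> K U \<epsilon> \<noteq> {}"
proof -
  obtain u0 where u0: "u0 \<in> L2" "ae_mem (radaption \<Phi> \<epsilon> u0) (U \<epsilon>)"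
    using adm eps unfolding admissible_sets_def by blast
  let ?g = "rfourier u0"
  have g: "?g \<in> L2" by (rule rfourier_L2[OF u0(1)])
  obtain v where v: "v \<in> U \<epsilon>" "AE x in lborel. synth w Z ?g x = complex_of_real (v x)"
    using u0(2) unfolding ae_mem_def adaption_eq_synth by blast
  have vL: "(\<lambda>x. complex_of_real (v x)) \<in> L2" using v(1) U_props(1) by (auto simp: L2_of_real)
  note c = bloch_coeff_synth[OF bloch eps g vL v(2)]
  have [measurable]: "bloch_coeff \<Phi> \<epsilon> 0 (\<lambda>x. complex_of_real (v x)) \<in> borel_measurable borel" using c(1) by (simp add: L2_on_def)
  have [measurable]: "?g \<in> borel_measurable borel" using g by auto
  have proj: "bloch_projection \<Phi> \<epsilon> K v x = synth w K ?g x" for x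
  proof -
    have wm [measurable]: "(\<lambda>\<eta>. bw.W x \<eta>) \<in> borel_measurable borel" by (rule bw.W_fst_measurable)
    have KZ: "K \<inter> Z = K" using K_Z by blast
    have iw: "indicator K \<eta> *\<^sub>R (a * w x \<eta>) = indicator K \<eta> *\<^sub>R (a * bw.W x \<eta>)" for a \<eta>
      using K_Z by (auto simp: bw.W_def indicator_def)
    show ?thesis
      unfolding bloch_projection_def synth_def set_lebesgue_integral_def KZ iw
    proof (rule integral_cong_AE)
      show "AE \<eta> in lborel. indicator K \<eta> *\<^sub>R (bloch_coeff \<Phi> \<epsilon> 0 (\<lambda>x. complex_of_real (v x)) \<eta> * bw.W x \<eta>)
          = indicator K \<eta> *\<^sub>R (?g \<eta> * bw.W x \<eta>)"
        using c(2)
      proof eventually_elim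
        case (elim \<eta>)
        then show ?case using K_Z by (cases "\<eta> \<in> K") auto
      qed
    qed measurable
  qed
  have mem: "ae_mem (synth w K ?g) (U \<epsilon>)"
    using adm eps v(1) unfolding admissible_sets_def proj[abs_def, symmetric] by blast
  define u where "u x = Re (synth plane K ?g x)" for x
  note rs = real_synth[OF g K_sets K_bounded K_sym rfourier_reflect[OF u0(1)], folded u_def]
  have uL: "u \<in> L2" using rs(1) .
  have "synth w Z (rfourier u) x = synth w K ?g x" for x
    unfolding bw.synth_subset[OF K_Z]
    by (rule bw.synth_cong_AE[OF rfourier_L2[OF uL] L2_indicator[OF g K_sets]]) (use rs(3) in \<open>auto elim: eventually_mono\<close>)
  then have "ae_mem (synth w Z (rfourier u)) (U \<epsilon>)" using mem by (simp add: ae_mem_def)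
  moreover have "fourier_supported_in K u"
    using rs(3) unfolding fourier_supported_in_def by eventually_elim auto
  ultimately show ?thesis using U_star_iff uL by blast
qed

text \<open>The adaption is linear.\<close>

lemma U_star_mid:
  assumes "u \<in> U_star \<Phi> K U \<epsilon>" "v \<in> U_star \<Phi> K U \<epsilon>"
  shows "(\<lambda>x. (1/2) *\<^sub>R (u x + v x)) \<in> U_star \<Phi> K U \<epsilon>"
proof -
  have u: "u \<in> L2" "fourier_supported_in K u" and v: "v \<in> L2" "fourier_supported_in K v"
    using assms U_star_iff by auto
  obtain a b where a: "a \<in> U \<epsilon>" "AE x in lborel. synth w Z (rfourier u) x = complex_of_real (a x)"
    and b: "b \<in> U \<epsilon>" "AE x in lborel. synth w Z (rfourier v) x = complex_of_real (b x)"
    using assms unfolding U_star_iff ae_mem_def by blast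
  let ?m = "\<lambda>x. (1/2) *\<^sub>R (u x + v x)"
  note gu = rfourier_L2[OF u(1)] and gv = rfourier_L2[OF v(1)]
  have m: "?m \<in> L2" by (intro L2_scaleR L2_add u v)
  note fm = rfourier_mid[OF u(1) v(1)]
  have "fourier_supported_in K ?m"
    using fm u(2) v(2) unfolding fourier_supported_in_def by eventually_elim auto
  moreover have "ae_mem (synth w Z (rfourier ?m)) (U \<epsilon>)"
  proof -
    let ?h = "\<lambda>\<eta>. (1/2) * (rfourier u \<eta> + rfourier v \<eta>)"
    have eq: "synth w Z (rfourier ?m) x = (1/2) * synth w Z (\<lambda>\<eta>. rfourier u \<eta> + rfourier v \<eta>) x" for x
      unfolding bw.synth_cmult[symmetric]
      by (rule bw.synth_cong_AE[OF rfourier_L2[OF m] L2_cmult[OF L2_add[OF gu gv]]])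
        (use fm in eventually_elim, simp add: scaleR_conv_of_real)
    have "AE x in lborel. synth w Z (rfourier ?m) x = complex_of_real ((1 - 1/2) * a x + 1/2 * b x)"
      using a(2) b(2) bw.synth_add[OF gu gv]
    proof eventually_elim
      case (elim x)
      show ?case unfolding eq elim(3) elim(1,2) by (simp add: distrib_left)
    qed
    moreover have "(\<lambda>x. (1 - 1/2) * a x + 1/2 * b x) \<in> U \<epsilon>"
    proof -
      have "(1/2::real) \<in> {0..1}" by simp
      then show ?thesis using U_props(2) a(1) b(1) unfolding fun_convex_def by blast
    qed
    ultimately show ?thesis unfolding ae_mem_def by (rule bexI)
  qed
  ultimately show ?thesis using U_star_iff m by blast
qed

text \<open>The adaption is a contraction.  The adapted limit need not be real pointwise, but it is the limit of
  real functions and therefore agrees with its real part.\<close>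

lemma U_star_closed: "L2_closed (U_star \<Phi> K U \<epsilon>)"
  unfolding L2_closed_def
proof (intro allI impI, elim conjE)
  fix u :: "nat \<Rightarrow> real^'n \<Rightarrow> real" and v
  assume uU: "\<forall>k. u k \<in> U_star \<Phi> K U \<epsilon>" and v: "v \<in> L2" and T: "L2_tendsto UNIV u v sequentially"
  have u: "u n \<in> L2" "fourier_supported_in K (u n)" for n using uU U_star_iff by blast+
  have lim: "(\<lambda>n. L2norm (\<lambda>x. u n x - v x)) \<longlonglongrightarrow> 0" by (rule iffD1[OF L2_tendsto_iff[OF u(1) v] T])
  have flim: "(\<lambda>n. L2norm (\<lambda>\<eta>. rfourier (u n) \<eta> - rfourier v \<eta>)) \<longlonglongrightarrow> 0"
    unfolding rfourier_norm_diff[OF u(1) v] by (rule lim)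
  note gu = rfourier_L2[OF u(1)] and gv = rfourier_L2[OF v]
  have "fourier_supported_in K v"
  proof -
    let ?h = "\<lambda>\<eta>. indicator K \<eta> *\<^sub>R rfourier v \<eta>"
    have h: "?h \<in> L2" by (rule L2_indicator[OF gv K_sets])
    have "L2norm (\<lambda>\<eta>. rfourier (u n) \<eta> - ?h \<eta>) \<le> L2norm (\<lambda>\<eta>. rfourier (u n) \<eta> - rfourier v \<eta>)" for n
    proof -
      have "AE \<eta> in lborel. rfourier (u n) \<eta> - ?h \<eta> = indicator K \<eta> *\<^sub>R (rfourier (u n) \<eta> - rfourier v \<eta>)"
        using u(2)[of n] unfolding fourier_supported_in_def by eventually_elim (auto simp: indicator_def)
      then have "L2norm (\<lambda>\<eta>. rfourier (u n) \<eta> - ?h \<eta>) = L2norm (\<lambda>\<eta>. indicator K \<eta> *\<^sub>R (rfourier (u n) \<eta> - rfourier v \<eta>))"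
        by (intro L2norm_cong_AE L2_diff gu h L2_indicator[OF L2_diff[OF gu gv] K_sets])
      also have "\<dots> \<le> 1 * L2norm (\<lambda>\<eta>. rfourier (u n) \<eta> - rfourier v \<eta>)"
        by (rule L2_bound(2)[OF L2_diff[OF gu gv] L2_measurable[OF L2_indicator[OF L2_diff[OF gu gv] K_sets]]])
          (auto simp: indicator_def)
      finally show ?thesis by simp
    qed
    then have "(\<lambda>n. L2norm (\<lambda>\<eta>. rfourier (u n) \<eta> - ?h \<eta>)) \<longlonglongrightarrow> 0" by (rule L2norm_squeeze[OF _ flim])
    from L2_limit_unique[OF gu gv h sequentially_bot flim this]
    show ?thesis unfolding fourier_supported_in_def by eventually_elim auto
  qed
  moreover have "ae_mem (synth w Z (rfourier v)) (U \<epsilon>)"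
  proof -
    let ?F = "synth w Z (rfourier v)"
    have F: "?F \<in> L2" by (rule bw.synth_L2[OF gv])
    have "\<exists>a. a \<in> U \<epsilon> \<and> (AE x in lborel. synth w Z (rfourier (u n)) x = complex_of_real (a x))" for n
      using uU unfolding U_star_iff ae_mem_def by blast
    then obtain a where a: "\<And>n. a n \<in> U \<epsilon>" "\<And>n. AE x in lborel. synth w Z (rfourier (u n)) x = complex_of_real (a n x)"
      by metis
    have aL: "a n \<in> L2" for n using a(1) U_props(1) by blast
    have aLc: "(\<lambda>x. complex_of_real (a n x)) \<in> L2" for n using aL by (simp add: L2_of_real)
    have le: "L2norm (\<lambda>x. complex_of_real (a n x) - ?F x) \<le> L2norm (\<lambda>\<eta>. rfourier (u n) \<eta> - rfourier v \<eta>)" for n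
    proof -
      have "L2norm (\<lambda>x. complex_of_real (a n x) - ?F x) = L2norm (\<lambda>x. synth w Z (rfourier (u n)) x - ?F x)"
        by (rule L2norm_cong_AE[OF L2_diff[OF aLc F] L2_diff[OF bw.synth_L2[OF gu] F]])
          (use a(2)[of n] in eventually_elim, simp)
      then show ?thesis using bw.synth_dist[OF gu gv, of n] by simp
    qed
    have l1: "(\<lambda>n. L2norm (\<lambda>x. complex_of_real (a n x) - ?F x)) \<longlonglongrightarrow> 0" by (rule L2norm_squeeze[OF le flim])
    let ?b = "\<lambda>x. Re (?F x)"
    have b: "?b \<in> L2" by (rule L2_Re[OF F])
    have "L2norm (\<lambda>x. a n x - ?b x) \<le> L2norm (\<lambda>x. complex_of_real (a n x) - ?F x)" for n
    proof -
      have "norm (a n x - ?b x) \<le> 1 * norm (complex_of_real (a n x) - ?F x)" for x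
        using abs_Re_le_cmod[of "complex_of_real (a n x) - ?F x"] by simp
      from L2_bound(2)[OF L2_diff[OF aLc F] L2_measurable[OF L2_diff[OF aL b]] this] show ?thesis by simp
    qed
    then have l2: "(\<lambda>n. L2norm (\<lambda>x. a n x - ?b x)) \<longlonglongrightarrow> 0" by (rule L2norm_squeeze[OF _ l1])
    have "L2_tendsto UNIV a ?b sequentially" by (rule iffD2[OF L2_tendsto_iff[OF aL b] l2])
    then have bU: "?b \<in> U \<epsilon>" using U_props(3) a(1) b unfolding L2_closed_def by blast
    have "L2norm (\<lambda>x. complex_of_real (a n x) - complex_of_real (?b x)) = L2norm (\<lambda>x. a n x - ?b x)" for n
      by (rule L2norm_cong) (simp flip: of_real_diff)
    then have l3: "(\<lambda>n. L2norm (\<lambda>x. complex_of_real (a n x) - complex_of_real (?b x))) \<longlonglongrightarrow> 0" using l2 by simp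
    have bc: "(\<lambda>x. complex_of_real (?b x)) \<in> L2" using b unfolding L2_of_real .
    have "AE x in lborel. ?F x = complex_of_real (?b x)"
      by (rule L2_limit_unique[OF aLc F bc sequentially_bot l1 l3])
    then show ?thesis unfolding ae_mem_def using bU by (rule bexI)
  qed
  ultimately show "v \<in> U_star \<Phi> K U \<epsilon>" using U_star_iff v by blast
qed

end

section \<open>The effective optimal control problem\<close>

locale effective_problem = effective_setting A lam \<Phi> K U \<epsilon>
  for A :: "real^'n \<Rightarrow> real^'n^'n" and lam and \<Phi> :: "nat \<Rightarrow> real^'n \<Rightarrow> real^'n \<Rightarrow> complex"
    and K :: "(real^'n) set" and U :: "real \<Rightarrow> (real^'n \<Rightarrow> real) set" and \<epsilon> :: real +
  fixes T :: "'n tensors" and M :: nat and \<mu>1 \<mu>2 \<kappa> :: real and f yd1 yd2 :: "real^'n \<Rightarrow> real"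
  assumes mu: "0 \<le> \<mu>1" "0 \<le> \<mu>2" and kappa: "0 < \<kappa>"
    and f: "f \<in> L2" "fourier_supported_in K f"
    and yd1: "yd1 \<in> L2" "fourier_supported_in K yd1"
    and yd2: "yd2 \<in> L2" "fourier_supported_in K yd2"
    and P_nonneg: "\<And>\<eta>. \<eta> \<in> K \<Longrightarrow> 0 \<le> Psym T \<epsilon> M \<eta>"
begin

abbreviation "Uad \<equiv> U_star \<Phi> K U \<epsilon>"
abbreviation "J \<equiv> J_star T \<epsilon> M \<mu>1 \<mu>2 \<kappa> yd1 yd2"
abbreviation "feasible \<equiv> P_star_feasible T \<epsilon> M f Uad"

text \<open>Off \<open>K\<close> the value \<open>1\<close> replaces \<open>Psym + 1\<close>, which may have zeros there; division by \<open>\<rho>\<close> is then a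
  bounded operation, and on functions with frequencies in \<open>K\<close> it is division by \<open>Psym + 1\<close>.\<close>

definition \<rho> :: "real^'n \<Rightarrow> real" where
  "\<rho> \<eta> = (if \<eta> \<in> K then Psym T \<epsilon> M \<eta> + 1 else 1)"

lemma \<rho>_ge_1: "1 \<le> \<rho> \<eta>"
  using P_nonneg by (simp add: \<rho>_def)

lemma \<rho>_pos: "0 < \<rho> \<eta>"
  using \<rho>_ge_1[of \<eta>] by linarith

lemma \<rho>_measurable [measurable]: "\<rho> \<in> borel_measurable borel"
  unfolding \<rho>_def[abs_def] by measurable

lemma \<rho>_bounded: obtains C where "\<And>\<eta>. \<rho> \<eta> \<le> C"
proof -
  have "compact ((\<lambda>\<eta>. Psym T \<epsilon> M \<eta> + 1) ` K)"
    by (rule compact_continuous_image[OF _ K_compact]) (intro continuous_intros Psym_continuous)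
  then obtain C where C: "\<forall>x\<in>(\<lambda>\<eta>. Psym T \<epsilon> M \<eta> + 1) ` K. norm x \<le> C"
    using compact_imp_bounded bounded_iff by metis
  have "\<rho> \<eta> \<le> max 1 C" for \<eta>
  proof (cases "\<eta> \<in> K")
    case True
    then have "Psym T \<epsilon> M \<eta> + 1 \<le> C" using C abs_le_D1 by fastforce
    then show ?thesis using True by (simp add: \<rho>_def)
  qed (simp add: \<rho>_def)
  then show ?thesis by (rule that)
qed

lemma \<rho>_reflect: "\<rho> (- \<eta>) = \<rho> \<eta>"
proof -
  have "- \<eta> \<in> K \<longleftrightarrow> \<eta> \<in> K" using K_sym by (metis imageI minus_minus)
  moreover have "tensor_apply T k (- \<eta>) = tensor_apply T k \<eta>" for k
    using tensor_apply_scale[of T k "-1" \<eta>] by simp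
  ultimately show ?thesis by (simp add: \<rho>_def Psym_def)
qed

text \<open>The inverse of the effective operator on functions with frequencies in \<open>K\<close>.\<close>

definition resolvent :: "(real^'n \<Rightarrow> complex) \<Rightarrow> real^'n \<Rightarrow> complex" where
  "resolvent g \<eta> = of_real (1 / \<rho> \<eta>) * g \<eta>"

lemma inverse_\<rho>:
  "(\<lambda>\<eta>. complex_of_real (1 / \<rho> \<eta>)) \<in> borel_measurable borel" "norm (complex_of_real (1 / \<rho> \<eta>)) \<le> 1"
  using \<rho>_ge_1[of \<eta>] \<rho>_pos[of \<eta>] by (simp_all add: norm_divide divide_le_eq)

lemma inverse_sqrt_\<rho>:
  "(\<lambda>\<eta>. complex_of_real (1 / sqrt (\<rho> \<eta>))) \<in> borel_measurable borel" "norm (complex_of_real (1 / sqrt (\<rho> \<eta>))) \<le> 1"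
  using \<rho>_ge_1[of \<eta>] \<rho>_pos[of \<eta>] by (simp_all add: norm_divide divide_le_eq)

lemma resolvent_L2: "g \<in> L2 \<Longrightarrow> resolvent g \<in> L2"
  unfolding resolvent_def[abs_def] by (rule L2_bounded_mult(1)[OF _ inverse_\<rho>])

text \<open>A state in \<open>Hk\<close> may have frequencies outside \<open>K\<close> a priori.  There the right-hand side vanishes, and
  since \<open>Psym + 1\<close> has no zeros up to a null set, so does the transform of the state.\<close>

lemma state_fourier:
  assumes u: "u \<in> L2" "fourier_supported_in K u" and y: "y \<in> Hk (2 * M)" and s: "state_equation T \<epsilon> M f u y"
  shows "AE \<eta> in lborel. rfourier y \<eta> = resolvent (\<lambda>\<eta>. rfourier f \<eta> + rfourier u \<eta>) \<eta>"
proof -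
  have "AE \<eta> in lborel. of_real (Psym T \<epsilon> M \<eta> + 1) * rfourier y \<eta> = rfourier f \<eta> + rfourier u \<eta>"
    using s state_equation_fourier[OF y f(1) u(1)] by blast
  with Psym_plus_1_nonzero[of T \<epsilon> M] f(2) u(2) show ?thesis
    unfolding fourier_supported_in_def
  proof eventually_elim
    case (elim \<eta>)
    show ?case
    proof (cases "\<eta> \<in> K")
      case True
      then have "\<rho> \<eta> = Psym T \<epsilon> M \<eta> + 1" by (simp add: \<rho>_def)
      then have "of_real (\<rho> \<eta>) * rfourier y \<eta> = rfourier f \<eta> + rfourier u \<eta>" using elim(4) by simp
      then show ?thesis using \<rho>_pos[of \<eta>] by (simp add: resolvent_def field_simps)
    next
      case False
      then have "of_real (Psym T \<epsilon> M \<eta> + 1) * rfourier y \<eta> = 0" using elim by simp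
      moreover have "complex_of_real (Psym T \<epsilon> M \<eta> + 1) \<noteq> 0"
        unfolding of_real_eq_0_iff by (rule elim(1))
      ultimately have "rfourier y \<eta> = 0" by (metis mult_eq_0_iff)
      then show ?thesis using elim False by (simp add: resolvent_def)
    qed
  qed
qed

lemma state_exists:
  assumes u: "u \<in> L2" "fourier_supported_in K u"
  obtains y where "y \<in> Hk (2 * M)" "state_equation T \<epsilon> M f u y"
proof -
  let ?g = "resolvent (\<lambda>\<eta>. rfourier f \<eta> + rfourier u \<eta>)"
  have g: "?g \<in> L2" by (intro resolvent_L2 L2_add rfourier_L2 f(1) u(1))
  have refl: "AE \<eta> in lborel. ?g (- \<eta>) = cnj (?g \<eta>)"
    using rfourier_reflect[OF f(1)] rfourier_reflect[OF u(1)]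
    by eventually_elim (simp add: resolvent_def \<rho>_reflect)
  define y where "y x = Re (synth plane K ?g x)" for x
  note rs = real_synth[OF g K_sets K_bounded K_sym refl, folded y_def]
  have yL: "y \<in> L2" by (rule rs(1))
  have supp: "fourier_supported_in K y"
    using rs(3) unfolding fourier_supported_in_def by eventually_elim auto
  have yH: "y \<in> Hk (2 * M)" by (rule band_limited_Hk[OF yL K_compact K_sym supp])
  have "AE \<eta> in lborel. of_real (Psym T \<epsilon> M \<eta> + 1) * rfourier y \<eta> = rfourier f \<eta> + rfourier u \<eta>"
    using rs(3) f(2) u(2) unfolding fourier_supported_in_def
  proof eventually_elim
    case (elim \<eta>)
    show ?case
    proof (cases "\<eta> \<in> K")
      case True
      then have "Psym T \<epsilon> M \<eta> + 1 = \<rho> \<eta>" by (simp add: \<rho>_def)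
      then show ?thesis using elim(1) True \<rho>_pos[of \<eta>] by (simp add: resolvent_def)
    qed (use elim in simp)
  qed
  then have "state_equation T \<epsilon> M f u y" using state_equation_fourier[OF yH f(1) u(1)] by blast
  with yH show ?thesis by (rule that)
qed

text \<open>With the state eliminated, the two tracking terms are squared norms of affine functions of the
  transform of the control.  The energy is weighted by \<open>\<rho>\<close>, whose root is absorbed into \<open>w1\<close> and \<open>h1\<close>.\<close>

definition w1 :: "real^'n \<Rightarrow> complex" where "w1 \<eta> = of_real (1 / sqrt (\<rho> \<eta>))"
definition w2 :: "real^'n \<Rightarrow> complex" where "w2 \<eta> = of_real (1 / \<rho> \<eta>)"
definition h1 :: "real^'n \<Rightarrow> complex" where
  "h1 \<eta> = w1 \<eta> * rfourier f \<eta> - of_real (sqrt (\<rho> \<eta>)) * rfourier yd1 \<eta>"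
definition h2 :: "real^'n \<Rightarrow> complex" where
  "h2 \<eta> = w2 \<eta> * rfourier f \<eta> - rfourier yd2 \<eta>"

definition reduced :: "(real^'n \<Rightarrow> real) \<Rightarrow> real" where
  "reduced u = \<mu>1 / 2 * (L2norm (\<lambda>\<eta>. w1 \<eta> * rfourier u \<eta> + h1 \<eta>))\<^sup>2
    + \<mu>2 / 2 * (L2norm (\<lambda>\<eta>. w2 \<eta> * rfourier u \<eta> + h2 \<eta>))\<^sup>2 + \<kappa> / 2 * (L2norm u)\<^sup>2"

lemma w1: "w1 \<in> borel_measurable borel" "norm (w1 \<eta>) \<le> 1"
  unfolding w1_def[abs_def] by (rule inverse_sqrt_\<rho>)+

lemma w2: "w2 \<in> borel_measurable borel" "norm (w2 \<eta>) \<le> 1"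
  unfolding w2_def[abs_def] by (rule inverse_\<rho>)+

lemma h1: "h1 \<in> L2"
proof -
  obtain C where C: "\<And>\<eta>. \<rho> \<eta> \<le> C" using \<rho>_bounded by blast
  have "(\<lambda>\<eta>. complex_of_real (sqrt (\<rho> \<eta>)) * rfourier yd1 \<eta>) \<in> L2"
  proof (rule L2_bounded_mult(1)[OF rfourier_L2[OF yd1(1)]])
    show "norm (complex_of_real (sqrt (\<rho> \<eta>))) \<le> sqrt C" for \<eta> using C[of \<eta>] \<rho>_pos[of \<eta>] by simp
  qed measurable
  then show ?thesis
    unfolding h1_def[abs_def] by (intro L2_diff L2_bounded_mult(1)[OF rfourier_L2[OF f(1)] w1])
qed

lemma h2: "h2 \<in> L2"
  unfolding h2_def[abs_def]
  by (intro L2_diff L2_bounded_mult(1)[OF rfourier_L2[OF f(1)] w2] rfourier_L2 yd2(1))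

lemma J_eq_reduced:
  assumes feas: "feasible u y" shows "J u y = reduced u"
proof -
  have u: "u \<in> L2" "fourier_supported_in K u" and yH: "y \<in> Hk (2 * M)" and s: "state_equation T \<epsilon> M f u y"
    using feas unfolding P_star_feasible_def U_star_iff by auto
  have y: "y \<in> L2" using yH by (simp add: Hk_def)
  note yf = state_fourier[OF u yH s]
  let ?z = "\<lambda>x. y x - yd1 x"
  have z: "?z \<in> L2" by (rule L2_diff[OF y yd1(1)])
  have zf: "AE \<eta> in lborel. rfourier ?z \<eta> = rfourier y \<eta> - rfourier yd1 \<eta>" by (rule rfourier_diff[OF y yd1(1)])
  have off: "AE \<eta> in lborel. \<eta> \<notin> K \<longrightarrow> rfourier f \<eta> = 0 \<and> rfourier u \<eta> = 0 \<and> rfourier yd1 \<eta> = 0"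
    using f(2) u(2) yd1(2) unfolding fourier_supported_in_def by eventually_elim auto
  have zsupp: "fourier_supported_in K ?z"
    unfolding fourier_supported_in_def using zf yf off
    by eventually_elim (simp add: resolvent_def)
  have zH: "?z \<in> Hk M" by (rule band_limited_Hk[OF z K_compact K_sym zsupp])
  have [measurable]: "rfourier ?z \<in> borel_measurable borel" by (rule rfourier_measurable[OF z])
  have A1: "(\<lambda>\<eta>. w1 \<eta> * rfourier u \<eta> + h1 \<eta>) \<in> L2"
    by (intro L2_add h1 L2_bounded_mult(1)[OF rfourier_L2[OF u(1)] w1])
  have A2: "(\<lambda>\<eta>. w2 \<eta> * rfourier u \<eta> + h2 \<eta>) \<in> L2"
    by (intro L2_add h2 L2_bounded_mult(1)[OF rfourier_L2[OF u(1)] w2])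
  have [measurable]: "(\<lambda>\<eta>. w1 \<eta> * rfourier u \<eta> + h1 \<eta>) \<in> borel_measurable borel" using A1 by (rule L2_measurable)
  have "E_star T \<epsilon> M ?z = (LINT \<eta>|lborel. (norm (w1 \<eta> * rfourier u \<eta> + h1 \<eta>))\<^sup>2)"
    unfolding E_star_fourier[OF zH]
  proof (rule integral_cong_AE)
    show "AE \<eta> in lborel. (Psym T \<epsilon> M \<eta> + 1) * (norm (rfourier ?z \<eta>))\<^sup>2 = (norm (w1 \<eta> * rfourier u \<eta> + h1 \<eta>))\<^sup>2"
      using zf yf off
    proof eventually_elim
      case (elim \<eta>)
      show ?case
      proof (cases "\<eta> \<in> K")
        case True
        let ?r = "complex_of_real (sqrt (\<rho> \<eta>))"
        have r: "?r * ?r = of_real (\<rho> \<eta>)" "?r \<noteq> 0"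
          using \<rho>_pos[of \<eta>] by (simp_all flip: of_real_mult)
        have "w1 \<eta> * rfourier u \<eta> + h1 \<eta> = ?r * rfourier ?z \<eta>"
        proof -
          have "complex_of_real (1 / \<rho> \<eta>) = 1 / (?r * ?r)" unfolding r(1) by simp
          then show ?thesis
            unfolding elim(1,2) resolvent_def h1_def w1_def using r(2) by (simp add: field_simps)
        qed
        then have "(norm (w1 \<eta> * rfourier u \<eta> + h1 \<eta>))\<^sup>2 = \<rho> \<eta> * (norm (rfourier ?z \<eta>))\<^sup>2"
          using \<rho>_pos[of \<eta>] by (simp add: norm_mult power_mult_distrib)
        then show ?thesis using True by (simp add: \<rho>_def)
      next
        case False
        then show ?thesis using elim by (simp add: resolvent_def h1_def)
      qed
    qed
  qed measurable
  also have "\<dots> = (L2norm (\<lambda>\<eta>. w1 \<eta> * rfourier u \<eta> + h1 \<eta>))\<^sup>2" by (rule L2norm_power2[symmetric])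
  finally have 1: "E_star T \<epsilon> M ?z = (L2norm (\<lambda>\<eta>. w1 \<eta> * rfourier u \<eta> + h1 \<eta>))\<^sup>2" .
  have "(LINT x|lborel. \<bar>y x - yd2 x\<bar>\<^sup>2) = (L2norm (\<lambda>x. y x - yd2 x))\<^sup>2"
    by (simp add: L2norm_power2)
  also have "L2norm (\<lambda>x. y x - yd2 x) = L2norm (\<lambda>\<eta>. rfourier y \<eta> - rfourier yd2 \<eta>)"
    by (rule rfourier_norm_diff[OF y yd2(1), symmetric])
  also have "\<dots> = L2norm (\<lambda>\<eta>. w2 \<eta> * rfourier u \<eta> + h2 \<eta>)"
  proof (rule L2norm_cong_AE[OF L2_diff[OF rfourier_L2[OF y] rfourier_L2[OF yd2(1)]] A2])
    show "AE \<eta> in lborel. rfourier y \<eta> - rfourier yd2 \<eta> = w2 \<eta> * rfourier u \<eta> + h2 \<eta>"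
      using yf by eventually_elim (simp add: resolvent_def w2_def h2_def algebra_simps)
  qed
  finally have 2: "(LINT x|lborel. \<bar>y x - yd2 x\<bar>\<^sup>2) = (L2norm (\<lambda>\<eta>. w2 \<eta> * rfourier u \<eta> + h2 \<eta>))\<^sup>2" .
  have 3: "(LINT x|lborel. \<bar>u x\<bar>\<^sup>2) = (L2norm u)\<^sup>2" by (simp add: L2norm_power2)
  show ?thesis unfolding J_star_def reduced_def 1 2 3 ..
qed

lemma Uad_L2: "Uad \<subseteq> L2"
  using U_star_iff by blast

text \<open>The tracking terms are convex because both weights are nonnegative; the control cost satisfies the
  parallelogram law, which produces the strictly convex term.\<close>

lemma reduced_convex:
  assumes u: "u \<in> L2" and v: "v \<in> L2"
  shows "reduced (\<lambda>x. (1/2) *\<^sub>R (u x + v x)) + \<kappa> / 8 * (L2norm (\<lambda>x. u x - v x))\<^sup>2 \<le> (reduced u + reduced v) / 2"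
proof -
  have *: "m1 / 2 * a + m2 / 2 * b + k / 2 * c + k / 8 * d
      \<le> ((m1 / 2 * a' + m2 / 2 * b' + k / 2 * c') + (m1 / 2 * a'' + m2 / 2 * b'' + k / 2 * c'')) / 2"
    if "0 \<le> m1" "0 \<le> m2" "a \<le> (a' + a'') / 2" "b \<le> (b' + b'') / 2" "c + ((1/2) * q)\<^sup>2 = (c' + c'') / 2" "d = q\<^sup>2"
    for m1 m2 k a b c d q a' a'' b' b'' c' c'' :: real
  proof -
    have "m1 * a \<le> m1 * ((a' + a'') / 2)" "m2 * b \<le> m2 * ((b' + b'') / 2)"
      by (rule mult_left_mono[OF that(3,1)], rule mult_left_mono[OF that(4,2)])
    moreover have "((1/2) * q)\<^sup>2 = q\<^sup>2 / 4" by (simp add: power_mult_distrib power_divide)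
    then have "c = (c' + c'') / 2 - q\<^sup>2 / 4" using that(5) by argo
    then have "k * c = k * ((c' + c'') / 2 - q\<^sup>2 / 4)" by (rule arg_cong)
    ultimately show ?thesis using that(6) by (simp add: algebra_simps)
  qed
  have c: "(L2norm (\<lambda>x. (1/2) *\<^sub>R (u x + v x)))\<^sup>2 + ((1/2) * L2norm (\<lambda>x. u x - v x))\<^sup>2 = ((L2norm u)\<^sup>2 + (L2norm v)\<^sup>2) / 2"
  proof -
    have "L2norm (\<lambda>x. (1/2) *\<^sub>R (u x - v x)) = (1/2) * L2norm (\<lambda>x. u x - v x)" by (subst L2norm_scaleR) simp
    then show ?thesis using L2_parallelogram[OF u v] by (simp only:)
  qed
  show ?thesis
    unfolding reduced_def
    by (rule *[OF mu affine_square_mid[OF w1 h1 u v] affine_square_mid[OF w2 h2 u v] c refl])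
qed

lemma reduced_tendsto:
  assumes s: "\<And>n. s n \<in> L2" and v: "v \<in> L2" and lim: "(\<lambda>n. L2norm (\<lambda>x. s n x - v x)) \<longlonglongrightarrow> 0"
  shows "(\<lambda>n. reduced (s n)) \<longlonglongrightarrow> reduced v"
  unfolding reduced_def
  by (intro tendsto_intros affine_square_tendsto[OF w1 h1 s v lim] affine_square_tendsto[OF w2 h2 s v lim]
      L2norm_tendsto[OF s v lim])

theorem unique_optimum:
  "\<exists>u y. P_star_optimal T \<epsilon> M \<mu>1 \<mu>2 \<kappa> f yd1 yd2 Uad u y \<and>
    (\<forall>u' y'. P_star_optimal T \<epsilon> M \<mu>1 \<mu>2 \<kappa> f yd1 yd2 Uad u' y' \<longrightarrow>
      (AE x in lborel. u' x = u x) \<and> (AE x in lborel. y' x = y x))"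
proof -
  have nn: "0 \<le> reduced u" for u
    using mu kappa by (simp add: reduced_def)
  obtain u where u: "u \<in> Uad" "\<And>v. v \<in> Uad \<Longrightarrow> reduced u \<le> reduced v"
    "\<And>v. v \<in> Uad \<Longrightarrow> reduced v \<le> reduced u \<Longrightarrow> AE x in lborel. v x = u x"
  proof (rule L2_strictly_convex_minimizer[OF U_star_nonempty Uad_L2 U_star_closed, of "\<kappa> / 8" reduced])
    show "0 < \<kappa> / 8" using kappa by simp
    show "(\<lambda>x. (1/2) *\<^sub>R (u x + v x)) \<in> Uad" if "u \<in> Uad" "v \<in> Uad" for u v by (rule U_star_mid[OF that])
    show "reduced (\<lambda>x. (1/2) *\<^sub>R (u x + v x)) + \<kappa> / 8 * (L2norm (\<lambda>x. u x - v x))\<^sup>2 \<le> (reduced u + reduced v) / 2"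
      if "u \<in> Uad" "v \<in> Uad" for u v
      by (rule reduced_convex) (use that Uad_L2 in auto)
    show "(\<lambda>n. reduced (s n)) \<longlonglongrightarrow> reduced v"
      if "\<And>n. s n \<in> Uad" "v \<in> Uad" "(\<lambda>n. L2norm (\<lambda>x. s n x - v x)) \<longlonglongrightarrow> 0" for s and v :: "real^'n \<Rightarrow> real"
      by (rule reduced_tendsto[OF _ _ that(3)]) (use that(1,2) Uad_L2 in auto)
  qed (use nn in auto)
  have uL: "u \<in> L2" "fourier_supported_in K u" using u(1) U_star_iff by auto
  obtain y where y: "y \<in> Hk (2 * M)" "state_equation T \<epsilon> M f u y" by (rule state_exists[OF uL])
  have fe: "feasible u y" unfolding P_star_feasible_def using u(1) y by blast
  have opt: "P_star_optimal T \<epsilon> M \<mu>1 \<mu>2 \<kappa> f yd1 yd2 Uad u y"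
    unfolding P_star_optimal_def
  proof (intro conjI fe allI impI)
    fix u' y' assume fe': "feasible u' y'"
    then have "u' \<in> Uad" by (simp add: P_star_feasible_def)
    then show "J u y \<le> J u' y'" unfolding J_eq_reduced[OF fe] J_eq_reduced[OF fe'] by (rule u(2))
  qed
  have "(AE x in lborel. u' x = u x) \<and> (AE x in lborel. y' x = y x)"
    if o: "P_star_optimal T \<epsilon> M \<mu>1 \<mu>2 \<kappa> f yd1 yd2 Uad u' y'" for u' y'
  proof
    have fe': "feasible u' y'" and le: "J u' y' \<le> J u y" using o fe unfolding P_star_optimal_def by blast+
    have u': "u' \<in> Uad" "u' \<in> L2" "fourier_supported_in K u'" and y': "y' \<in> Hk (2 * M)" "state_equation T \<epsilon> M f u' y'"
      using fe' unfolding P_star_feasible_def U_star_iff by auto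
    show eq: "AE x in lborel. u' x = u x"
      using le unfolding J_eq_reduced[OF fe] J_eq_reduced[OF fe'] by (rule u(3)[OF u'(1)])
    have "AE \<eta> in lborel. rfourier u' \<eta> = rfourier u \<eta>" using eq rfourier_eq_iff[OF u'(2) uL(1)] by blast
    with state_fourier[OF u'(2,3) y'] state_fourier[OF uL y]
    have "AE \<eta> in lborel. rfourier y' \<eta> = rfourier y \<eta>" by eventually_elim (simp add: resolvent_def)
    then show "AE x in lborel. y' x = y x"
      using rfourier_eq_iff[of y' y] y'(1) y(1) by (simp add: Hk_def)
  qed
  with opt show ?thesis by blast
qed

end

theorem corollary2p9:
  fixes A :: "real^'n \<Rightarrow> real^'n^'n"
    and lam :: "nat \<Rightarrow> real^'n \<Rightarrow> real"
    and \<Phi> :: "nat \<Rightarrow> real^'n \<Rightarrow> real^'n \<Rightarrow> complex"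
    and T :: "'n tensors"
    and c \<mu>1 \<mu>2 \<kappa> \<epsilon>M :: real
    and f yd1 yd2 :: "real^'n \<Rightarrow> real"
    and K :: "(real^'n) set"
    and U :: "real \<Rightarrow> (real^'n \<Rightarrow> real) set"
    and M :: nat
  assumes "coefficient_field A"
    and "bloch_system A lam \<Phi>"
    and "effective_tensors (lam 0) T c"
    and "\<mu>1 \<ge> 0" and "\<mu>2 \<ge> 0" and "\<kappa> > 0"
    and "compact K" and "uminus ` K = K"
    and "f \<in> L2" and "fourier_supported_in K f"
    and "yd1 \<in> L2" and "fourier_supported_in K yd1"
    and "yd2 \<in> L2" and "fourier_supported_in K yd2"
    and "admissible_sets \<Phi> K U"
    and "M \<ge> 1"
    and "\<epsilon>M > 0"
    and "\<And>\<eta> \<epsilon> N. \<eta> \<in> K \<Longrightarrow> 0 < \<epsilon> \<Longrightarrow> \<epsilon> < \<epsilon>M \<Longrightarrow> 1 \<le> N \<Longrightarrow> N \<le> M \<Longrightarrow>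
          Psym T \<epsilon> N \<eta> \<ge> c / 2 * (norm \<eta>)\<^sup>2"
  shows "\<forall>\<epsilon>. 0 < \<epsilon> \<and> \<epsilon> < \<epsilon>M \<and> K \<subseteq> Zscaled \<epsilon> \<longrightarrow>
    (\<exists>u y. P_star_optimal T \<epsilon> M \<mu>1 \<mu>2 \<kappa> f yd1 yd2 (U_star \<Phi> K U \<epsilon>) u y \<and>
      (\<forall>u' y'. P_star_optimal T \<epsilon> M \<mu>1 \<mu>2 \<kappa> f yd1 yd2 (U_star \<Phi> K U \<epsilon>) u' y' \<longrightarrow>
        (AE x in lborel. u' x = u x) \<and> (AE x in lborel. y' x = y x)))"
proof (intro allI impI, elim conjE)
  fix \<epsilon> :: real
  assume \<epsilon>: "0 < \<epsilon>" "\<epsilon> < \<epsilon>M" "K \<subseteq> Zscaled \<epsilon>"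
  have "0 < c" using assms(3) by (simp add: effective_tensors_def)
  then have "0 \<le> Psym T \<epsilon> M \<eta>" if "\<eta> \<in> K" for \<eta>
    using assms(18)[OF that \<epsilon>(1,2) assms(16) order_refl] order_trans[of 0 "c / 2 * (norm \<eta>)\<^sup>2"] by simp
  then interpret effective_problem A lam \<Phi> K U \<epsilon> T M \<mu>1 \<mu>2 \<kappa> f yd1 yd2
    by unfold_locales (use assms \<epsilon> in auto)
  show "\<exists>u y. P_star_optimal T \<epsilon> M \<mu>1 \<mu>2 \<kappa> f yd1 yd2 (U_star \<Phi> K U \<epsilon>) u y \<and>
      (\<forall>u' y'. P_star_optimal T \<epsilon> M \<mu>1 \<mu>2 \<kappa> f yd1 yd2 (U_star \<Phi> K U \<epsilon>) u' y' \<longrightarrow>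
        (AE x in lborel. u' x = u x) \<and> (AE x in lborel. y' x = y x))"
    by (rule unique_optimum)
qed

end
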